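(* Let $N\ge1$ be an integer, let $\varphi,\psi\in\ell^1(\mathbb Z^N)$ be real functions and let $\tau\in\mathbb T$. Then $$\sigma_{\rm ess}\big(T^{N-1}_{\mu(\tau)\varphi}+V^{N-1}_{\mu(0)\psi}\big)=\bigcup_{j=2}^{N}\ \bigcup_{\tau'\in\mathbb T}\Sigma_j(\tau,\tau'),$$ where, for $j\in\{2,\dots,N\}$ and $\tau'\in\mathbb T$, $\Sigma_j(\tau,\tau')$ is the spectrum of the operator $T^{N-2}_{\nu_j(\tau')\mu(\tau)\varphi}+V^{N-2}_{\nu_j(0)\mu(0)\psi}$ acting in $\ell^2[(\mathbb N^* )^{N-2}]$.
   Context: All Hilbert spaces are complex. $\mathbb N^*:=\{1,2,\dots\}$, and $\mathbb T$ is the interval $[0,1]$ with $0$ identified to $1$. Toeplitz operators on $\ell^2[(\mathbb N^* )^k]$. Let $k\ge1$ and write $E=(\mathbb N^* )^k\subset\mathbb Z^k$. For $\eta\in\mathbb Z^k$ let $(u_\eta f)(\xi):=f(\xi-\eta)$ on $\ell^2(\mathbb Z^k)$, let $P^E:\ell^2(\mathbb Z^k)\to\ell^2(E)$ be the projection given by multiplication by the characteristic function of $E$, and set $v^E_\eta:=P^Eu_\eta\upharpoonright\ell^2(E)$. For $\varrho\in\ell^1(\mathbb Z^k)$ put $$T^k_\varrho:=\sum_{\eta\in\mathbb Z^k}\varrho(\eta)v^E_\eta,\qquad V^k_\varrho:=\sum_{\eta\in\mathbb Z^k}\varrho(\eta)v^E_\eta(v^E_\eta)^*,$$ bounded operators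 in $\ell^2(E)$. For $k=0$, $\mathbb Z^0=(\mathbb N^* )^0=\{0\}$, functions are scalars, and $T^0_\varrho=V^0_\varrho:=\varrho\,1$ in $\ell^2(\{0\})\equiv\mathbb C$. Partial Fourier transforms. Let $\theta^{-1}:\mathbb Z^N\to\mathbb Z^N$ be $\theta^{-1}(z_1,\dots,z_N)=(z_1,z_1+z_2,\dots,z_1+\dots+z_N)$. For $\rho\in\ell^1(\mathbb Z^N)$ and $\tau\in\mathbb T$ define $\mu(\tau)\rho\in\ell^1(\mathbb Z^{N-1})$ by $$[\mu(\tau)\rho](z_2,\dots,z_N):=\sum_{z_1\in\mathbb Z}e^{-2\pi iz_1\tau}(\rho\circ\theta^{-1})(z_1,z_2,\dots,z_N).$$ Variables in $\mathbb Z^{N-1}$ are labelled $z_2,\dots,z_N$. For $j\in\{2,\dots,N\}$, $\varrho\in\ell^1(\mathbb Z^{N-1})$ and $\tau'\in\mathbb T$ define $\nu_j(\tau')\varrho\in\ell^1(\mathbb Z^{N-2})$ by $$[\nu_j(\tau')\varrho](z_2,\dots,z_{j-1},z_{j+1},\dots,z_N):=\sum_{z_j\in\mathbb Z}e^{-2\pi iz_j\tau'}\varrho(z_2,\dots,z_N).$$ The essential spectrum $\sigma_{\rm ess}(A)$ of a bounded operator $A$ in a Hilbert space $\mathcal G$ is the spectrum of its image in the Calkin algebra $\mathscr B(\mathcal G)/\mathscr K(\mathcal G)$, where $\mathscr K(\mathcal G)$ is the ideal of compact operators. *)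

theory Defs
  imports "HOL-Analysis.Analysis" "HOL-Library.Function_Algebras" "HOL-Algebra.QuotRing"
begin

section \<open>The Hilbert space of square-summable families\<close>

typedef 'a ell2 = "{f :: 'a \<Rightarrow> complex. (\<lambda>x. (cmod (f x))\<^sup>2) summable_on UNIV}"
  morphisms coord Abs_ell2
  by (rule exI[of _ "\<lambda>_. 0"]) simp

setup_lifting type_definition_ell2

lemma coord_summable: "(\<lambda>x. (cmod (coord f x))\<^sup>2) summable_on A"
  using coord[of f] summable_on_subset_banach by blast

lemma coord_inject_ext: "(\<And>x. coord f x = coord g x) \<Longrightarrow> f = g"
  by (simp add: coord_inject[symmetric] ext)

lemma sq_summable_comparison:
  assumes "g summable_on A" "\<And>x. x \<in> A \<Longrightarrow> (cmod (f x))\<^sup>2 \<le> g x"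
  shows "(\<lambda>x. (cmod (f x))\<^sup>2) summable_on A"
  by (rule summable_on_comparison_test[OF assms]) auto

lemma cmod_add_sq_le: "(cmod (a + b))\<^sup>2 \<le> 2 * (cmod a)\<^sup>2 + 2 * (cmod b)\<^sup>2"
proof -
  have "(cmod (a + b))\<^sup>2 \<le> (cmod a + cmod b)\<^sup>2"
    by (intro power_mono norm_triangle_ineq) auto
  also have "\<dots> \<le> 2 * (cmod a)\<^sup>2 + 2 * (cmod b)\<^sup>2"
    using zero_le_power2[of "cmod a - cmod b"] by (simp add: power2_eq_square algebra_simps)
  finally show ?thesis .
qed

instantiation ell2 :: (type) real_vector
begin

lift_definition zero_ell2 :: "'a ell2" is "\<lambda>_. 0" by simp

lift_definition plus_ell2 :: "'a ell2 \<Rightarrow> 'a ell2 \<Rightarrow> 'a ell2" is "\<lambda>f g x. f x + g x"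
  by (rule sq_summable_comparison[OF _ cmod_add_sq_le])
     (intro summable_on_add summable_on_cmult_right; simp)

lift_definition uminus_ell2 :: "'a ell2 \<Rightarrow> 'a ell2" is "\<lambda>f x. - f x" by simp

lift_definition minus_ell2 :: "'a ell2 \<Rightarrow> 'a ell2 \<Rightarrow> 'a ell2" is "\<lambda>f g x. f x - g x"
proof -
  fix f g :: "'a \<Rightarrow> complex"
  assume "(\<lambda>x. (cmod (f x))\<^sup>2) summable_on UNIV" "(\<lambda>x. (cmod (g x))\<^sup>2) summable_on UNIV"
  then have "(\<lambda>x. 2 * (cmod (f x))\<^sup>2 + 2 * (cmod (- g x))\<^sup>2) summable_on UNIV"
    by (intro summable_on_add summable_on_cmult_right) simp_all
  then show "(\<lambda>x. (cmod (f x - g x))\<^sup>2) summable_on UNIV"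
    by (rule sq_summable_comparison) (use cmod_add_sq_le[of "f _" "- g _"] in simp)
qed

lift_definition scaleR_ell2 :: "real \<Rightarrow> 'a ell2 \<Rightarrow> 'a ell2" is "\<lambda>r f x. of_real r * f x"
  by (simp add: norm_mult power_mult_distrib summable_on_cmult_right)

instance
  by standard (transfer; simp add: fun_eq_iff algebra_simps)+

end

lift_definition scaleC :: "complex \<Rightarrow> 'a ell2 \<Rightarrow> 'a ell2" is "\<lambda>c f x. c * f x"
  by (simp add: norm_mult power_mult_distrib summable_on_cmult_right)

definition cinner :: "'a ell2 \<Rightarrow> 'a ell2 \<Rightarrow> complex"
  where "cinner f g = (\<Sum>\<^sub>\<infinity>x. cnj (coord f x) * coord g x)"

lemma cinner_abs_summable: "(\<lambda>x. norm (cnj (coord f x) * coord g x)) summable_on UNIV"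
proof (rule Infinite_Sum.abs_summable_on_comparison_test')
  show "(\<lambda>x. (cmod (coord f x))\<^sup>2 + (cmod (coord g x))\<^sup>2) summable_on UNIV"
    by (intro summable_on_add coord_summable)
  show "norm (cnj (coord f x) * coord g x) \<le> (cmod (coord f x))\<^sup>2 + (cmod (coord g x))\<^sup>2" for x
  proof -
    have "2 * (cmod (coord f x) * cmod (coord g x)) \<le> (cmod (coord f x))\<^sup>2 + (cmod (coord g x))\<^sup>2"
      using sum_squares_bound[of "cmod (coord f x)" "cmod (coord g x)"] by simp
    moreover have "0 \<le> cmod (coord f x) * cmod (coord g x)" by simp
    ultimately show ?thesis unfolding norm_mult complex_mod_cnj by linarith
  qed
qed

lemma cinner_summable: "(\<lambda>x. cnj (coord f x) * coord g x) summable_on UNIV"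
  by (rule abs_summable_summable[OF cinner_abs_summable])

lemma cinner_add_left: "cinner (f + g) h = cinner f h + cinner g h"
  using infsum_add[OF cinner_summable[of f h] cinner_summable[of g h]]
  by (simp add: cinner_def plus_ell2.rep_eq algebra_simps)

lemma cinner_commute: "cinner f g = cnj (cinner g f)"
  unfolding cinner_def infsum_cnj[symmetric] by (simp add: mult.commute)

lemma cinner_self: "cinner f f = of_real (\<Sum>\<^sub>\<infinity>x. (cmod (coord f x))\<^sup>2)"
proof -
  have "cinner f f = (\<Sum>\<^sub>\<infinity>x. complex_of_real ((cmod (coord f x))\<^sup>2))"
    unfolding cinner_def by (simp only: complex_norm_square mult.commute)
  also have "\<dots> = of_real (\<Sum>\<^sub>\<infinity>x. (cmod (coord f x))\<^sup>2)"
    by (intro infsumI has_sum_of_real has_sum_infsum coord_summable)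
  finally show ?thesis .
qed

instantiation ell2 :: (type) real_inner
begin

definition norm_ell2 :: "'a ell2 \<Rightarrow> real"
  where "norm_ell2 f = sqrt (\<Sum>\<^sub>\<infinity>x. (cmod (coord f x))\<^sup>2)"

definition inner_ell2 :: "'a ell2 \<Rightarrow> 'a ell2 \<Rightarrow> real"
  where "inner_ell2 f g = Re (cinner f g)"

definition sgn_ell2 :: "'a ell2 \<Rightarrow> 'a ell2"
  where "sgn_ell2 f = f /\<^sub>R norm f"

definition dist_ell2 :: "'a ell2 \<Rightarrow> 'a ell2 \<Rightarrow> real"
  where "dist_ell2 f g = norm (f - g)"

definition uniformity_ell2 :: "('a ell2 \<times> 'a ell2) filter"
  where "uniformity_ell2 = (INF e\<in>{0<..}. principal {(x, y). dist x y < e})"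

definition open_ell2 :: "'a ell2 set \<Rightarrow> bool"
  where "open_ell2 U \<longleftrightarrow> (\<forall>x\<in>U. eventually (\<lambda>(x', y). x' = x \<longrightarrow> y \<in> U) uniformity)"

instance
proof
  fix f g h :: "'a ell2" and r :: real
  show "inner f g = inner g f"
    unfolding inner_ell2_def by (subst cinner_commute) simp
  show "inner (f + g) h = inner f h + inner g h"
    by (simp add: inner_ell2_def cinner_add_left)
  have "cinner (r *\<^sub>R f) g = of_real r * cinner f g"
    unfolding cinner_def scaleR_ell2.rep_eq by (simp add: mult.assoc infsum_cmult_right')
  then show "inner (r *\<^sub>R f) g = r * inner f g"
    by (simp add: inner_ell2_def)
  have sq: "inner f f = (\<Sum>\<^sub>\<infinity>x. (cmod (coord f x))\<^sup>2)"
    by (simp add: inner_ell2_def cinner_self)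
  show "0 \<le> inner f f"
    unfolding sq by (rule infsum_nonneg) simp
  show "inner f f = 0 \<longleftrightarrow> f = 0"
  proof
    assume "inner f f = 0"
    then have "(cmod (coord f x))\<^sup>2 = 0" for x
      unfolding sq by (intro nonneg_infsum_le_0D[OF _ coord_summable[of f UNIV]]) auto
    then show "f = 0"
      by (intro coord_inject_ext) (simp add: zero_ell2.rep_eq)
  qed (unfold sq, simp add: zero_ell2.rep_eq)
  show "norm f = sqrt (inner f f)"
    by (simp add: sq norm_ell2_def)
qed (fact sgn_ell2_def dist_ell2_def uniformity_ell2_def open_ell2_def)+

end

lemma norm_ell2_sq: "(norm f)\<^sup>2 = (\<Sum>\<^sub>\<infinity>x. (cmod (coord f x))\<^sup>2)"
  by (simp add: norm_ell2_def infsum_nonneg)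

lemma sum_coord_le: "finite F \<Longrightarrow> (\<Sum>x\<in>F. (cmod (coord f x))\<^sup>2) \<le> (norm f)\<^sup>2"
  unfolding norm_ell2_sq by (rule finite_sum_le_infsum[OF coord_summable]) auto

lemma cmod_coord_le: "cmod (coord f x) \<le> norm f"
  using sum_coord_le[of "{x}" f] by (simp add: power2_le_iff_abs_le)

lemma norm_ell2_leI:
  assumes "\<And>F. finite F \<Longrightarrow> (\<Sum>x\<in>F. (cmod (coord f x))\<^sup>2) \<le> b\<^sup>2" "0 \<le> b"
  shows "norm f \<le> b"
proof -
  have "(norm f)\<^sup>2 \<le> b\<^sup>2"
    unfolding norm_ell2_sq using assms by (intro infsum_le_finite_sums coord_summable) auto
  then show ?thesis using assms(2) by (simp add: power2_le_iff_abs_le)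
qed

instance ell2 :: (type) banach
proof
  fix X :: "nat \<Rightarrow> 'a ell2"
  assume X: "Cauchy X"
  define g where "g x = lim (\<lambda>n. coord (X n) x)" for x
  have g: "(\<lambda>n. coord (X n) x) \<longlonglongrightarrow> g x" for x
  proof -
    have "Cauchy (\<lambda>n. coord (X n) x)"
    proof (rule metric_CauchyI)
      fix e :: real assume "0 < e"
      then obtain M where M: "\<And>m n. m \<ge> M \<Longrightarrow> n \<ge> M \<Longrightarrow> dist (X m) (X n) < e"
        using metric_CauchyD[OF X] by blast
      have "dist (coord (X m) x) (coord (X n) x) \<le> dist (X m) (X n)" for m n
        using cmod_coord_le[of "X m - X n" x] by (simp add: dist_norm minus_ell2.rep_eq)
      then show "\<exists>M. \<forall>m\<ge>M. \<forall>n\<ge>M. dist (coord (X m) x) (coord (X n) x) < e"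
        using M by (meson le_less_trans)
    qed
    then show ?thesis
      unfolding g_def by (simp add: Cauchy_convergent_iff convergent_LIMSEQ_iff)
  qed
  have bound: "(\<Sum>x\<in>F. (cmod (coord (X m) x - g x))\<^sup>2) \<le> e\<^sup>2"
    if "\<And>n. n \<ge> M \<Longrightarrow> dist (X m) (X n) < e" "finite F" for F m M and e :: real
  proof (rule LIMSEQ_le_const2)
    show "(\<lambda>n. \<Sum>x\<in>F. (cmod (coord (X m) x - coord (X n) x))\<^sup>2)
            \<longlonglongrightarrow> (\<Sum>x\<in>F. (cmod (coord (X m) x - g x))\<^sup>2)"
      by (intro tendsto_intros g)
    have "(\<Sum>x\<in>F. (cmod (coord (X m) x - coord (X n) x))\<^sup>2) \<le> e\<^sup>2" if "n \<ge> M" for n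
    proof -
      have "(\<Sum>x\<in>F. (cmod (coord (X m) x - coord (X n) x))\<^sup>2) \<le> (norm (X m - X n))\<^sup>2"
        using sum_coord_le[OF \<open>finite F\<close>, of "X m - X n"] by (simp add: minus_ell2.rep_eq)
      also have "\<dots> \<le> e\<^sup>2"
        using \<open>\<And>n. n \<ge> M \<Longrightarrow> dist (X m) (X n) < e\<close>[OF that]
        by (intro power_mono) (auto simp: dist_norm)
      finally show ?thesis .
    qed
    then show "\<exists>M. \<forall>n\<ge>M. (\<Sum>x\<in>F. (cmod (coord (X m) x - coord (X n) x))\<^sup>2) \<le> e\<^sup>2" by blast
  qed
  obtain M where M: "\<And>m n. m \<ge> M \<Longrightarrow> n \<ge> M \<Longrightarrow> dist (X m) (X n) < 1"
    using metric_CauchyD[OF X, of 1] by auto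
  have "(\<lambda>x. (cmod (coord (X M) x - g x))\<^sup>2) summable_on UNIV"
    by (rule nonneg_bdd_above_summable_on) (auto intro!: bdd_aboveI[of _ "1\<^sup>2"] bound M)
  then have mem: "(\<lambda>x. coord (X M) x - g x) \<in> {f. (\<lambda>x. (cmod (f x))\<^sup>2) summable_on UNIV}"
    by simp
  define L where "L = X M - Abs_ell2 (\<lambda>x. coord (X M) x - g x)"
  have L: "coord L x = g x" for x
    unfolding L_def minus_ell2.rep_eq by (subst Abs_ell2_inverse[OF mem]) simp
  have "X \<longlonglongrightarrow> L"
  proof (rule metric_LIMSEQ_I)
    fix e :: real assume e: "0 < e"
    then obtain M where M: "\<And>m n. m \<ge> M \<Longrightarrow> n \<ge> M \<Longrightarrow> dist (X m) (X n) < e / 2"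
      using metric_CauchyD[OF X, of "e / 2"] by auto
    have "norm (X m - L) \<le> e / 2" if "m \<ge> M" for m
      using e bound[OF M[OF that]] by (intro norm_ell2_leI) (auto simp: minus_ell2.rep_eq L)
    then show "\<exists>M. \<forall>n\<ge>M. dist (X n) L < e"
      using e by (fastforce simp: dist_norm intro!: exI[of _ M])
  qed
  then show "convergent X" by (rule convergentI)
qed

lemma norm_ell2_mono:
  assumes "\<And>x. cmod (coord f x) \<le> cmod (coord g x)"
  shows "norm f \<le> norm g"
  unfolding norm_ell2_def
  by (intro real_sqrt_le_mono infsum_mono coord_summable power_mono assms) auto

lemma norm_scaleC: "norm (scaleC c f) = cmod c * norm f"
  unfolding norm_ell2_def scaleC.rep_eq
  by (simp add: norm_mult power_mult_distrib infsum_cmult_right' real_sqrt_mult)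


section \<open>Bounded operators, spectrum and essential spectrum\<close>

type_synonym 'a op = "'a ell2 \<Rightarrow>\<^sub>L 'a ell2"

definition complex_linear :: "'a op \<Rightarrow> bool"
  where "complex_linear A \<longleftrightarrow> (\<forall>c f. blinfun_apply A (scaleC c f) = scaleC c (blinfun_apply A f))"

lift_definition scalar :: "complex \<Rightarrow> 'a op" is scaleC
proof (rule bounded_linear_intro)
  show "scaleC c (f + g) = scaleC c f + scaleC c g" for c and f g :: "'a ell2"
    by transfer (simp add: algebra_simps)
  show "scaleC c (r *\<^sub>R f) = r *\<^sub>R scaleC c f" for c r and f :: "'a ell2"
    by transfer (simp add: algebra_simps)
  show "norm (scaleC c f) \<le> norm f * cmod c" for c and f :: "'a ell2"
    by (simp add: norm_scaleC)
qed

lift_definition restr :: "'a set \<Rightarrow> 'a ell2 \<Rightarrow> 'a ell2" is "\<lambda>E f x. if x \<in> E then f x else 0"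
  by (erule sq_summable_comparison) auto

lift_definition proj :: "'a set \<Rightarrow> 'a op" is restr
proof (rule bounded_linear_intro[where K = 1])
  show "restr E (f + g) = restr E f + restr E g" for E and f g :: "'a ell2"
    by transfer auto
  show "restr E (r *\<^sub>R f) = r *\<^sub>R restr E f" for E r and f :: "'a ell2"
    by transfer auto
  show "norm (restr E f) \<le> norm f * 1" for E and f :: "'a ell2"
    by simp (rule norm_ell2_mono, simp add: restr.rep_eq)
qed

text \<open>
  \<open>\<ell>\<^sup>2(E)\<close> is the range of \<^term>\<open>proj E\<close>, and the algebra of bounded operators in \<open>\<ell>\<^sup>2(E)\<close> is
  identified with the corner \<open>P\<^sup>E \<B> P\<^sup>E\<close> of the algebra \<open>\<B>\<close> of bounded operators in the
  ambient space: an operator in \<open>\<ell>\<^sup>2(E)\<close> is extended by zero to the orthogonal complement.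
  Thus the unit is \<^term>\<open>proj E\<close>, and invertibility and compactness have their usual
  meaning in \<open>\<ell>\<^sup>2(E)\<close>.
\<close>

definition bop_alg :: "'a set \<Rightarrow> 'a op ring"
  where "bop_alg E =
    \<lparr>carrier = {A. complex_linear A \<and> proj E o\<^sub>L A o\<^sub>L proj E = A},
     mult = (o\<^sub>L), one = proj E, zero = 0, add = (+)\<rparr>"

definition compact_ops :: "'a set \<Rightarrow> 'a op set"
  where "compact_ops E =
    {K \<in> carrier (bop_alg E). compact (closure (blinfun_apply K ` cball 0 1))}"

definition calkin :: "'a set \<Rightarrow> 'a op set ring"
  where "calkin E = bop_alg E Quot compact_ops E"

definition calkin_map :: "'a set \<Rightarrow> 'a op \<Rightarrow> 'a op set"
  where "calkin_map E A = compact_ops E +>\<^bsub>bop_alg E\<^esub> A"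

text \<open>
  Spectrum of \<open>a\<close> in a unital ring \<open>R\<close> whose complex scalar multiples of the unit are given
  by \<open>e\<close>. In the zero ring every element is a unit and all spectra are empty.
\<close>

definition alg_spectrum :: "('b, 'm) ring_scheme \<Rightarrow> (complex \<Rightarrow> 'b) \<Rightarrow> 'b \<Rightarrow> complex set"
  where "alg_spectrum R e a = {z. a \<ominus>\<^bsub>R\<^esub> e z \<notin> Units R}"

definition spectrum :: "'a set \<Rightarrow> 'a op \<Rightarrow> complex set"
  where "spectrum E A = alg_spectrum (bop_alg E) (\<lambda>z. scalar z o\<^sub>L proj E) A"

definition ess_spectrum :: "'a set \<Rightarrow> 'a op \<Rightarrow> complex set"
  where "ess_spectrum E A =
    alg_spectrum (calkin E) (\<lambda>z. calkin_map E (scalar z o\<^sub>L proj E)) (calkin_map E A)"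

lemma blinfun_compose_assoc': "(A o\<^sub>L B) o\<^sub>L C = A o\<^sub>L (B o\<^sub>L C)"
  by (rule blinfun_eqI) simp

definition hilbert_adjoint :: "'a op \<Rightarrow> 'a op"
  where "hilbert_adjoint A =
    (THE B. \<forall>f g. cinner (blinfun_apply B f) g = cinner f (blinfun_apply A g))"

lemma complex_linear_compose: "complex_linear A \<Longrightarrow> complex_linear B \<Longrightarrow> complex_linear (A o\<^sub>L B)"
  by (simp add: complex_linear_def)

lemma complex_linear_scalar: "complex_linear (scalar c)"
  unfolding complex_linear_def scalar.rep_eq by transfer (simp add: algebra_simps)

lemma complex_linear_proj: "complex_linear (proj E)"
  unfolding complex_linear_def proj.rep_eq by transfer auto

lemma complex_linear_plus: "complex_linear A \<Longrightarrow> complex_linear B \<Longrightarrow> complex_linear (A + B)"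
  using linear_add[of "blinfun_apply (scalar _)"]
  by (simp add: complex_linear_def blinfun.bilinear_simps scalar.rep_eq[symmetric])

lemma complex_linear_uminus: "complex_linear A \<Longrightarrow> complex_linear (- A)"
  by (simp add: complex_linear_def blinfun.bilinear_simps scalar.rep_eq[symmetric])

lemma proj_proj: "proj E o\<^sub>L proj E = proj E"
  by (rule blinfun_eqI, simp add: proj.rep_eq, transfer) auto

lemma corner_iff:
  "proj E o\<^sub>L A o\<^sub>L proj E = A \<longleftrightarrow> proj E o\<^sub>L A = A \<and> A o\<^sub>L proj E = A"
  by (metis proj_proj blinfun_compose_assoc')

lemma bop_alg_simps:
  "A \<in> carrier (bop_alg E) \<longleftrightarrow> complex_linear A \<and> proj E o\<^sub>L A = A \<and> A o\<^sub>L proj E = A"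
  "A \<otimes>\<^bsub>bop_alg E\<^esub> B = A o\<^sub>L B" "\<one>\<^bsub>bop_alg E\<^esub> = proj E"
  "A \<oplus>\<^bsub>bop_alg E\<^esub> B = A + B" "\<zero>\<^bsub>bop_alg E\<^esub> = 0"
  by (simp_all add: bop_alg_def corner_iff)

lemma comp_absorb_left: "A o\<^sub>L B = B \<Longrightarrow> A o\<^sub>L (B o\<^sub>L C) = B o\<^sub>L C"
  by (simp add: blinfun_compose_assoc'[symmetric])

lemma scalar_proj_carrier: "scalar z o\<^sub>L proj E \<in> carrier (bop_alg E)"
proof -
  have "proj E o\<^sub>L (scalar z o\<^sub>L proj E) = scalar z o\<^sub>L proj E"
    by (rule blinfun_eqI, simp add: proj.rep_eq scalar.rep_eq, transfer) auto
  then show ?thesis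
    by (simp add: bop_alg_simps complex_linear_compose complex_linear_scalar
        complex_linear_proj blinfun_compose_assoc' proj_proj)
qed

lemmas blinfun_compose_bilinear =
  bounded_bilinear.add_left[OF bounded_bilinear_blinfun_compose]
  bounded_bilinear.add_right[OF bounded_bilinear_blinfun_compose]
  bounded_bilinear.minus_left[OF bounded_bilinear_blinfun_compose]
  bounded_bilinear.minus_right[OF bounded_bilinear_blinfun_compose]

lemma complex_linear_zero: "complex_linear 0"
  by (simp add: complex_linear_def) (simp add: blinfun.bilinear_simps scalar.rep_eq[symmetric])

lemma ring_bop_alg: "ring (bop_alg E)"
proof (intro ringI abelian_groupI monoidI)
  show "\<exists>B\<in>carrier (bop_alg E). B \<oplus>\<^bsub>bop_alg E\<^esub> A = \<zero>\<^bsub>bop_alg E\<^esub>"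
    if "A \<in> carrier (bop_alg E)" for A
    using that complex_linear_uminus
    by (intro bexI[of _ "- A"]) (auto simp: bop_alg_simps blinfun_compose_bilinear)
qed (auto simp: bop_alg_simps blinfun_compose_bilinear complex_linear_compose comp_absorb_left
    complex_linear_plus complex_linear_proj complex_linear_zero proj_proj
    blinfun_compose_assoc' add.assoc add.commute)

lemma compact_closure_mono:
  fixes S T :: "'b::metric_space set"
  shows "compact T \<Longrightarrow> S \<subseteq> T \<Longrightarrow> compact (closure S)"
  by (metis closed_Int_compact closed_closure closure_minimal compact_imp_closed inf.absorb1)

lemma compact_comp_left:
  fixes A K :: "'a op"
  assumes "compact (closure (blinfun_apply K ` cball 0 1))"
  shows "compact (closure (blinfun_apply (A o\<^sub>L K) ` cball 0 1))"
proof (rule compact_closure_mono)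
  show "compact (blinfun_apply A ` closure (blinfun_apply K ` cball 0 1))"
    by (intro compact_continuous_image assms continuous_intros)
  have "blinfun_apply A ` (blinfun_apply K ` cball 0 1) \<subseteq> blinfun_apply A ` closure (blinfun_apply K ` cball 0 1)"
    by (rule image_mono[OF closure_subset])
  then show "blinfun_apply (A o\<^sub>L K) ` cball 0 1 \<subseteq> blinfun_apply A ` closure (blinfun_apply K ` cball 0 1)"
    by (simp add: image_image)
qed

lemma compact_comp_right:
  fixes A K :: "'a op"
  assumes "compact (closure (blinfun_apply K ` cball 0 1))"
  shows "compact (closure (blinfun_apply (K o\<^sub>L A) ` cball 0 1))"
proof (rule compact_closure_mono)
  define r where "r = norm A + 1"
  have r: "0 < r" by (simp add: r_def add_nonneg_pos)
  show "compact ((*\<^sub>R) r ` closure (blinfun_apply K ` cball 0 1))"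
    by (intro compact_scaling assms)
  show "blinfun_apply (K o\<^sub>L A) ` cball 0 1 \<subseteq> (*\<^sub>R) r ` closure (blinfun_apply K ` cball 0 1)"
  proof clarsimp
    fix f :: "'a ell2" assume f: "norm f \<le> 1"
    have "norm (blinfun_apply A f) \<le> norm A * norm f" by (rule norm_blinfun)
    also have "\<dots> \<le> norm A * 1" using f by (intro mult_left_mono) auto
    finally have "norm (blinfun_apply A f) \<le> r" by (simp add: r_def)
    then have "(1 / r) *\<^sub>R blinfun_apply A f \<in> cball 0 1"
      using r by (simp add: field_simps)
    then have "blinfun_apply K ((1 / r) *\<^sub>R blinfun_apply A f) \<in> closure (blinfun_apply K ` cball 0 1)"
      by (rule subsetD[OF closure_subset imageI])
    moreover have "blinfun_apply K (blinfun_apply A f) =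
        r *\<^sub>R blinfun_apply K ((1 / r) *\<^sub>R blinfun_apply A f)"
      using r by (simp add: blinfun.scaleR_right)
    ultimately show "blinfun_apply K (blinfun_apply A f)
        \<in> (*\<^sub>R) r ` closure (blinfun_apply K ` cball 0 1)" by (rule rev_image_eqI)
  qed
qed

lemma compact_plus:
  fixes K L :: "'a op"
  assumes "compact (closure (blinfun_apply K ` cball 0 1))"
    and "compact (closure (blinfun_apply L ` cball 0 1))"
  shows "compact (closure (blinfun_apply (K + L) ` cball 0 1))"
proof (rule compact_closure_mono)
  show "compact {x + y | x y. x \<in> closure (blinfun_apply K ` cball 0 1) \<and>
                              y \<in> closure (blinfun_apply L ` cball 0 1)}"
    by (rule compact_sums[OF assms])
  show "blinfun_apply (K + L) ` cball 0 1 \<subseteq> {x + y | x y.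
      x \<in> closure (blinfun_apply K ` cball 0 1) \<and> y \<in> closure (blinfun_apply L ` cball 0 1)}"
  proof (rule image_subsetI)
    fix f :: "'a ell2" assume "f \<in> cball 0 1"
    then have "blinfun_apply K f \<in> closure (blinfun_apply K ` cball 0 1)"
      "blinfun_apply L f \<in> closure (blinfun_apply L ` cball 0 1)"
      by (rule subsetD[OF closure_subset imageI])+
    then show "blinfun_apply (K + L) f \<in> {x + y | x y.
      x \<in> closure (blinfun_apply K ` cball 0 1) \<and> y \<in> closure (blinfun_apply L ` cball 0 1)}"
      unfolding blinfun.add_left by blast
  qed
qed

lemma compact_uminus:
  fixes K :: "'a op"
  assumes "compact (closure (blinfun_apply K ` cball 0 1))"
  shows "compact (closure (blinfun_apply (- K) ` cball 0 1))"
  using compact_comp_left[OF assms, of "- id_blinfun"]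
  by (simp add: blinfun_compose_bilinear(3) blinfun.minus_left o_def image_def)

lemma ideal_compact_ops: "ideal (compact_ops E) (bop_alg E)"
proof -
  interpret ring "bop_alg E" by (rule ring_bop_alg)
  have neg: "\<ominus>\<^bsub>bop_alg E\<^esub> A = - A" if "A \<in> carrier (bop_alg E)" for A
    using that complex_linear_uminus[of A]
    by (intro minus_equality) (auto simp: bop_alg_simps blinfun_compose_bilinear)
  have closed: "A + B \<in> carrier (bop_alg E)" "A o\<^sub>L B \<in> carrier (bop_alg E)"
    if "A \<in> carrier (bop_alg E)" "B \<in> carrier (bop_alg E)" for A B
    using a_closed[OF that] m_closed[OF that] by (simp_all only: bop_alg_simps(2,4))
  have zero: "(0 :: 'a op) \<in> compact_ops E"
    using zero_closed by (simp add: compact_ops_def bop_alg_simps(5) image_constant_conv)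
  show ?thesis
  proof (intro idealI ring_bop_alg group.subgroupI[OF a_group])
    show "compact_ops E \<subseteq> carrier (add_monoid (bop_alg E))"
      by (auto simp: compact_ops_def)
    show "compact_ops E \<noteq> {}" using zero by blast
    show "inv\<^bsub>add_monoid (bop_alg E)\<^esub> K \<in> compact_ops E" if "K \<in> compact_ops E" for K
    proof -
      have K: "K \<in> carrier (bop_alg E)" using that by (simp add: compact_ops_def)
      have "inv\<^bsub>add_monoid (bop_alg E)\<^esub> K = - K"
        using neg[OF K] by (simp add: a_inv_def)
      then show ?thesis
        using that a_inv_closed[OF K] neg[OF K] compact_uminus[of K] by (simp add: compact_ops_def)
    qed
  qed (use closed compact_plus compact_comp_left compact_comp_right in
      \<open>auto simp: compact_ops_def bop_alg_simps(2,4)\<close>)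
qed


section \<open>Toeplitz operators\<close>

text \<open>
  \<open>\<int>\<^sup>k\<close> with coordinates labelled by a finite set \<open>J\<close> of cardinality \<open>k\<close> consists of the
  functions vanishing off \<open>J\<close>; in particular \<^term>\<open>ZZ {} = {0}\<close>. Labelling by \<open>J\<close> rather than
  by \<open>{1..k}\<close> accommodates the partial Fourier transforms, whose results
  have coordinates labelled by \<open>{2..N}\<close> and \<open>{2..N} - {j}\<close>.
\<close>

definition ZZ :: "nat set \<Rightarrow> (nat \<Rightarrow> int) set"
  where "ZZ J = {z. \<forall>i. i \<notin> J \<longrightarrow> z i = 0}"

definition NN :: "nat set \<Rightarrow> (nat \<Rightarrow> int) set"
  where "NN J = {z \<in> ZZ J. \<forall>i\<in>J. 1 \<le> z i}"

lift_definition translate :: "'a::ab_group_add \<Rightarrow> 'a ell2 \<Rightarrow> 'a ell2" is "\<lambda>\<eta> f \<xi>. f (\<xi> - \<eta>)"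
proof -
  fix \<eta> :: 'a and f :: "'a \<Rightarrow> complex"
  assume "(\<lambda>x. (cmod (f x))\<^sup>2) summable_on UNIV"
  then show "(\<lambda>\<xi>. (cmod (f (\<xi> - \<eta>)))\<^sup>2) summable_on UNIV"
    using summable_on_reindex_bij_betw[OF bij_diff_right, of "\<lambda>x. (cmod (f x))\<^sup>2" \<eta>] by simp
qed

lemma norm_translate: "norm (translate \<eta> f) = norm f"
  unfolding norm_ell2_def translate.rep_eq
  using infsum_reindex_bij_betw[OF bij_diff_right, of "\<lambda>x. (cmod (coord f x))\<^sup>2" \<eta>] by simp

lift_definition shift :: "'a::ab_group_add \<Rightarrow> 'a op" is translate
proof (rule bounded_linear_intro[where K = 1])
  show "translate \<eta> (f + g) = translate \<eta> f + translate \<eta> g" for \<eta> and f g :: "'a ell2"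
    by transfer simp
  show "translate \<eta> (r *\<^sub>R f) = r *\<^sub>R translate \<eta> f" for \<eta> r and f :: "'a ell2"
    by transfer simp
  show "norm (translate \<eta> f) \<le> norm f * 1" for \<eta> and f :: "'a ell2"
    by (simp add: norm_translate)
qed

definition trunc_shift :: "'a::ab_group_add set \<Rightarrow> 'a \<Rightarrow> 'a op"
  where "trunc_shift E \<eta> = proj E o\<^sub>L shift \<eta> o\<^sub>L proj E"

text \<open>The sums below are over \<open>\<int>\<^sup>k\<close> and converge absolutely in operator norm when \<open>\<rho>\<close> is in \<open>\<ell>\<^sup>1\<close>.\<close>

definition toeplitz_T :: "nat set \<Rightarrow> ((nat \<Rightarrow> int) \<Rightarrow> complex) \<Rightarrow> (nat \<Rightarrow> int) op"
  where "toeplitz_T J \<rho> = (\<Sum>\<^sub>\<infinity>\<eta>\<in>ZZ J. scalar (\<rho> \<eta>) o\<^sub>L trunc_shift (NN J) \<eta>)"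

definition toeplitz_V :: "nat set \<Rightarrow> ((nat \<Rightarrow> int) \<Rightarrow> complex) \<Rightarrow> (nat \<Rightarrow> int) op"
  where "toeplitz_V J \<rho> = (\<Sum>\<^sub>\<infinity>\<eta>\<in>ZZ J. scalar (\<rho> \<eta>) o\<^sub>L
      (trunc_shift (NN J) \<eta> o\<^sub>L hilbert_adjoint (trunc_shift (NN J) \<eta>)))"

lemma hilbert_adjointI:
  assumes "\<And>f g. cinner (blinfun_apply B f) g = cinner f (blinfun_apply A g)"
  shows "hilbert_adjoint A = B"
  unfolding hilbert_adjoint_def
proof (rule the_equality)
  fix C assume C: "\<forall>f g. cinner (blinfun_apply C f) g = cinner f (blinfun_apply A g)"
  show "C = B"
  proof (rule blinfun_eqI)
    fix f
    let ?d = "blinfun_apply C f - blinfun_apply B f"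
    have "inner ?d ?d = 0"
      unfolding inner_diff_left[of _ _ ?d] using C assms by (simp add: inner_ell2_def)
    then show "blinfun_apply C f = blinfun_apply B f" by simp
  qed
qed (use assms in blast)

lemma hilbert_adjoint_trunc_shift: "hilbert_adjoint (trunc_shift E \<eta>) = trunc_shift E (- \<eta>)"
proof (rule hilbert_adjointI)
  fix f g :: "'a ell2"
  let ?h = "\<lambda>\<xi>. cnj (if \<xi> \<in> E then if \<xi> + \<eta> \<in> E then coord f (\<xi> + \<eta>) else 0 else 0) * coord g \<xi>"
  have "cinner (blinfun_apply (trunc_shift E (- \<eta>)) f) g = (\<Sum>\<^sub>\<infinity>\<xi>. ?h \<xi>)"
    by (simp add: cinner_def trunc_shift_def proj.rep_eq shift.rep_eq restr.rep_eq translate.rep_eq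
        cong: if_cong)
  also have "\<dots> = (\<Sum>\<^sub>\<infinity>\<xi>. ?h (\<xi> - \<eta>))"
    by (rule infsum_reindex_bij_betw[OF bij_diff_right, symmetric])
  also have "\<dots> = cinner f (blinfun_apply (trunc_shift E \<eta>) g)"
    unfolding cinner_def
    by (rule infsum_cong)
       (simp add: trunc_shift_def proj.rep_eq shift.rep_eq restr.rep_eq translate.rep_eq)
  finally show "cinner (blinfun_apply (trunc_shift E (- \<eta>)) f) g =
      cinner f (blinfun_apply (trunc_shift E \<eta>) g)" .
qed

lemma norm_trunc_shift_le: "norm (trunc_shift E \<eta>) \<le> 1"
proof (rule norm_blinfun_bound)
  fix f :: "'a ell2"
  have P: "norm (restr E g) \<le> norm g" for g :: "'a ell2"
    by (rule norm_ell2_mono) (simp add: restr.rep_eq)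
  show "norm (blinfun_apply (trunc_shift E \<eta>) f) \<le> 1 * norm f"
    using P[of "translate \<eta> (restr E f)"] P[of f]
    by (simp add: trunc_shift_def proj.rep_eq shift.rep_eq norm_translate)
qed simp

lemma norm_scalar_comp_le: "norm (scalar c o\<^sub>L A) \<le> cmod c * norm A"
  by (rule norm_blinfun_bound)
     (auto simp: scalar.rep_eq norm_scaleC mult.assoc intro!: mult_left_mono norm_blinfun)

lemma infsum_bop_alg:
  assumes "\<And>x. x \<in> X \<Longrightarrow> F x \<in> carrier (bop_alg E)" "F summable_on X"
  shows "infsum F X \<in> carrier (bop_alg E)"
proof -
  have comm: "B o\<^sub>L infsum F X = (\<Sum>\<^sub>\<infinity>x\<in>X. B o\<^sub>L F x)" "infsum F X o\<^sub>L B = (\<Sum>\<^sub>\<infinity>x\<in>X. F x o\<^sub>L B)" for B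
    by (rule infsumI[symmetric] has_sum_bounded_linear has_sum_infsum assms
        bounded_bilinear.bounded_linear_right[OF bounded_bilinear_blinfun_compose]
        bounded_bilinear.bounded_linear_left[OF bounded_bilinear_blinfun_compose])+
  have lin: "complex_linear A \<longleftrightarrow> (\<forall>c. A o\<^sub>L scalar c = scalar c o\<^sub>L A)" for A :: "'b op"
    by (auto simp: complex_linear_def scalar.rep_eq intro!: blinfun_eqI) (metis blinfun_apply_blinfun_compose scalar.rep_eq)
  show ?thesis
    using assms(1) unfolding bop_alg_simps lin comm by (auto intro!: infsum_cong)
qed

lemma toeplitz_summable:
  assumes "(\<lambda>\<eta>. cmod (\<rho> \<eta>)) summable_on ZZ J"
  shows "(\<lambda>\<eta>. scalar (\<rho> \<eta>) o\<^sub>L trunc_shift (NN J) \<eta>) summable_on ZZ J"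
    and "(\<lambda>\<eta>. scalar (\<rho> \<eta>) o\<^sub>L (trunc_shift (NN J) \<eta> o\<^sub>L
            hilbert_adjoint (trunc_shift (NN J) \<eta>))) summable_on ZZ J"
proof -
  have *: "(\<lambda>\<eta>. scalar (\<rho> \<eta>) o\<^sub>L A \<eta>) summable_on ZZ J"
    if "\<And>\<eta>. norm (A \<eta>) \<le> 1" for A :: "(nat \<Rightarrow> int) \<Rightarrow> (nat \<Rightarrow> int) op"
  proof (rule abs_summable_summable,
      rule Infinite_Sum.abs_summable_on_comparison_test'[OF assms])
    show "norm (scalar (\<rho> \<eta>) o\<^sub>L A \<eta>) \<le> cmod (\<rho> \<eta>)" for \<eta>
      using norm_scalar_comp_le[of "\<rho> \<eta>" "A \<eta>"] mult_left_mono[OF that[of \<eta>], of "cmod (\<rho> \<eta>)"]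
      by simp
  qed
  show "(\<lambda>\<eta>. scalar (\<rho> \<eta>) o\<^sub>L trunc_shift (NN J) \<eta>) summable_on ZZ J"
    by (rule *) (rule norm_trunc_shift_le)
  have "norm (trunc_shift (NN J) \<eta> o\<^sub>L trunc_shift (NN J) (- \<eta>)) \<le> 1" for \<eta>
    using norm_blinfun_compose[of "trunc_shift (NN J) \<eta>" "trunc_shift (NN J) (- \<eta>)"]
      mult_le_one[OF norm_trunc_shift_le norm_ge_zero norm_trunc_shift_le]
    by (rule order_trans)
  then show "(\<lambda>\<eta>. scalar (\<rho> \<eta>) o\<^sub>L (trunc_shift (NN J) \<eta> o\<^sub>L
            hilbert_adjoint (trunc_shift (NN J) \<eta>))) summable_on ZZ J"
    unfolding hilbert_adjoint_trunc_shift by (rule *)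
qed

lemma trunc_shift_carrier: "trunc_shift E \<eta> \<in> carrier (bop_alg E)"
proof -
  have "complex_linear (shift \<eta>)"
    unfolding complex_linear_def shift.rep_eq by transfer simp
  then show ?thesis
    by (simp add: bop_alg_simps trunc_shift_def complex_linear_compose complex_linear_proj
        proj_proj blinfun_compose_assoc' comp_absorb_left)
qed

lemma toeplitz_carrier:
  assumes "(\<lambda>\<eta>. cmod (\<rho> \<eta>)) summable_on ZZ J"
  shows "toeplitz_T J \<rho> \<in> carrier (bop_alg (NN J))"
    and "toeplitz_V J \<rho> \<in> carrier (bop_alg (NN J))"
proof -
  have *: "scalar c o\<^sub>L A \<in> carrier (bop_alg E)" if A: "A \<in> carrier (bop_alg E)"
    for c E and A :: "(nat \<Rightarrow> int) op"
  proof -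
    have "(scalar c o\<^sub>L proj E) o\<^sub>L A \<in> carrier (bop_alg E)"
      using monoid.m_closed[OF ring.is_monoid[OF ring_bop_alg] scalar_proj_carrier A]
      by (simp add: bop_alg_simps(2))
    then show ?thesis using A by (simp add: bop_alg_simps(1) blinfun_compose_assoc')
  qed
  have **: "A o\<^sub>L B \<in> carrier (bop_alg E)"
    if "A \<in> carrier (bop_alg E)" "B \<in> carrier (bop_alg E)" for E and A B :: "(nat \<Rightarrow> int) op"
    using monoid.m_closed[OF ring.is_monoid[OF ring_bop_alg] that] by (simp add: bop_alg_simps(2))
  show "toeplitz_T J \<rho> \<in> carrier (bop_alg (NN J))" "toeplitz_V J \<rho> \<in> carrier (bop_alg (NN J))"
    unfolding toeplitz_T_def toeplitz_V_def hilbert_adjoint_trunc_shift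
    by (intro infsum_bop_alg * ** trunc_shift_carrier
        toeplitz_summable[OF assms, unfolded hilbert_adjoint_trunc_shift])+
qed

text \<open>The convention \<open>T\<^sup>0\<^sub>\<rho> = V\<^sup>0\<^sub>\<rho> = \<rho> 1\<close> is the case \<open>J = {}\<close> of the general formulas.\<close>

lemma toeplitz_dim_zero:
  "toeplitz_T {} \<rho> = scalar (\<rho> 0) o\<^sub>L proj {0}" "toeplitz_V {} \<rho> = scalar (\<rho> 0) o\<^sub>L proj {0}"
proof -
  have Z: "ZZ {} = {0}" "NN {} = {0}" by (auto simp: ZZ_def NN_def)
  have "shift 0 = (id_blinfun :: (nat \<Rightarrow> int) op)"
    by (rule blinfun_eqI, simp add: shift.rep_eq, transfer) simp
  moreover have "A o\<^sub>L id_blinfun = A" for A :: "(nat \<Rightarrow> int) op"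
    by (rule blinfun_eqI) simp
  ultimately have "trunc_shift {0} 0 = (proj {0} :: (nat \<Rightarrow> int) op)"
    by (simp add: trunc_shift_def proj_proj)
  then show "toeplitz_T {} \<rho> = scalar (\<rho> 0) o\<^sub>L proj {0}" "toeplitz_V {} \<rho> = scalar (\<rho> 0) o\<^sub>L proj {0}"
    by (simp_all add: toeplitz_T_def toeplitz_V_def hilbert_adjoint_trunc_shift Z proj_proj)
qed


section \<open>Partial Fourier transforms\<close>

text \<open>
  A function on \<open>\<int>\<^sup>k\<close> is a function on \<^typ>\<open>nat \<Rightarrow> int\<close> of which only the values on
  \<^term>\<open>ZZ J\<close> matter. The transform in the variable \<open>z\<^sub>j\<close> is to be evaluated at
  \<open>z \<in> ZZ (J - {j})\<close>, and \<open>z(j := z\<^sub>j)\<close> restores the missing coordinate. The circle is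
  parametrised by \<open>{0..1}\<close>; both transforms have period 1 in \<open>\<tau>\<close>.
\<close>

definition theta_inv :: "nat \<Rightarrow> (nat \<Rightarrow> int) \<Rightarrow> (nat \<Rightarrow> int)"
  where "theta_inv N z = (\<lambda>i. if i \<in> {1..N} then \<Sum>l=1..i. z l else 0)"

definition mu :: "nat \<Rightarrow> real \<Rightarrow> ((nat \<Rightarrow> int) \<Rightarrow> complex) \<Rightarrow> ((nat \<Rightarrow> int) \<Rightarrow> complex)"
  where "mu N \<tau> \<rho> = (\<lambda>z. \<Sum>\<^sub>\<infinity>z1. exp (- 2 * pi * \<i> * of_int z1 * \<tau>) * (\<rho> \<circ> theta_inv N) (z(1 := z1)))"

definition nu :: "nat \<Rightarrow> real \<Rightarrow> ((nat \<Rightarrow> int) \<Rightarrow> complex) \<Rightarrow> ((nat \<Rightarrow> int) \<Rightarrow> complex)"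
  where "nu j \<tau> \<rho> = (\<lambda>z. \<Sum>\<^sub>\<infinity>zj. exp (- 2 * pi * \<i> * of_int zj * \<tau>) * \<rho> (z(j := zj)))"

end

theory Submission
  imports Defs
begin

text \<open>
  Fix a finite label set \<open>J\<close>, summable \<open>\<rho>\<close>, \<open>\<sigma>\<close>, and let \<open>H = T\<^sub>\<rho> + V\<^sub>\<sigma>\<close> act in \<open>\<ell>\<^sup>2\<close> of the octant
  \<open>NN J\<close>. A vector that lives far away from the wall \<open>\<xi>\<^sub>j = 1\<close> does not notice the constraint
  \<open>\<xi>\<^sub>j \<ge> 1\<close>: there shifts in the direction \<open>j\<close> are invertible, a Fourier transform in \<open>\<xi>\<^sub>j\<close> turns
  them into multiplications by characters, and the projections that make up \<open>V\<^sub>\<sigma>\<close> lose their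
  constraint in \<open>\<xi>\<^sub>j\<close>. Hence at frequency \<open>\<tau>\<close> the operator \<open>H\<close> acts like the operator with symbols
  \<open>nu j \<tau> \<rho>\<close> and \<open>nu j 0 \<sigma>\<close> in the octant \<open>NN (J - {j})\<close>, here called its face at \<open>(j, \<tau>)\<close>. Only
  finitely many points of the octant are far from no wall, so modulo compact operators nothing
  but the faces matters: \<open>H\<close> is invertible modulo compact operators if and only if all its faces are
  invertible (\<open>calkin_Units_iff_faces\<close>). Subtracting \<open>z\<close> from \<open>H\<close> subtracts \<open>z\<close> from \<open>\<rho> 0\<close>, and hence
  from every face, which gives the formula for the essential spectrum; the theorem is the case
  \<open>J = {2..N}\<close>. The formula has the union itself and not its closure because the inverses of
  the faces, if all of them exist, are bounded uniformly in \<open>\<tau>\<close> (\<open>face_inverse_bounded\<close>).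

  The operators need not be normal, so left and right inverses are treated separately, and all
  inverses are explicit approximations. The link between \<open>H\<close> and its faces is a sequence of operators
  \<open>s\<^sub>n\<close> on \<open>\<ell>\<^sup>2(\<int>)\<close>, acting in the variable \<open>\<xi>\<^sub>j\<close> alone, that intertwines the half-line shifts with
  multiplications by characters up to an error tending to 0 in norm. By dominated convergence it
  intertwines \<open>H\<close> with the family of its faces up to such an error (\<open>symbol_right\<close>, \<open>symbol_left\<close>).
  Two such sequences are used.

  \<^item> If \<open>B\<close> inverts \<open>H\<close> modulo compact operators, let \<open>s\<^sub>n\<close> tensor a vector with a plane wave of
  frequency \<open>\<tau>\<close> cut off to \<open>{n..<2n}\<close>. Compact operators vanish in the limit because the waves move to
  infinity, and \<open>s\<^sub>n\<^sup>* B s\<^sub>n\<close> becomes an inverse of the face at \<open>(j, \<tau>)\<close> (\<open>face_Units_if_parametrix\<close>).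

  \<^item> If all faces are invertible, let \<open>s\<^sub>n\<close> superpose plane waves cut off to all windows of length \<open>n\<close>
  that start at \<open>n\<close> or later. Then \<open>s\<^sub>n s\<^sub>n\<^sup>*\<close> is a cutoff function that equals 1 far from the wall
  (\<open>gabor_frame\<close>), and inserting the inverses of the faces between \<open>s\<^sub>n\<close> and \<open>s\<^sub>n\<^sup>*\<close> inverts \<open>H\<close> there
  (\<open>face_parametrix\<close>). A partition of unity glues these inverses for all \<open>j\<close> (\<open>partial_parametrix\<close>).
\<close>

section \<open>Constructing operators on square-summable families\<close>

text \<open>
  Bounded operators are defined through the coordinates of their values; square-summability and the
  norm bound both follow from a bound on finite partial sums.
\<close>

definition ell2_op :: "('b ell2 \<Rightarrow> 'a \<Rightarrow> complex) \<Rightarrow> ('b ell2 \<Rightarrow>\<^sub>L 'a ell2)"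
  where "ell2_op F = Blinfun (\<lambda>f. Abs_ell2 (F f))"

lemma scaleR_scaleC: "r *\<^sub>R f = scaleC (of_real r) f"
  by (rule coord_inject_ext) (simp add: scaleR_ell2.rep_eq scaleC.rep_eq)

lemma sq_summable_if_bounded:
  assumes "\<And>X. finite X \<Longrightarrow> (\<Sum>x\<in>X. (cmod (f x))\<^sup>2) \<le> b"
  shows "(\<lambda>x. (cmod (f x))\<^sup>2) summable_on UNIV"
  by (rule nonneg_bdd_above_summable_on) (auto intro!: bdd_aboveI[of _ b] assms)

lemma
  assumes add: "\<And>f g x. F (f + g) x = F f x + F g x"
    and scale: "\<And>c f x. F (scaleC c f) x = c * F f x"
    and bound: "\<And>f X. finite X \<Longrightarrow> (\<Sum>x\<in>X. (cmod (F f x))\<^sup>2) \<le> (K * norm f)\<^sup>2"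
    and K: "0 \<le> K"
  shows coord_ell2_op: "coord (blinfun_apply (ell2_op F) f) x = F f x"
    and norm_ell2_op: "norm (ell2_op F) \<le> K"
    and scaleC_ell2_op: "blinfun_apply (ell2_op F) (scaleC c f) = scaleC c (blinfun_apply (ell2_op F) f)"
proof -
  have c: "coord (Abs_ell2 (F f)) = F f" for f
    using sq_summable_if_bounded[OF bound] by (subst Abs_ell2_inverse) auto
  have nrm: "norm (Abs_ell2 (F f)) \<le> norm f * K" for f
    using bound[of _ f] K by (intro norm_ell2_leI) (auto simp: c mult.commute)
  have "bounded_linear (\<lambda>f. Abs_ell2 (F f))"
    by (rule bounded_linear_intro[OF _ _ nrm])
       (auto intro!: coord_inject_ext
          simp: c add scale plus_ell2.rep_eq scaleR_scaleC scaleC.rep_eq)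
  then have app: "blinfun_apply (ell2_op F) f = Abs_ell2 (F f)" for f
    unfolding ell2_op_def by (simp add: bounded_linear_Blinfun_apply)
  show "coord (blinfun_apply (ell2_op F) f) x = F f x"
    by (simp add: app c)
  show "norm (ell2_op F) \<le> K"
    using K nrm by (intro norm_blinfun_bound) (auto simp: app mult.commute)
  show "blinfun_apply (ell2_op F) (scaleC c f) = scaleC c (blinfun_apply (ell2_op F) f)"
    by (rule coord_inject_ext) (simp add: app c scale scaleC.rep_eq)
qed

lemmas coord_simps = plus_ell2.rep_eq minus_ell2.rep_eq uminus_ell2.rep_eq zero_ell2.rep_eq
  scaleC.rep_eq scaleR_ell2.rep_eq restr.rep_eq translate.rep_eq proj.rep_eq shift.rep_eq scalar.rep_eq

lemma op_eqI:
  fixes A B :: "'b ell2 \<Rightarrow>\<^sub>L 'a ell2"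
  shows "(\<And>f x. coord (blinfun_apply A f) x = coord (blinfun_apply B f) x) \<Longrightarrow> A = B"
  by (intro blinfun_eqI coord_inject_ext)

lemma complex_linear_diff: "complex_linear A \<Longrightarrow> complex_linear B \<Longrightarrow> complex_linear (A - B)"
  using complex_linear_plus[OF _ complex_linear_uminus, of A B] by simp

lemma complex_linear_shift: "complex_linear (shift \<eta>)"
  by (auto simp: complex_linear_def coord_simps intro!: coord_inject_ext)

lemma complex_linear_trunc_shift: "complex_linear (trunc_shift E \<eta>)"
  unfolding trunc_shift_def
  by (intro complex_linear_compose complex_linear_proj complex_linear_shift)

lemma complex_linear_scalar_commute:
  "complex_linear A \<Longrightarrow> A o\<^sub>L (scalar c o\<^sub>L B) = scalar c o\<^sub>L (A o\<^sub>L B)"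
  by (rule blinfun_eqI) (simp add: complex_linear_def scalar.rep_eq)

text \<open>
  Complex linearity is membership in \<open>bop_alg UNIV\<close>, which is closed under convergent sums.
\<close>

lemma complex_linear_infsum:
  fixes F :: "'x \<Rightarrow> 'a op"
  assumes "\<And>x. x \<in> X \<Longrightarrow> complex_linear (F x)" "F summable_on X"
  shows "complex_linear (infsum F X)"
proof -
  have "proj UNIV = (id_blinfun :: 'a op)" by (rule op_eqI) (simp add: coord_simps)
  then have "A \<in> carrier (bop_alg UNIV) \<longleftrightarrow> complex_linear A" for A :: "'a op"
    by (auto simp: bop_alg_simps intro!: blinfun_eqI)
  then show ?thesis using infsum_bop_alg[of X F UNIV, OF _ assms(2)] assms(1) by simp
qed

subsection \<open>Multiplication operators\<close>

definition mulop :: "('a \<Rightarrow> complex) \<Rightarrow> 'a op"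
  where "mulop u = ell2_op (\<lambda>f x. u x * coord f x)"

lemma
  assumes "\<And>x. cmod (u x) \<le> K"
  shows coord_mulop: "coord (mulop u f) x = u x * coord f x"
    and norm_mulop: "norm (mulop u) \<le> K"
    and complex_linear_mulop: "complex_linear (mulop u)"
proof -
  have K: "0 \<le> K" using assms norm_ge_zero order_trans by blast
  have bound: "(\<Sum>x\<in>X. (cmod (u x * coord f x))\<^sup>2) \<le> (K * norm f)\<^sup>2" if "finite X" for f X
  proof -
    have "(\<Sum>x\<in>X. (cmod (u x * coord f x))\<^sup>2) \<le> (\<Sum>x\<in>X. K\<^sup>2 * (cmod (coord f x))\<^sup>2)"
      using assms by (intro sum_mono) (auto simp: norm_mult power_mult_distrib intro!: mult_right_mono power_mono)
    also have "\<dots> \<le> K\<^sup>2 * (norm f)\<^sup>2"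
      unfolding sum_distrib_left[symmetric] using sum_coord_le[OF that] by (intro mult_left_mono) auto
    finally show ?thesis by (simp add: power_mult_distrib)
  qed
  note * = _ _ bound K
  show "coord (mulop u f) x = u x * coord f x"
    unfolding mulop_def by (rule coord_ell2_op[OF *]) (auto simp: coord_simps algebra_simps)
  show "norm (mulop u) \<le> K"
    unfolding mulop_def by (rule norm_ell2_op[OF *]) (auto simp: coord_simps algebra_simps)
  show "complex_linear (mulop u)"
    unfolding mulop_def complex_linear_def
    by (intro allI, rule scaleC_ell2_op[OF *]) (auto simp: coord_simps algebra_simps)
qed

subsection \<open>Adjoints\<close>

definition ket :: "'a \<Rightarrow> 'a ell2"
  where "ket x = Abs_ell2 (\<lambda>y. if y = x then 1 else 0)"

lemma coord_ket: "coord (ket x) y = (if y = x then 1 else 0)"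
proof -
  have "(\<lambda>y. (cmod (if y = x then 1 else 0))\<^sup>2) summable_on {x}" by simp
  then have "(\<lambda>y. (cmod (if y = x then 1 else 0))\<^sup>2) summable_on UNIV"
    by (rule summable_on_cong_neutral[THEN iffD1, rotated -1]) auto
  then show ?thesis by (simp add: ket_def Abs_ell2_inverse)
qed

lemma restr_tendsto: "((\<lambda>F. restr F g) \<longlongrightarrow> g) (finite_subsets_at_top UNIV)"
proof (rule tendstoI)
  fix e :: real assume e: "0 < e"
  let ?q = "\<lambda>x. (cmod (coord g x))\<^sup>2"
  have "(sum ?q \<longlongrightarrow> infsum ?q UNIV) (finite_subsets_at_top UNIV)"
    by (intro infsum_tendsto coord_summable)
  then have "eventually (\<lambda>F. dist (sum ?q F) (infsum ?q UNIV) < e\<^sup>2) (finite_subsets_at_top UNIV)"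
    using e by (intro tendstoD) auto
  moreover have "eventually finite (finite_subsets_at_top (UNIV :: 'a set))"
    by (simp add: eventually_finite_subsets_at_top_weakI)
  ultimately show "eventually (\<lambda>F. dist (restr F g) g < e) (finite_subsets_at_top UNIV)"
  proof eventually_elim
    case (elim F)
    have "(norm (g - restr F g))\<^sup>2 = infsum ?q (- F)"
      unfolding norm_ell2_sq by (rule infsum_cong_neutral) (auto simp: coord_simps)
    also have "\<dots> = infsum ?q UNIV - sum ?q F"
      using elim(2) infsum_Diff[of ?q UNIV F] by (simp add: coord_summable Compl_eq_Diff_UNIV)
    also have "\<dots> < e\<^sup>2" using elim(1) by (simp add: dist_real_def)
    finally show ?case using e power_less_imp_less_base[of _ 2 e] by (simp add: dist_norm norm_minus_commute)
  qed
qed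

lemma restr_finite: "finite F \<Longrightarrow> restr F g = (\<Sum>x\<in>F. scaleC (coord g x) (ket x))"
proof (induction F rule: finite_induct)
  case empty then show ?case by (intro coord_inject_ext) (simp add: coord_simps)
next
  case (insert x F)
  have "restr (insert x F) g = scaleC (coord g x) (ket x) + restr F g"
    using insert(2) by (intro coord_inject_ext) (auto simp: coord_simps coord_ket)
  then show ?case using insert by simp
qed

lemma ket_expansion: "((\<lambda>x. scaleC (coord g x) (ket x)) has_sum g) UNIV"
  unfolding has_sum_def
  by (rule Lim_transform_eventually[OF restr_tendsto[of g]])
     (rule eventually_finite_subsets_at_top_weakI, simp add: restr_finite)

lemma cinner_add_right: "cinner f (g + h) = cinner f g + cinner f h"
  by (metis cinner_add_left cinner_commute complex_cnj_add)

lemma cinner_scaleC_right: "cinner f (scaleC c g) = c * cinner f g"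
  unfolding cinner_def scaleC.rep_eq by (simp add: infsum_cmult_right'[symmetric] algebra_simps)

lemma bounded_linear_cinner_right: "bounded_linear (cinner f)"
proof -
  have "cinner f = (\<lambda>g. of_real (inner f g) + of_real (- inner f (scalar \<i> g)) * \<i>)"
    by (rule ext) (simp add: complex_eq_iff inner_ell2_def scalar.rep_eq cinner_scaleC_right)
  moreover have "bounded_linear (\<lambda>g. of_real (inner f g) + of_real (- inner f (scalar \<i> g)) * \<i>)"
    by (intro bounded_linear_intros bounded_linear_add bounded_linear_compose[OF bounded_linear_of_real]
       bounded_linear_compose[OF bounded_linear_inner_right] bounded_linear_compose[OF bounded_linear_mult_left]
       bounded_linear_minus blinfun.bounded_linear_right)
  ultimately show ?thesis by simp
qed

lemma ket_cinner: "cinner (ket x) f = coord f x"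
proof -
  have "cinner (ket x) f = (\<Sum>\<^sub>\<infinity>y\<in>{x}. coord f y)"
    unfolding cinner_def by (rule infsum_cong_neutral) (auto simp: coord_ket)
  then show ?thesis by simp
qed

text \<open>
  The adjoint is constructed from its matrix, whose rows are the images of the standard basis. A
  definite description defines \<^const>\<open>hilbert_adjoint\<close>, so existence is all that is to be shown.
\<close>

lemma cinner_hilbert_adjoint:
  assumes A: "complex_linear A"
  shows "cinner (hilbert_adjoint A f) g = cinner f (A g)"
proof -
  let ?F = "\<lambda>f x. cinner (A (ket x)) f"
  have bound: "(\<Sum>x\<in>X. (cmod (?F f x))\<^sup>2) \<le> (norm A * norm f)\<^sup>2" if "finite X" for f X
  proof -
    \<comment> \<open>test against the truncation \<open>h\<close> of the vector to be bounded\<close>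
    define h where "h = (\<Sum>x\<in>X. scaleC (?F f x) (ket x))"
    let ?S = "\<Sum>x\<in>X. (cmod (?F f x))\<^sup>2"
    have ch: "coord h x = (if x \<in> X then ?F f x else 0)" for x
      unfolding h_def using that
      by (induction X rule: finite_induct) (auto simp: coord_simps coord_ket)
    have "(norm h)\<^sup>2 = infsum (\<lambda>x. (cmod (?F f x))\<^sup>2) X"
      unfolding norm_ell2_sq by (rule infsum_cong_neutral) (auto simp: ch)
    then have nh: "(norm h)\<^sup>2 = ?S" using that by simp
    have "cinner f (A h) = (\<Sum>x\<in>X. ?F f x * cinner f (A (ket x)))"
    proof -
      interpret bounded_linear "cinner f" by (rule bounded_linear_cinner_right)
      show ?thesis unfolding h_def blinfun.sum_right sum
        using A by (simp add: complex_linear_def cinner_scaleC_right)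
    qed
    also have "\<dots> = of_real ?S"
      by (simp add: cinner_commute[of f] complex_norm_square del: of_real_power)
    finally have "?S = inner f (A h)" by (simp add: inner_ell2_def)
    also have "\<dots> \<le> norm f * (norm A * norm h)"
      using norm_cauchy_schwarz[of f "A h"] norm_blinfun[of A h]
      by (meson mult_left_mono norm_ge_zero order_trans)
    finally have le: "(norm h)\<^sup>2 \<le> norm A * norm f * norm h" using nh by (simp add: mult_ac)
    have "norm h \<le> norm A * norm f"
    proof (cases "norm h = 0")
      case False then show ?thesis using le by (simp add: power2_eq_square)
    qed simp
    then show ?thesis unfolding nh[symmetric] by (intro power_mono) auto
  qed
  have props: "?F (f + g) x = ?F f x + ?F g x" "?F (scaleC c f) x = c * ?F f x" for f g x c
    by (simp_all add: cinner_add_right cinner_scaleC_right)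
  let ?B = "ell2_op ?F"
  have coordB: "coord (blinfun_apply ?B f) x = ?F f x" for f x
    by (rule coord_ell2_op[OF props bound norm_ge_zero])
  have adj: "cinner (blinfun_apply ?B f) g = cinner f (A g)" for f g
  proof -
    have "((\<lambda>x. cinner f (A (scaleC (coord g x) (ket x)))) has_sum cinner f (A g)) UNIV"
      by (intro has_sum_bounded_linear[OF bounded_linear_cinner_right]
            has_sum_bounded_linear[OF blinfun.bounded_linear_right] ket_expansion)
    moreover have "cinner f (A (scaleC (coord g x) (ket x))) =
        cnj (coord (blinfun_apply ?B f) x) * coord g x" for x
      using A by (simp add: complex_linear_def cinner_scaleC_right coordB mult.commute cinner_commute[of f "A (ket x)"])
    ultimately show ?thesis unfolding cinner_def[of "blinfun_apply ?B f"] by (simp add: infsumI)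
  qed
  have "hilbert_adjoint A = ?B" by (rule hilbert_adjointI) (rule adj)
  then show ?thesis by (simp add: adj)
qed

lemma coord_hilbert_adjoint:
  "complex_linear A \<Longrightarrow> coord (hilbert_adjoint A f) x = cinner (A (ket x)) f"
  by (metis cinner_commute cinner_hilbert_adjoint ket_cinner)

lemma complex_linear_hilbert_adjoint: "complex_linear A \<Longrightarrow> complex_linear (hilbert_adjoint A)"
  unfolding complex_linear_def[of "hilbert_adjoint A"]
  by (auto intro!: coord_inject_ext simp: coord_hilbert_adjoint cinner_scaleC_right scaleC.rep_eq)

lemma norm_hilbert_adjoint_le:
  assumes "complex_linear A" shows "norm (hilbert_adjoint A) \<le> norm A"
proof (rule norm_blinfun_bound)
  fix f
  let ?g = "hilbert_adjoint A f"
  have "(norm ?g)\<^sup>2 = inner ?g ?g" by (simp add: power2_norm_eq_inner)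
  also have "\<dots> = inner f (A ?g)"
    by (simp add: inner_ell2_def cinner_hilbert_adjoint[OF assms])
  also have "\<dots> \<le> norm f * (norm A * norm ?g)"
    using norm_cauchy_schwarz[of f "A ?g"] norm_blinfun[of A ?g]
    by (meson mult_left_mono norm_ge_zero order_trans)
  finally have le: "(norm ?g)\<^sup>2 \<le> norm A * norm f * norm ?g" by (simp add: mult_ac)
  show "norm ?g \<le> norm A * norm f"
  proof (cases "norm ?g = 0")
    case False then show ?thesis using le by (simp add: power2_eq_square)
  qed simp
qed simp

lemma hilbert_adjoint_compose:
  "complex_linear A \<Longrightarrow> complex_linear B \<Longrightarrow>
    hilbert_adjoint (A o\<^sub>L B) = hilbert_adjoint B o\<^sub>L hilbert_adjoint A"
  by (rule hilbert_adjointI) (simp add: cinner_hilbert_adjoint)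

lemma hilbert_adjoint_diff:
  assumes "complex_linear A" "complex_linear B"
  shows "hilbert_adjoint (A - B) = hilbert_adjoint A - hilbert_adjoint B"
proof (rule op_eqI)
  fix f x
  show "coord (hilbert_adjoint (A - B) f) x = coord ((hilbert_adjoint A - hilbert_adjoint B) f) x"
    using assms cinner_add_left[of "A (ket x) - B (ket x)" "B (ket x)" f]
    by (simp add: coord_hilbert_adjoint complex_linear_diff blinfun.diff_left coord_simps)
qed

lemma hilbert_adjoint_mulop:
  assumes "\<And>x. cmod (u x) \<le> K"
  shows "hilbert_adjoint (mulop u) = mulop (\<lambda>x. cnj (u x))"
proof (rule hilbert_adjointI)
  have bd: "\<And>x. cmod (cnj (u x)) \<le> K" using assms by simp
  note c = coord_mulop[of "\<lambda>x. cnj (u x)" K, OF bd] coord_mulop[of u K, OF assms]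
  show "cinner (mulop (\<lambda>x. cnj (u x)) f) g = cinner f (mulop u g)" for f g
    by (simp add: cinner_def c mult_ac)
qed

subsection \<open>Operators acting fibrewise\<close>

text \<open>
  \<open>pull D e f\<close> is the part of \<open>f\<close> seen through the injective chart \<open>e\<close> on \<open>D\<close>. An operator on
  \<open>\<ell>\<^sup>2\<close> of a disjoint union of charts may act on each of them separately.
\<close>

definition pull :: "'b set \<Rightarrow> ('b \<Rightarrow> 'a) \<Rightarrow> 'a ell2 \<Rightarrow> 'b ell2"
  where "pull D e f = Abs_ell2 (\<lambda>y. if y \<in> D then coord f (e y) else 0)"

lemma
  assumes "inj_on e D"
  shows coord_pull: "coord (pull D e f) y = (if y \<in> D then coord f (e y) else 0)"
    and norm_pull_sq: "(norm (pull D e f))\<^sup>2 = (\<Sum>\<^sub>\<infinity>x\<in>e ` D. (cmod (coord f x))\<^sup>2)"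
proof -
  have "(\<lambda>x. (cmod (coord f x))\<^sup>2) summable_on e ` D" by (rule coord_summable)
  then have "(\<lambda>y. (cmod (coord f (e y)))\<^sup>2) summable_on D"
    by (simp add: summable_on_reindex[OF assms] o_def)
  then have "(\<lambda>y. (cmod (if y \<in> D then coord f (e y) else 0))\<^sup>2) summable_on UNIV"
    by (rule summable_on_cong_neutral[THEN iffD1, rotated -1]) auto
  then show c: "coord (pull D e f) y = (if y \<in> D then coord f (e y) else 0)" for y
    by (simp add: pull_def Abs_ell2_inverse)
  have "(norm (pull D e f))\<^sup>2 = infsum (\<lambda>y. (cmod (coord f (e y)))\<^sup>2) D"
    unfolding norm_ell2_sq by (rule infsum_cong_neutral) (auto simp: c)
  then show "(norm (pull D e f))\<^sup>2 = (\<Sum>\<^sub>\<infinity>x\<in>e ` D. (cmod (coord f x))\<^sup>2)"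
    by (simp add: infsum_reindex[OF assms] o_def)
qed

lemma sum_norm_pull_le:
  assumes "finite I" and inj: "inj_on (\<lambda>(i, y). e i y) (Sigma I D)"
  shows "(\<Sum>i\<in>I. (norm (pull (D i) (e i) f))\<^sup>2) \<le> (norm f)\<^sup>2"
proof -
  let ?q = "\<lambda>x. (cmod (coord f x))\<^sup>2"
  have inj': "inj_on (e i) (D i)" if "i \<in> I" for i
    using inj that unfolding inj_on_def by fastforce
  have disj: "e i ` D i \<inter> e k ` D k = {}" if "i \<in> I" "k \<in> I" "i \<noteq> k" for i k
    using inj that unfolding inj_on_def by fastforce
  have "(\<Sum>i\<in>I. infsum ?q (e i ` D i)) = infsum ?q (\<Union>i\<in>I. e i ` D i)"
    using assms(1) disj
  proof (induction I rule: finite_induct)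
    case (insert i I)
    have "infsum ?q (e i ` D i \<union> (\<Union>k\<in>I. e k ` D k)) = infsum ?q (e i ` D i) + infsum ?q (\<Union>k\<in>I. e k ` D k)"
      using insert(2) insert(4)[of i] by (intro infsum_Un_disjoint coord_summable) blast
    moreover have "(\<Sum>i\<in>I. infsum ?q (e i ` D i)) = infsum ?q (\<Union>i\<in>I. e i ` D i)"
      using insert by blast
    ultimately show ?case using insert(1,2) by simp
  qed simp
  also have "\<dots> \<le> infsum ?q UNIV"
    by (rule infsum_mono_neutral) (auto intro!: coord_summable)
  finally show ?thesis using norm_pull_sq[OF inj'] by (simp add: norm_ell2_sq)
qed

lemma pull_add: "inj_on e D \<Longrightarrow> pull D e (f + g) = pull D e f + pull D e g"
  and pull_scaleC: "inj_on e D \<Longrightarrow> pull D e (scaleC c f) = scaleC c (pull D e f)"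
  by (auto intro!: coord_inject_ext simp: coord_pull coord_simps)

text \<open>
  The chart of index \<open>base x\<close> contains the point \<open>x\<close> at the position \<open>pos x\<close>. Two families of charts of
  \<open>\<int>\<^sup>J\<close> matter below: the lines in direction \<open>j\<close>, all carrying the same operator on \<open>\<ell>\<^sup>2(\<int>)\<close>, and the
  hyperplanes orthogonal to that direction, carrying different operators.
\<close>

definition fibre_op :: "('a \<Rightarrow> 'i) \<Rightarrow> ('a \<Rightarrow> 'y) \<Rightarrow> 'y set \<Rightarrow> ('i \<Rightarrow> 'y \<Rightarrow> 'a) \<Rightarrow> ('i \<Rightarrow> 'y op) \<Rightarrow> 'a op"
  where "fibre_op base pos D e L =
    ell2_op (\<lambda>f x. coord (blinfun_apply (L (base x)) (pull D (e (base x)) f)) (pos x))"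

lemma
  assumes C: "0 \<le> C" "\<And>i. norm (L i) \<le> C" and lin: "\<And>i. complex_linear (L i)"
    and inj_pos: "inj (\<lambda>x. (base x, pos x))"
    and inj_e: "inj_on (\<lambda>(i, y). e i y) (range base \<times> D)"
  shows coord_fibre_op: "coord (fibre_op base pos D e L f) x =
      coord (blinfun_apply (L (base x)) (pull D (e (base x)) f)) (pos x)"
    and norm_fibre_op: "norm (fibre_op base pos D e L) \<le> C"
    and complex_linear_fibre_op: "complex_linear (fibre_op base pos D e L)"
proof -
  let ?F = "\<lambda>f x. coord (blinfun_apply (L (base x)) (pull D (e (base x)) f)) (pos x)"
  have inj': "inj_on (e (base x)) D" for x
    using inj_e unfolding inj_on_def by fastforce
  have props: "?F (f + g) x = ?F f x + ?F g x" "?F (scaleC c f) x = c * ?F f x" for f g x c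
    using lin by (simp_all add: pull_add[OF inj'] pull_scaleC[OF inj'] blinfun.add_right coord_simps complex_linear_def)
  have bound: "(\<Sum>x\<in>X. (cmod (?F f x))\<^sup>2) \<le> (C * norm f)\<^sup>2" if "finite X" for f X
  proof -
    let ?v = "\<lambda>i. blinfun_apply (L i) (pull D (e i) f)"
    have "(\<Sum>x\<in>X. (cmod (?F f x))\<^sup>2) = (\<Sum>i\<in>base ` X. \<Sum>x\<in>{x\<in>X. base x = i}. (cmod (coord (?v i) (pos x)))\<^sup>2)"
      using that by (simp add: sum.image_gen[of X _ base])
    also have "\<dots> \<le> (\<Sum>i\<in>base ` X. (norm (?v i))\<^sup>2)"
    proof (rule sum_mono)
      fix i assume "i \<in> base ` X"
      have "inj_on pos {x\<in>X. base x = i}"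
        using inj_pos unfolding inj_on_def by fastforce
      then have "(\<Sum>x\<in>{x\<in>X. base x = i}. (cmod (coord (?v i) (pos x)))\<^sup>2)
          = (\<Sum>y\<in>pos ` {x\<in>X. base x = i}. (cmod (coord (?v i) y))\<^sup>2)"
        by (simp add: sum.reindex)
      also have "\<dots> \<le> (norm (?v i))\<^sup>2" using that by (intro sum_coord_le) auto
      finally show "(\<Sum>x\<in>{x\<in>X. base x = i}. (cmod (coord (?v i) (pos x)))\<^sup>2) \<le> (norm (?v i))\<^sup>2" .
    qed
    also have "\<dots> \<le> (\<Sum>i\<in>base ` X. C\<^sup>2 * (norm (pull D (e i) f))\<^sup>2)"
    proof (rule sum_mono)
      fix i
      have "norm (?v i) \<le> C * norm (pull D (e i) f)"
        by (rule order_trans[OF norm_blinfun mult_right_mono[OF C(2)]]) simp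
      then have "(norm (?v i))\<^sup>2 \<le> (C * norm (pull D (e i) f))\<^sup>2" by (intro power_mono) auto
      then show "(norm (?v i))\<^sup>2 \<le> C\<^sup>2 * (norm (pull D (e i) f))\<^sup>2" by (simp add: power_mult_distrib)
    qed
    also have "\<dots> \<le> C\<^sup>2 * (norm f)\<^sup>2"
      unfolding sum_distrib_left[symmetric]
      using that by (intro mult_left_mono sum_norm_pull_le inj_on_subset[OF inj_e]) auto
    finally show ?thesis by (simp add: power_mult_distrib)
  qed
  note * = props bound C(1)
  show "coord (fibre_op base pos D e L f) x = ?F f x"
    unfolding fibre_op_def by (rule coord_ell2_op[OF *])
  show "norm (fibre_op base pos D e L) \<le> C"
    unfolding fibre_op_def by (rule norm_ell2_op[OF *])
  show "complex_linear (fibre_op base pos D e L)"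
    unfolding fibre_op_def complex_linear_def by (intro allI, rule scaleC_ell2_op[OF *])
qed

section \<open>Operators acting on one coordinate\<close>

text \<open>
  The amplification \<open>1 \<otimes> s\<close> of \<open>s\<close>, where the second tensor factor is the variable \<open>\<xi>\<^sub>j\<close>.
\<close>

definition amp :: "nat \<Rightarrow> int op \<Rightarrow> (nat \<Rightarrow> int) op"
  where "amp j s = fibre_op (\<lambda>\<xi>. \<xi>(j := 0)) (\<lambda>\<xi>. \<xi> j) UNIV (\<lambda>\<zeta> m. \<zeta>(j := m)) (\<lambda>_. s)"

abbreviation line :: "nat \<Rightarrow> (nat \<Rightarrow> int) \<Rightarrow> (nat \<Rightarrow> int) ell2 \<Rightarrow> int ell2"
  where "line j \<xi> \<equiv> pull UNIV (\<lambda>m. \<xi>(j := m))"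

lemma inj_update: "inj (\<lambda>m. \<xi>(j := m))"
  by (rule injI) (metis fun_upd_same)

lemma
  assumes "complex_linear s"
  shows coord_amp: "coord (amp j s f) \<xi> = coord (blinfun_apply s (line j \<xi> f)) (\<xi> j)"
    and norm_amp: "norm (amp j s) \<le> norm s"
    and complex_linear_amp: "complex_linear (amp j s)"
proof -
  have inj1: "inj (\<lambda>\<xi> :: nat \<Rightarrow> int. (\<xi>(j := 0), \<xi> j))"
    by (rule injI) (metis Pair_inject fun_upd_triv fun_upd_upd)
  have inj2: "inj_on (\<lambda>(\<zeta>, m). \<zeta>(j := m)) (range (\<lambda>\<xi>. \<xi>(j := 0)) \<times> UNIV)"
    by (rule inj_onI) (auto simp: fun_eq_iff split: if_splits)
  have upd: "fun_upd (\<xi>(j := 0)) j = fun_upd \<xi> j" for \<xi> :: "nat \<Rightarrow> int"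
    by (rule ext) simp
  note * = norm_ge_zero[of s] order_refl assms inj1 inj2
  show "coord (amp j s f) \<xi> = coord (blinfun_apply s (line j \<xi> f)) (\<xi> j)"
    unfolding amp_def by (subst coord_fibre_op[OF *]) (simp add: upd)
  show "norm (amp j s) \<le> norm s"
    unfolding amp_def by (rule norm_fibre_op[OF *])
  show "complex_linear (amp j s)"
    unfolding amp_def by (rule complex_linear_fibre_op[OF *])
qed

lemma coord_line: "coord (line j \<xi> f) m = coord f (\<xi>(j := m))"
  by (simp add: coord_pull[OF inj_update])

lemma line_amp: "complex_linear s \<Longrightarrow> line j \<xi> (amp j s f) = blinfun_apply s (line j \<xi> f)"
  by (rule coord_inject_ext) (simp add: coord_line coord_amp)

lemma amp_compose:
  "complex_linear s \<Longrightarrow> complex_linear t \<Longrightarrow> amp j (s o\<^sub>L t) = amp j s o\<^sub>L amp j t"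
  by (rule op_eqI) (simp add: coord_amp complex_linear_compose line_amp)

lemma amp_diff:
  "complex_linear s \<Longrightarrow> complex_linear t \<Longrightarrow> amp j (s - t) = amp j s - amp j t"
  by (rule op_eqI) (simp add: coord_amp complex_linear_diff blinfun.diff_left coord_simps)

lemma amp_mulop:
  assumes "\<And>x. cmod (u x) \<le> K"
  shows "amp j (mulop u) = mulop (\<lambda>\<xi>. u (\<xi> j))"
  by (rule op_eqI)
     (simp add: coord_amp complex_linear_mulop[OF assms] coord_mulop[where K = K, OF assms] coord_line)

lemma coord_trunc_shift:
  "coord (trunc_shift E \<eta> f) \<xi> = (if \<xi> \<in> E \<and> \<xi> - \<eta> \<in> E then coord f (\<xi> - \<eta>) else 0)"
  by (simp add: trunc_shift_def coord_simps)

lemma update_minus: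
  fixes \<xi> \<eta> :: "nat \<Rightarrow> int"
  shows "\<eta> j = 0 \<Longrightarrow> \<xi>(j := m) - \<eta> = (\<xi> - \<eta>)(j := m)"
  by (auto simp: fun_eq_iff)

lemma amp_trunc_shift_commute:
  assumes E: "\<And>\<xi> m. \<xi>(j := m) \<in> E \<longleftrightarrow> \<xi> \<in> E" and \<eta>: "\<eta> j = 0" and s: "complex_linear s"
  shows "trunc_shift E \<eta> o\<^sub>L amp j s = amp j s o\<^sub>L trunc_shift E \<eta>"
proof (rule op_eqI)
  fix f \<xi>
  have "line j \<xi> (trunc_shift E \<eta> f) = (if \<xi> \<in> E \<and> \<xi> - \<eta> \<in> E then line j (\<xi> - \<eta>) f else 0)"
    by (rule coord_inject_ext) (simp add: coord_line coord_trunc_shift E update_minus[of \<eta> j, OF \<eta>] coord_simps)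
  then show "coord ((trunc_shift E \<eta> o\<^sub>L amp j s) f) \<xi>
      = coord ((amp j s o\<^sub>L trunc_shift E \<eta>) f) \<xi>"
    using \<eta> by (simp add: coord_amp[OF s] coord_trunc_shift coord_simps)
qed

lemma amp_proj_commute:
  assumes E: "\<And>\<xi> m. \<xi>(j := m) \<in> E \<longleftrightarrow> \<xi> \<in> E" and s: "complex_linear s"
  shows "proj E o\<^sub>L amp j s = amp j s o\<^sub>L proj E"
proof (rule op_eqI)
  fix f \<xi>
  have "line j \<xi> (proj E f) = (if \<xi> \<in> E then line j \<xi> f else 0)"
    by (rule coord_inject_ext) (simp add: coord_line E coord_simps)
  then show "coord ((proj E o\<^sub>L amp j s) f) \<xi> = coord ((amp j s o\<^sub>L proj E) f) \<xi>"
    by (simp add: coord_amp[OF s] coord_simps)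
qed

section \<open>Slices\<close>

text \<open>
  The restriction to the hyperplane \<open>\<xi>\<^sub>j = b\<close>, translated to \<open>\<xi>\<^sub>j = 0\<close>, since functions in the remaining
  variables are represented by functions supported in \<open>\<xi>\<^sub>j = 0\<close>.
\<close>

definition slice :: "nat \<Rightarrow> int \<Rightarrow> (nat \<Rightarrow> int) op"
  where "slice j b = ell2_op (\<lambda>f \<xi>. coord (pull {\<xi>. \<xi> j = 0} (\<lambda>\<xi>. \<xi>(j := b)) f) \<xi>)"

lemma inj_on_update_slice: "inj_on (\<lambda>\<xi>. \<xi>(j := b)) {\<xi>. \<xi> j = (0 :: int)}"
  by (rule inj_on_inverseI[where g = "\<lambda>\<xi>. \<xi>(j := 0)"]) (auto simp: fun_upd_idem)

lemma
  shows slice_pull: "slice j b f = pull {\<xi>. \<xi> j = 0} (\<lambda>\<xi>. \<xi>(j := b)) f"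
    and norm_slice: "norm (slice j b) \<le> 1"
    and complex_linear_slice: "complex_linear (slice j b)"
proof -
  let ?p = "pull {\<xi> :: nat \<Rightarrow> int. \<xi> j = 0} (\<lambda>\<xi>. \<xi>(j := b))"
  have props: "coord (?p (f + g)) \<xi> = coord (?p f) \<xi> + coord (?p g) \<xi>"
     "coord (?p (scaleC c f)) \<xi> = c * coord (?p f) \<xi>" for f g c \<xi>
    by (simp_all add: pull_add[OF inj_on_update_slice] pull_scaleC[OF inj_on_update_slice] coord_simps)
  have bound: "(\<Sum>x\<in>X. (cmod (coord (?p f) x))\<^sup>2) \<le> (1 * norm f)\<^sup>2" if "finite X" for f X
  proof -
    have "inj_on (\<lambda>(i, \<xi>). \<xi>(j := b)) ({()} \<times> {\<xi> :: nat \<Rightarrow> int. \<xi> j = 0})"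
      using inj_on_update_slice[of j b] by (auto simp: inj_on_def)
    from sum_norm_pull_le[OF _ this] sum_coord_le[OF that, of "?p f"]
    show ?thesis by (fastforce intro: order_trans)
  qed
  note * = props bound
  show "slice j b f = ?p f"
    unfolding slice_def by (rule coord_inject_ext, rule coord_ell2_op[OF *]) auto
  show "norm (slice j b) \<le> 1"
    unfolding slice_def by (rule norm_ell2_op[OF *]) auto
  show "complex_linear (slice j b)"
    unfolding slice_def complex_linear_def by (intro allI, rule scaleC_ell2_op[OF *]) auto
qed

lemma coord_slice:
  "coord (slice j b f) \<xi> = (if \<xi> j = 0 then coord f (\<xi>(j := b)) else 0)"
  by (simp add: slice_pull coord_pull[OF inj_on_update_slice])

lemma slice_ext:
  fixes A B :: "'a ell2 \<Rightarrow>\<^sub>L (nat \<Rightarrow> int) ell2"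
  assumes "\<And>b. slice j b o\<^sub>L A = slice j b o\<^sub>L B"
  shows "A = B"
proof (rule op_eqI)
  fix f \<xi>
  have "coord ((slice j (\<xi> j) o\<^sub>L A) f) (\<xi>(j := 0)) = coord ((slice j (\<xi> j) o\<^sub>L B) f) (\<xi>(j := 0))"
    by (simp add: assms)
  then show "coord (blinfun_apply A f) \<xi> = coord (blinfun_apply B f) \<xi>"
    by (simp add: coord_slice)
qed

lemma slice_0: "slice j 0 = proj {\<xi>. \<xi> j = 0}"
  by (rule op_eqI) (auto simp: coord_slice coord_simps fun_upd_idem)

lemma slice_trunc_shift:
  assumes E: "\<And>\<xi> m. \<xi>(j := m) \<in> E \<longleftrightarrow> \<xi> \<in> E" and \<eta>: "\<eta> j = 0"
  shows "slice j b o\<^sub>L trunc_shift E \<eta> = trunc_shift (E \<inter> {\<xi>. \<xi> j = 0}) \<eta> o\<^sub>L slice j b"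
  using \<eta> by (intro op_eqI) (auto simp: coord_slice coord_trunc_shift E update_minus[of \<eta> j, OF \<eta>])

lemma slice_proj:
  assumes E: "\<And>\<xi> m. \<xi>(j := m) \<in> E \<longleftrightarrow> \<xi> \<in> E"
  shows "slice j b o\<^sub>L proj E = proj (E \<inter> {\<xi>. \<xi> j = 0}) o\<^sub>L slice j b"
  by (intro op_eqI) (auto simp: coord_slice coord_simps E)

lemma slice_amp_mulop:
  assumes "\<And>x. cmod (u x) \<le> K"
  shows "slice j b o\<^sub>L amp j (mulop u) = scalar (u b) o\<^sub>L slice j b"
  by (intro op_eqI)
     (auto simp: coord_slice amp_mulop[where K = K, OF assms] coord_mulop[of "\<lambda>\<xi>. u (\<xi> j)" K, OF assms] coord_simps)

definition direct_sum :: "nat \<Rightarrow> (int \<Rightarrow> (nat \<Rightarrow> int) op) \<Rightarrow> (nat \<Rightarrow> int) op"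
  where "direct_sum j X = fibre_op (\<lambda>\<xi>. \<xi> j) (\<lambda>\<xi>. \<xi>(j := 0)) {\<xi>. \<xi> j = 0} (\<lambda>b \<xi>. \<xi>(j := b)) X"

lemma
  assumes C: "\<And>b. norm (X b) \<le> C" and lin: "\<And>b. complex_linear (X b)"
  shows norm_direct_sum: "norm (direct_sum j X) \<le> C"
    and complex_linear_direct_sum: "complex_linear (direct_sum j X)"
    and slice_direct_sum: "slice j b o\<^sub>L direct_sum j X = proj {\<xi>. \<xi> j = 0} o\<^sub>L X b o\<^sub>L slice j b"
proof -
  have C0: "0 \<le> C" using C norm_ge_zero order_trans by blast
  have inj1: "inj (\<lambda>\<xi> :: nat \<Rightarrow> int. (\<xi> j, \<xi>(j := 0)))"
    by (rule injI) (metis Pair_inject fun_upd_triv fun_upd_upd)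
  have inj2: "inj_on (\<lambda>(b, \<xi>). \<xi>(j := b)) (range (\<lambda>\<xi> :: nat \<Rightarrow> int. \<xi> j) \<times> {\<xi>. \<xi> j = 0})"
    by (rule inj_on_inverseI[where g = "\<lambda>\<xi>. (\<xi> j, \<xi>(j := 0))"]) (auto simp: fun_upd_idem)
  note * = C0 C lin inj1 inj2
  show "norm (direct_sum j X) \<le> C"
    unfolding direct_sum_def by (rule norm_fibre_op[OF *])
  show "complex_linear (direct_sum j X)"
    unfolding direct_sum_def by (rule complex_linear_fibre_op[OF *])
  show "slice j b o\<^sub>L direct_sum j X = proj {\<xi>. \<xi> j = 0} o\<^sub>L X b o\<^sub>L slice j b"
    unfolding direct_sum_def
    by (intro op_eqI) (auto simp: slice_pull coord_pull[OF inj_on_update_slice] coord_fibre_op[OF *] coord_simps fun_upd_idem)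
qed

section \<open>Partial Fourier transforms and series of operators\<close>

text \<open>
  The characters of \<open>\<int>\<close> are \<open>k \<mapsto> chi (k \<tau>)\<close>.
\<close>

definition chi :: "real \<Rightarrow> complex" where "chi t = cis (2 * pi * t)"

lemma norm_chi [simp]: "cmod (chi t) = 1" by (simp add: chi_def)

lemma chi_add: "chi (s + t) = chi s * chi t" by (simp add: chi_def cis_mult algebra_simps)

lemma chi_0 [simp]: "chi 0 = 1" by (simp add: chi_def)

lemma cnj_chi: "cnj (chi t) = chi (- t)" by (simp add: chi_def cis_cnj)

lemma nu_chi: "nu j \<tau> \<rho> z = (\<Sum>\<^sub>\<infinity>m. chi (- (of_int m * \<tau>)) * \<rho> (z(j := m)))"
  by (simp add: nu_def chi_def cis_conv_exp mult_ac)

lemma bij_betw_ZZ_update: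
  assumes "j \<in> J"
  shows "bij_betw (\<lambda>(z, m). z(j := m)) (ZZ (J - {j}) \<times> UNIV) (ZZ J)"
  by (rule bij_betw_byWitness[where f' = "\<lambda>z. (z(j := 0), z j)"])
     (use assms in \<open>auto simp: ZZ_def fun_upd_idem\<close>)

lemma summable_ZZ_split:
  fixes F :: "(nat \<Rightarrow> int) \<Rightarrow> 'b::banach"
  assumes "j \<in> J" "F summable_on ZZ J"
  shows "(\<lambda>(z, m). F (z(j := m))) summable_on ZZ (J - {j}) \<times> UNIV"
    and "infsum F (ZZ J) = (\<Sum>\<^sub>\<infinity>z\<in>ZZ (J - {j}). \<Sum>\<^sub>\<infinity>m. F (z(j := m)))"
proof -
  show s: "(\<lambda>(z, m). F (z(j := m))) summable_on ZZ (J - {j}) \<times> UNIV"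
    using assms(2) summable_on_reindex_bij_betw[OF bij_betw_ZZ_update[OF assms(1)], of F]
    by (simp add: case_prod_unfold)
  show "infsum F (ZZ J) = (\<Sum>\<^sub>\<infinity>z\<in>ZZ (J - {j}). \<Sum>\<^sub>\<infinity>m. F (z(j := m)))"
    using infsum_reindex_bij_betw[OF bij_betw_ZZ_update[OF assms(1)], of F] infsum_Sigma'_banach[OF s]
    by (simp add: case_prod_unfold)
qed

lemma abs_summable_nu:
  assumes j: "j \<in> J" and \<rho>: "(\<lambda>\<eta>. cmod (\<rho> \<eta>)) summable_on ZZ J"
  shows "(\<lambda>z. cmod (nu j \<tau> \<rho> z)) summable_on ZZ (J - {j})"
proof -
  have s: "(\<lambda>(z, m). cmod (\<rho> (z(j := m)))) summable_on ZZ (J - {j}) \<times> UNIV"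
    by (rule summable_ZZ_split[OF j \<rho>])
  have s1: "(\<lambda>m. cmod (\<rho> (z(j := m)))) summable_on UNIV" if "z \<in> ZZ (J - {j})" for z
    using summable_on_SigmaD1[OF s that] by simp
  have s2: "(\<lambda>z. \<Sum>\<^sub>\<infinity>m. cmod (\<rho> (z(j := m)))) summable_on ZZ (J - {j})"
    using summable_on_Sigma_banach[OF s] by simp
  show ?thesis
  proof (rule summable_on_comparison_test[OF s2])
    fix z assume z: "z \<in> ZZ (J - {j})"
    have "(\<lambda>m. cmod (chi (- (of_int m * \<tau>)) * \<rho> (z(j := m)))) summable_on UNIV"
      using s1[OF z] by (simp add: norm_mult)
    then show "cmod (nu j \<tau> \<rho> z) \<le> (\<Sum>\<^sub>\<infinity>m. cmod (\<rho> (z(j := m))))"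
      unfolding nu_chi using norm_infsum_bound by (fastforce simp: norm_mult)
  qed simp
qed

lemma bounded_linear_scalar_compose: "bounded_linear (\<lambda>c. scalar c o\<^sub>L (A :: 'a op))"
proof (rule bounded_linear_intro)
  show "scalar (c + d) o\<^sub>L A = (scalar c o\<^sub>L A) + (scalar d o\<^sub>L A)" for c d
    by (rule op_eqI) (simp add: coord_simps blinfun.add_left algebra_simps)
  show "scalar (r *\<^sub>R c) o\<^sub>L A = r *\<^sub>R (scalar c o\<^sub>L A)" for r c
    by (rule op_eqI) (simp add: coord_simps blinfun.scaleR_left scaleR_conv_of_real)
  show "norm (scalar c o\<^sub>L A) \<le> norm c * norm A" for c
    by (rule norm_scalar_comp_le)
qed

lemma abs_summable_scalar:
  fixes A :: "'x \<Rightarrow> 'a op"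
  assumes "(\<lambda>\<eta>. cmod (\<rho> \<eta>)) summable_on X" "\<And>\<eta>. \<eta> \<in> X \<Longrightarrow> norm (A \<eta>) \<le> K"
  shows "(\<lambda>\<eta>. norm (scalar (\<rho> \<eta>) o\<^sub>L A \<eta>)) summable_on X"
    and "(\<lambda>\<eta>. scalar (\<rho> \<eta>) o\<^sub>L A \<eta>) summable_on X"
proof -
  show "(\<lambda>\<eta>. norm (scalar (\<rho> \<eta>) o\<^sub>L A \<eta>)) summable_on X"
  proof (rule summable_on_comparison_test)
    show "(\<lambda>\<eta>. cmod (\<rho> \<eta>) * K) summable_on X" by (rule summable_on_cmult_left[OF assms(1)])
    show "norm (scalar (\<rho> \<eta>) o\<^sub>L A \<eta>) \<le> cmod (\<rho> \<eta>) * K" if "\<eta> \<in> X" for \<eta>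
      by (rule order_trans[OF norm_scalar_comp_le mult_left_mono[OF assms(2)[OF that]]]) simp
  qed simp
  then show "(\<lambda>\<eta>. scalar (\<rho> \<eta>) o\<^sub>L A \<eta>) summable_on X" by (rule abs_summable_summable)
qed

text \<open>
  Summing over the variable \<open>\<eta>\<^sub>j\<close> first is what produces the partial Fourier transform.
\<close>

lemma infsum_scalar_regroup:
  fixes A :: "(nat \<Rightarrow> int) \<Rightarrow> 'a op"
  assumes j: "j \<in> J" and \<rho>: "(\<lambda>\<eta>. cmod (\<rho> \<eta>)) summable_on ZZ J" and A: "\<And>z. norm (A z) \<le> K"
  shows "(\<Sum>\<^sub>\<infinity>\<eta>\<in>ZZ J. scalar (chi (- (of_int (\<eta> j) * \<tau>)) * \<rho> \<eta>) o\<^sub>L A (\<eta>(j := 0)))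
     = (\<Sum>\<^sub>\<infinity>z\<in>ZZ (J - {j}). scalar (nu j \<tau> \<rho> z) o\<^sub>L A z)"
proof -
  let ?F = "\<lambda>\<eta>. scalar (chi (- (of_int (\<eta> j) * \<tau>)) * \<rho> \<eta>) o\<^sub>L A (\<eta>(j := 0))"
  have "?F summable_on ZZ J"
    using \<rho> A by (intro abs_summable_scalar(2)) (auto simp: norm_mult)
  then have "infsum ?F (ZZ J) = (\<Sum>\<^sub>\<infinity>z\<in>ZZ (J - {j}). \<Sum>\<^sub>\<infinity>m. ?F (z(j := m)))"
    by (rule summable_ZZ_split[OF j])
  also have "\<dots> = (\<Sum>\<^sub>\<infinity>z\<in>ZZ (J - {j}). scalar (nu j \<tau> \<rho> z) o\<^sub>L A z)"
  proof (rule infsum_cong)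
    fix z assume z: "z \<in> ZZ (J - {j})"
    then have z0: "z(j := 0) = z" by (auto simp: ZZ_def fun_upd_idem)
    have "(\<lambda>(z, m). cmod (\<rho> (z(j := m)))) summable_on ZZ (J - {j}) \<times> UNIV"
      by (rule summable_ZZ_split[OF j \<rho>])
    from summable_on_SigmaD1[OF this z]
    have "(\<lambda>m. cmod (chi (- (of_int m * \<tau>)) * \<rho> (z(j := m)))) summable_on UNIV"
      by (simp add: norm_mult)
    then have "(\<lambda>m. chi (- (of_int m * \<tau>)) * \<rho> (z(j := m))) summable_on UNIV"
      by (rule abs_summable_summable)
    from infsumI[OF has_sum_bounded_linear[OF bounded_linear_scalar_compose has_sum_infsum[OF this]], of "A z"]
    show "(\<Sum>\<^sub>\<infinity>m. ?F (z(j := m))) = scalar (nu j \<tau> \<rho> z) o\<^sub>L A z"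
      by (simp add: nu_chi z0)
  qed
  finally show ?thesis .
qed

lemma norm_compose_le:
  "norm A \<le> a \<Longrightarrow> norm B \<le> b \<Longrightarrow> norm (A o\<^sub>L B) \<le> a * b"
  by (meson mult_mono norm_blinfun_compose norm_ge_zero order_trans)

lemma norm_diff_le:
  fixes A B :: "'a::real_normed_vector"
  shows "norm A \<le> a \<Longrightarrow> norm B \<le> b \<Longrightarrow> norm (A - B) \<le> a + b"
  using norm_triangle_ineq4[of A B] by linarith

lemmas blinfun_diff_left = bounded_bilinear.diff_left[OF bounded_bilinear_blinfun_compose]
lemmas blinfun_diff_right = bounded_bilinear.diff_right[OF bounded_bilinear_blinfun_compose]

lemma norm_tendsto_0_le:
  assumes "(g \<longlongrightarrow> 0) F" "\<And>n. norm (f n) \<le> g n"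
  shows "((\<lambda>n. norm (f n)) \<longlongrightarrow> 0) F"
  by (rule tendsto_norm_zero[OF Lim_null_comparison[OF always_eventually assms(1)]]) (use assms(2) in blast)

text \<open>Dominated convergence for sums, with the dominating function \<open>K * a\<close>.\<close>

lemma infsum_dominated_tendsto_0:
  fixes a :: "'x \<Rightarrow> real"
  assumes a: "a summable_on X" "\<And>x. x \<in> X \<Longrightarrow> 0 \<le> a x"
    and c: "\<And>n x. 0 \<le> c n x" "\<And>n x. x \<in> X \<Longrightarrow> c n x \<le> K"
    and lim: "\<And>x. x \<in> X \<Longrightarrow> ((\<lambda>n. c n x) \<longlongrightarrow> 0) F"
  shows "((\<lambda>n. \<Sum>\<^sub>\<infinity>x\<in>X. a x * c n x) \<longlongrightarrow> 0) F"
proof (rule tendstoI)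
  fix e :: real assume e: "0 < e"
  define d where "d = e / (2 * (\<bar>K\<bar> + 1))"
  have d: "0 < d" "\<bar>K\<bar> * d < e / 2" using e by (auto simp: d_def field_simps)
  have "eventually (\<lambda>Y. dist (sum a Y) (infsum a X) < d) (finite_subsets_at_top X)"
    by (rule tendstoD[OF infsum_tendsto[OF a(1)] d(1)])
  then obtain Y where Y: "finite Y" "Y \<subseteq> X" "dist (sum a Y) (infsum a X) < d"
    unfolding eventually_finite_subsets_at_top by blast
  have s: "(\<lambda>x. a x * c n x) summable_on Z" if "Z \<subseteq> X" for n Z
  proof (rule summable_on_comparison_test)
    show "(\<lambda>x. a x * K) summable_on Z"
      by (intro summable_on_cmult_left summable_on_subset_banach[OF a(1) that])
  qed (use a c that in \<open>auto intro!: mult_left_mono\<close>)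
  have tail: "infsum (\<lambda>x. a x * c n x) (X - Y) < e / 2" for n
  proof -
    have "infsum (\<lambda>x. a x * c n x) (X - Y) \<le> infsum (\<lambda>x. a x * K) (X - Y)"
      using a c by (intro infsum_mono s summable_on_cmult_left summable_on_subset_banach[OF a(1)] mult_left_mono) auto
    also have "\<dots> = K * infsum a (X - Y)" by (simp add: infsum_cmult_left')
    also have "\<dots> \<le> \<bar>K\<bar> * infsum a (X - Y)"
      using a by (intro mult_right_mono infsum_nonneg) auto
    also have "infsum a (X - Y) = infsum a X - sum a Y"
      using Y infsum_Diff[OF a(1), of Y] by simp
    also have "\<bar>K\<bar> * (infsum a X - sum a Y) \<le> \<bar>K\<bar> * d"
      using Y(3) by (intro mult_left_mono) (auto simp: dist_real_def)
    finally show ?thesis using d(2) by simp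
  qed
  have "((\<lambda>n. \<Sum>x\<in>Y. a x * c n x) \<longlongrightarrow> (\<Sum>x\<in>Y. a x * 0)) F"
    using Y(2) lim by (intro tendsto_intros) blast
  then have "((\<lambda>n. \<Sum>x\<in>Y. a x * c n x) \<longlongrightarrow> 0) F" by simp
  from tendstoD[OF this, of "e / 2"] e
  have "eventually (\<lambda>n. dist (\<Sum>x\<in>Y. a x * c n x) 0 < e / 2) F" by simp
  then show "eventually (\<lambda>n. dist (\<Sum>\<^sub>\<infinity>x\<in>X. a x * c n x) 0 < e) F"
  proof eventually_elim
    case (elim n)
    have "infsum (\<lambda>x. a x * c n x) X = infsum (\<lambda>x. a x * c n x) Y + infsum (\<lambda>x. a x * c n x) (X - Y)"
      using infsum_Un_disjoint[of "\<lambda>x. a x * c n x" Y "X - Y"] Y s by (simp add: Un_absorb1)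
    moreover have "0 \<le> infsum (\<lambda>x. a x * c n x) X"
      using a c by (intro infsum_nonneg) auto
    ultimately show ?case using elim tail[of n] Y(1) by (simp add: dist_real_def)
  qed
qed

lemma infsum_scalar_tendsto_0:
  fixes A :: "'n \<Rightarrow> 'x \<Rightarrow> 'a op"
  assumes \<rho>: "(\<lambda>\<eta>. cmod (\<rho> \<eta>)) summable_on X"
    and K: "\<And>n \<eta>. \<eta> \<in> X \<Longrightarrow> norm (A n \<eta>) \<le> K"
    and lim: "\<And>\<eta>. \<eta> \<in> X \<Longrightarrow> ((\<lambda>n. norm (A n \<eta>)) \<longlongrightarrow> 0) F"
  shows "((\<lambda>n. norm (\<Sum>\<^sub>\<infinity>\<eta>\<in>X. scalar (\<rho> \<eta>) o\<^sub>L A n \<eta>)) \<longlongrightarrow> 0) F"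
proof (rule norm_tendsto_0_le)
  show "((\<lambda>n. \<Sum>\<^sub>\<infinity>\<eta>\<in>X. cmod (\<rho> \<eta>) * norm (A n \<eta>)) \<longlongrightarrow> 0) F"
    by (rule infsum_dominated_tendsto_0[OF \<rho> _ _ K lim]) auto
  show "norm (\<Sum>\<^sub>\<infinity>\<eta>\<in>X. scalar (\<rho> \<eta>) o\<^sub>L A n \<eta>) \<le> (\<Sum>\<^sub>\<infinity>\<eta>\<in>X. cmod (\<rho> \<eta>) * norm (A n \<eta>))" for n
  proof (rule order_trans[OF norm_infsum_bound infsum_mono])
    show s: "(\<lambda>\<eta>. norm (scalar (\<rho> \<eta>) o\<^sub>L A n \<eta>)) summable_on X"
      by (rule abs_summable_scalar(1)[OF \<rho> K])
    then show "(\<lambda>\<eta>. norm (scalar (\<rho> \<eta>) o\<^sub>L A n \<eta>)) summable_on X" .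
    show "(\<lambda>\<eta>. cmod (\<rho> \<eta>) * norm (A n \<eta>)) summable_on X"
      by (rule summable_on_comparison_test[OF summable_on_cmult_left[OF \<rho>, of K]])
         (auto intro!: mult_left_mono K)
  qed (rule norm_scalar_comp_le)
qed

lemma
  fixes A B :: "'x \<Rightarrow> 'a op"
  assumes \<rho>: "(\<lambda>\<eta>. cmod (\<rho> \<eta>)) summable_on X" and A: "\<And>\<eta>. norm (A \<eta>) \<le> K"
  shows infsum_scalar_compose_right:
      "(\<Sum>\<^sub>\<infinity>\<eta>\<in>X. scalar (\<rho> \<eta>) o\<^sub>L A \<eta>) o\<^sub>L S = (\<Sum>\<^sub>\<infinity>\<eta>\<in>X. scalar (\<rho> \<eta>) o\<^sub>L (A \<eta> o\<^sub>L S))"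
    and infsum_scalar_compose_left: "complex_linear S \<Longrightarrow>
      S o\<^sub>L (\<Sum>\<^sub>\<infinity>\<eta>\<in>X. scalar (\<rho> \<eta>) o\<^sub>L A \<eta>) = (\<Sum>\<^sub>\<infinity>\<eta>\<in>X. scalar (\<rho> \<eta>) o\<^sub>L (S o\<^sub>L A \<eta>))"
    and infsum_scalar_diff: "(\<And>\<eta>. norm (B \<eta>) \<le> L) \<Longrightarrow>
      (\<Sum>\<^sub>\<infinity>\<eta>\<in>X. scalar (\<rho> \<eta>) o\<^sub>L A \<eta>) - (\<Sum>\<^sub>\<infinity>\<eta>\<in>X. scalar (\<rho> \<eta>) o\<^sub>L B \<eta>)
        = (\<Sum>\<^sub>\<infinity>\<eta>\<in>X. scalar (\<rho> \<eta>) o\<^sub>L (A \<eta> - B \<eta>))"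
proof -
  have s: "(\<lambda>\<eta>. scalar (\<rho> \<eta>) o\<^sub>L A \<eta>) summable_on X"
    by (rule abs_summable_scalar(2)[OF \<rho> A])
  have "(\<Sum>\<^sub>\<infinity>\<eta>\<in>X. (scalar (\<rho> \<eta>) o\<^sub>L A \<eta>) o\<^sub>L S) = (\<Sum>\<^sub>\<infinity>\<eta>\<in>X. scalar (\<rho> \<eta>) o\<^sub>L A \<eta>) o\<^sub>L S"
    by (intro infsumI has_sum_bounded_linear[OF _ has_sum_infsum[OF s]]
        bounded_bilinear.bounded_linear_left[OF bounded_bilinear_blinfun_compose])
  then show "(\<Sum>\<^sub>\<infinity>\<eta>\<in>X. scalar (\<rho> \<eta>) o\<^sub>L A \<eta>) o\<^sub>L S = (\<Sum>\<^sub>\<infinity>\<eta>\<in>X. scalar (\<rho> \<eta>) o\<^sub>L (A \<eta> o\<^sub>L S))"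
    by (simp add: blinfun_compose_assoc')
  show "S o\<^sub>L (\<Sum>\<^sub>\<infinity>\<eta>\<in>X. scalar (\<rho> \<eta>) o\<^sub>L A \<eta>) = (\<Sum>\<^sub>\<infinity>\<eta>\<in>X. scalar (\<rho> \<eta>) o\<^sub>L (S o\<^sub>L A \<eta>))"
    if "complex_linear S"
  proof -
    have "(\<Sum>\<^sub>\<infinity>\<eta>\<in>X. S o\<^sub>L (scalar (\<rho> \<eta>) o\<^sub>L A \<eta>)) = S o\<^sub>L (\<Sum>\<^sub>\<infinity>\<eta>\<in>X. scalar (\<rho> \<eta>) o\<^sub>L A \<eta>)"
      by (intro infsumI has_sum_bounded_linear[OF _ has_sum_infsum[OF s]]
          bounded_bilinear.bounded_linear_right[OF bounded_bilinear_blinfun_compose])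
    then show ?thesis by (simp add: complex_linear_scalar_commute[OF that])
  qed
  show "(\<Sum>\<^sub>\<infinity>\<eta>\<in>X. scalar (\<rho> \<eta>) o\<^sub>L A \<eta>) - (\<Sum>\<^sub>\<infinity>\<eta>\<in>X. scalar (\<rho> \<eta>) o\<^sub>L B \<eta>)
        = (\<Sum>\<^sub>\<infinity>\<eta>\<in>X. scalar (\<rho> \<eta>) o\<^sub>L (A \<eta> - B \<eta>))" if B: "\<And>\<eta>. norm (B \<eta>) \<le> L"
  proof -
    have "((\<lambda>\<eta>. (scalar (\<rho> \<eta>) o\<^sub>L A \<eta>) + - (scalar (\<rho> \<eta>) o\<^sub>L B \<eta>)) has_sum
        (\<Sum>\<^sub>\<infinity>\<eta>\<in>X. scalar (\<rho> \<eta>) o\<^sub>L A \<eta>) + - (\<Sum>\<^sub>\<infinity>\<eta>\<in>X. scalar (\<rho> \<eta>) o\<^sub>L B \<eta>)) X"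
      using abs_summable_scalar(2)[OF \<rho> B]
      by (intro has_sum_add has_sum_infsum s has_sum_uminus[THEN iffD2]) (simp add: has_sum_infsum)
    then show ?thesis by (intro infsumI[symmetric]) (simp add: blinfun_diff_right)
  qed
qed

section \<open>Symbols at the faces\<close>

text \<open>The octant without the wall in direction \<open>j\<close>.\<close>

definition Cyl :: "nat set \<Rightarrow> nat \<Rightarrow> (nat \<Rightarrow> int) set"
  where "Cyl J j = {\<xi> \<in> ZZ J. \<forall>i\<in>J - {j}. 1 \<le> \<xi> i}"

lemma Cyl_update: "j \<in> J \<Longrightarrow> \<xi>(j := m) \<in> Cyl J j \<longleftrightarrow> \<xi> \<in> Cyl J j"
  by (auto simp: Cyl_def ZZ_def)

lemma NN_eq_Cyl: "j \<in> J \<Longrightarrow> NN J = {\<xi> \<in> Cyl J j. 1 \<le> \<xi> j}"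
  by (auto simp: Cyl_def NN_def)

lemma Cyl_slice: "j \<in> J \<Longrightarrow> Cyl J j \<inter> {\<xi>. \<xi> j = 0} = NN (J - {j})"
  by (auto simp: Cyl_def NN_def ZZ_def)

text \<open>
  A truncated shift is the product of a shift in the variables other than \<open>\<xi>\<^sub>j\<close>, which commutes with all
  operators acting in \<open>\<xi>\<^sub>j\<close> alone, and a shift of the half-line.
\<close>

lemma trunc_shift_NN_factor:
  assumes "j \<in> J"
  shows "trunc_shift (NN J) \<eta> = trunc_shift (Cyl J j) (\<eta>(j := 0)) o\<^sub>L amp j (trunc_shift {1..} (\<eta> j))"
proof (rule op_eqI)
  fix f \<xi>
  have 1: "\<xi> - \<eta> = (\<xi> - \<eta>(j := 0))(j := \<xi> j - \<eta> j)" by (auto simp: fun_eq_iff)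
  have 2: "\<xi> - \<eta> \<in> Cyl J j \<longleftrightarrow> \<xi> - \<eta>(j := 0) \<in> Cyl J j" by (subst 1) (rule Cyl_update[OF assms])
  have 3: "coord (line j (\<xi> - \<eta>(j := 0)) f) (\<xi> j - \<eta> j) = coord f (\<xi> - \<eta>)"
    by (subst 1) (simp add: coord_line)
  show "coord (trunc_shift (NN J) \<eta> f) \<xi> =
      coord ((trunc_shift (Cyl J j) (\<eta>(j := 0)) o\<^sub>L amp j (trunc_shift {1..} (\<eta> j))) f) \<xi>"
    by (simp add: coord_trunc_shift coord_amp complex_linear_trunc_shift NN_eq_Cyl[OF assms] 2 3)
qed

abbreviation TV :: "nat set \<Rightarrow> ((nat \<Rightarrow> int) \<Rightarrow> complex) \<Rightarrow> ((nat \<Rightarrow> int) \<Rightarrow> complex) \<Rightarrow> (nat \<Rightarrow> int) op"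
  where "TV J \<rho> \<sigma> \<equiv> toeplitz_T J \<rho> + toeplitz_V J \<sigma>"

text \<open>
  The image of the shift by \<open>k\<close> under a Fourier transform, on a space whose basis vector \<open>b\<close> has
  frequency \<open>\<theta> b\<close>.
\<close>

definition freq :: "(int \<Rightarrow> real) \<Rightarrow> int \<Rightarrow> int op"
  where "freq \<theta> k = mulop (\<lambda>b. chi (- (of_int k * \<theta> b)))"

lemma
  shows coord_freq: "coord (freq \<theta> k f) b = chi (- (of_int k * \<theta> b)) * coord f b"
    and norm_freq: "norm (freq \<theta> k) \<le> 1"
    and complex_linear_freq: "complex_linear (freq \<theta> k)"
  unfolding freq_def by (rule coord_mulop[where K = 1] norm_mulop complex_linear_mulop[where K = 1], simp)+

lemma freq_freq_minus: "freq \<theta> k o\<^sub>L freq \<theta> (- k) = id_blinfun" "freq \<theta> (- k) o\<^sub>L freq \<theta> k = id_blinfun"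
  by (rule op_eqI, simp add: coord_freq mult.assoc[symmetric] chi_add[symmetric])+

text \<open>
  The result of replacing the half-line shifts in \<open>T\<^sub>\<rho> + V\<^sub>\<sigma>\<close> by multiplications with characters. It is
  the direct sum of the faces at the frequencies \<open>\<theta> b\<close> (\<open>slice_face_symbol\<close>), but in the form of a series it
  can be compared with \<open>T\<^sub>\<rho> + V\<^sub>\<sigma>\<close> term by term. In the second series the characters of \<open>\<eta>\<^sub>j\<close> and \<open>- \<eta>\<^sub>j\<close>
  have cancelled, whence \<open>nu j 0 \<sigma>\<close> in the faces.
\<close>

definition face_symbol :: "nat set \<Rightarrow> nat \<Rightarrow> (int \<Rightarrow> real) \<Rightarrow> ((nat \<Rightarrow> int) \<Rightarrow> complex) \<Rightarrow> ((nat \<Rightarrow> int) \<Rightarrow> complex) \<Rightarrow> (nat \<Rightarrow> int) op"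
  where "face_symbol J j \<theta> \<rho> \<sigma> =
    (\<Sum>\<^sub>\<infinity>\<eta>\<in>ZZ J. scalar (\<rho> \<eta>) o\<^sub>L (amp j (freq \<theta> (\<eta> j)) o\<^sub>L trunc_shift (Cyl J j) (\<eta>(j := 0)))) +
    (\<Sum>\<^sub>\<infinity>\<eta>\<in>ZZ J. scalar (\<sigma> \<eta>) o\<^sub>L
       (trunc_shift (Cyl J j) (\<eta>(j := 0)) o\<^sub>L trunc_shift (Cyl J j) (- \<eta>(j := 0))))"

lemma norm_amp_freq: "norm (amp j (freq \<theta> k)) \<le> 1"
  using norm_amp[OF complex_linear_freq] norm_freq by (rule order_trans)

lemma norm_trunc_shift2_le: "norm (trunc_shift E \<eta> o\<^sub>L trunc_shift E \<zeta>) \<le> 1"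
  using norm_compose_le[OF norm_trunc_shift_le norm_trunc_shift_le] by simp

lemma toeplitz_V_alt:
  "toeplitz_V J \<rho> = (\<Sum>\<^sub>\<infinity>\<eta>\<in>ZZ J. scalar (\<rho> \<eta>) o\<^sub>L (trunc_shift (NN J) \<eta> o\<^sub>L trunc_shift (NN J) (- \<eta>)))"
  by (simp add: toeplitz_V_def hilbert_adjoint_trunc_shift)

lemma scalar_scalar: "scalar a o\<^sub>L (scalar b o\<^sub>L A) = scalar (b * a) o\<^sub>L (A :: 'a op)"
  by (rule op_eqI) (simp add: coord_simps)

context
  fixes J j and \<rho> \<sigma> :: "(nat \<Rightarrow> int) \<Rightarrow> complex"
  assumes j: "j \<in> J"
    and \<rho>: "(\<lambda>\<eta>. cmod (\<rho> \<eta>)) summable_on ZZ J"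
    and \<sigma>: "(\<lambda>\<eta>. cmod (\<sigma> \<eta>)) summable_on ZZ J"
begin

lemma slice_face_symbol:
  "slice j b o\<^sub>L face_symbol J j \<theta> \<rho> \<sigma> = TV (J - {j}) (nu j (\<theta> b) \<rho>) (nu j 0 \<sigma>) o\<^sub>L slice j b"
proof -
  let ?w = "\<lambda>\<eta>. trunc_shift (Cyl J j) (\<eta>(j := 0))"
  let ?v = "trunc_shift (NN (J - {j}))"
  have sw: "slice j b o\<^sub>L trunc_shift (Cyl J j) \<eta> = ?v \<eta> o\<^sub>L slice j b" if "\<eta> j = 0" for \<eta>
    by (simp add: slice_trunc_shift Cyl_update j that Cyl_slice)
  have T: "slice j b o\<^sub>L (\<Sum>\<^sub>\<infinity>\<eta>\<in>ZZ J. scalar (\<rho> \<eta>) o\<^sub>L (amp j (freq \<theta> (\<eta> j)) o\<^sub>L ?w \<eta>))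
      = toeplitz_T (J - {j}) (nu j (\<theta> b) \<rho>) o\<^sub>L slice j b" (is "?L = _")
  proof -
    have "slice j b o\<^sub>L amp j (freq \<theta> k) = scalar (chi (- (of_int k * \<theta> b))) o\<^sub>L slice j b" for k
      unfolding freq_def by (rule slice_amp_mulop[where K = 1]) simp
    then have *: "slice j b o\<^sub>L (amp j (freq \<theta> (\<eta> j)) o\<^sub>L ?w \<eta>)
        = scalar (chi (- (of_int (\<eta> j) * \<theta> b))) o\<^sub>L (?v (\<eta>(j := 0)) o\<^sub>L slice j b)" for \<eta>
      by (simp add: blinfun_compose_assoc'[symmetric]) (simp add: blinfun_compose_assoc' sw)
    have bd: "norm (amp j (freq \<theta> (\<eta> j)) o\<^sub>L ?w \<eta>) \<le> 1 * 1" for \<eta>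
      by (intro norm_compose_le norm_amp_freq norm_trunc_shift_le)
    have "?L = (\<Sum>\<^sub>\<infinity>\<eta>\<in>ZZ J. scalar (chi (- (of_int (\<eta> j) * \<theta> b)) * \<rho> \<eta>) o\<^sub>L (?v (\<eta>(j := 0)) o\<^sub>L slice j b))"
      unfolding infsum_scalar_compose_left[where A = "\<lambda>\<eta>. amp j (freq \<theta> (\<eta> j)) o\<^sub>L ?w \<eta>", OF \<rho> bd complex_linear_slice] by (simp only: * scalar_scalar)
    also have "\<dots> = (\<Sum>\<^sub>\<infinity>z\<in>ZZ (J - {j}). scalar (nu j (\<theta> b) \<rho> z) o\<^sub>L (?v z o\<^sub>L slice j b))"
      by (rule infsum_scalar_regroup[OF j \<rho>]) (rule norm_compose_le[OF norm_trunc_shift_le norm_slice])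
    also have "\<dots> = toeplitz_T (J - {j}) (nu j (\<theta> b) \<rho>) o\<^sub>L slice j b"
      unfolding toeplitz_T_def
      by (rule infsum_scalar_compose_right[symmetric, OF abs_summable_nu[OF j \<rho>] norm_trunc_shift_le])
    finally show ?thesis .
  qed
  have V: "slice j b o\<^sub>L (\<Sum>\<^sub>\<infinity>\<eta>\<in>ZZ J. scalar (\<sigma> \<eta>) o\<^sub>L (?w \<eta> o\<^sub>L trunc_shift (Cyl J j) (- \<eta>(j := 0))))
      = toeplitz_V (J - {j}) (nu j 0 \<sigma>) o\<^sub>L slice j b" (is "?L = _")
  proof -
    have *: "slice j b o\<^sub>L (?w \<eta> o\<^sub>L trunc_shift (Cyl J j) (- \<eta>(j := 0)))
        = (?v (\<eta>(j := 0)) o\<^sub>L ?v (- \<eta>(j := 0))) o\<^sub>L slice j b" for \<eta>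
      by (simp add: blinfun_compose_assoc'[symmetric] sw) (simp add: blinfun_compose_assoc' sw)
    have "?L = (\<Sum>\<^sub>\<infinity>\<eta>\<in>ZZ J. scalar (chi (- (of_int (\<eta> j) * 0)) * \<sigma> \<eta>) o\<^sub>L ((?v (\<eta>(j := 0)) o\<^sub>L ?v (- \<eta>(j := 0))) o\<^sub>L slice j b))"
      by (simp add: infsum_scalar_compose_left[OF \<sigma> norm_trunc_shift2_le complex_linear_slice] *)
    also have "\<dots> = (\<Sum>\<^sub>\<infinity>z\<in>ZZ (J - {j}). scalar (nu j 0 \<sigma> z) o\<^sub>L ((?v z o\<^sub>L ?v (- z)) o\<^sub>L slice j b))"
      by (rule infsum_scalar_regroup[OF j \<sigma>]) (rule norm_compose_le[OF norm_trunc_shift2_le norm_slice])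
    also have "\<dots> = toeplitz_V (J - {j}) (nu j 0 \<sigma>) o\<^sub>L slice j b"
      unfolding toeplitz_V_alt
      by (rule infsum_scalar_compose_right[symmetric, OF abs_summable_nu[OF j \<sigma>] norm_trunc_shift2_le])
    finally show ?thesis .
  qed
  show ?thesis
    unfolding face_symbol_def by (simp add: blinfun_compose_bilinear T V)
qed

end

section \<open>Asymptotic intertwiners\<close>

abbreviation hshift :: "int \<Rightarrow> int op" where "hshift \<equiv> trunc_shift {1..}"

abbreviation shift_defect :: "int \<Rightarrow> int op \<Rightarrow> (int \<Rightarrow> real) \<Rightarrow> int op"
  where "shift_defect k s \<theta> \<equiv> (hshift k o\<^sub>L s) - (s o\<^sub>L freq \<theta> k)"

text \<open>
  The operator \<open>s n\<close> takes the space with frequencies \<open>\<theta> n\<close> to \<open>\<ell>\<^sup>2\<close> of the half-line and asymptotically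
  intertwines \<open>freq (\<theta> n)\<close> with the half-line shifts; \<open>t n\<close> goes in the opposite direction and is the
  adjoint of \<open>s n\<close> in the applications.
\<close>

locale wave_packets =
  fixes s t :: "nat \<Rightarrow> int op" and \<theta> :: "nat \<Rightarrow> int \<Rightarrow> real" and M :: real
  assumes lin: "complex_linear (s n)" "complex_linear (t n)"
    and bounded: "norm (s n) \<le> M" "norm (t n) \<le> M"
    and shift_right: "(\<lambda>n. norm (shift_defect k (s n) (\<theta> n))) \<longlonglongrightarrow> 0"
    and shift_left: "(\<lambda>n. norm ((t n o\<^sub>L hshift k) - (freq (\<theta> n) k o\<^sub>L t n))) \<longlonglongrightarrow> 0"
begin

text \<open>
  The half-line projection \<open>hshift k o\<^sub>L hshift (- k)\<close> asymptotically acts as the identity, because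
  \<open>freq (\<theta> n) k\<close> and \<open>freq (\<theta> n) (- k)\<close> are mutually inverse.
\<close>

lemma V_right: "(\<lambda>n. norm ((hshift k o\<^sub>L hshift (- k) o\<^sub>L s n) - s n)) \<longlonglongrightarrow> 0"
proof (rule norm_tendsto_0_le)
  let ?e = "\<lambda>k n. shift_defect k (s n) (\<theta> n)"
  show "(\<lambda>n. norm (?e (- k) n) + norm (?e k n)) \<longlonglongrightarrow> 0"
    using tendsto_add[OF shift_right[of "- k"] shift_right[of k]] by simp
  show "norm ((hshift k o\<^sub>L hshift (- k) o\<^sub>L s n) - s n) \<le> norm (?e (- k) n) + norm (?e k n)" for n
  proof -
    have "(hshift k o\<^sub>L hshift (- k) o\<^sub>L s n) - s n = (hshift k o\<^sub>L ?e (- k) n) + (?e k n o\<^sub>L freq (\<theta> n) (- k))"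
      by (simp add: blinfun_diff_left blinfun_diff_right blinfun_compose_assoc' freq_freq_minus)
         (auto intro!: blinfun_eqI simp: blinfun.diff_left)
    moreover have "norm (hshift k o\<^sub>L ?e (- k) n) \<le> 1 * norm (?e (- k) n)"
      by (rule norm_compose_le[OF norm_trunc_shift_le order_refl])
    moreover have "norm (?e k n o\<^sub>L freq (\<theta> n) (- k)) \<le> norm (?e k n) * 1"
      by (rule norm_compose_le[OF order_refl norm_freq])
    ultimately show ?thesis using norm_triangle_ineq by (smt (verit))
  qed
qed

lemma V_left: "(\<lambda>n. norm ((t n o\<^sub>L (hshift k o\<^sub>L hshift (- k))) - t n)) \<longlonglongrightarrow> 0"
proof (rule norm_tendsto_0_le)
  let ?e = "\<lambda>k n. (t n o\<^sub>L hshift k) - (freq (\<theta> n) k o\<^sub>L t n)"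
  show "(\<lambda>n. norm (?e k n) + norm (?e (- k) n)) \<longlonglongrightarrow> 0"
    using tendsto_add[OF shift_left[of k] shift_left[of "- k"]] by simp
  show "norm ((t n o\<^sub>L (hshift k o\<^sub>L hshift (- k))) - t n) \<le> norm (?e k n) + norm (?e (- k) n)" for n
  proof -
    have "(t n o\<^sub>L (hshift k o\<^sub>L hshift (- k))) - t n = (?e k n o\<^sub>L hshift (- k)) + (freq (\<theta> n) k o\<^sub>L ?e (- k) n)"
      by (simp add: blinfun_diff_left blinfun_diff_right blinfun_compose_assoc'[symmetric] freq_freq_minus)
         (auto intro!: blinfun_eqI simp: blinfun.diff_left)
    moreover have "norm (?e k n o\<^sub>L hshift (- k)) \<le> norm (?e k n) * 1"
      by (rule norm_compose_le[OF order_refl norm_trunc_shift_le])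
    moreover have "norm (freq (\<theta> n) k o\<^sub>L ?e (- k) n) \<le> 1 * norm (?e (- k) n)"
      by (rule norm_compose_le[OF norm_freq order_refl])
    ultimately show ?thesis using norm_triangle_ineq by (smt (verit))
  qed
qed

context
  fixes J j and \<rho> \<sigma> :: "(nat \<Rightarrow> int) \<Rightarrow> complex"
  assumes j: "j \<in> J"
    and \<rho>: "(\<lambda>\<eta>. cmod (\<rho> \<eta>)) summable_on ZZ J"
    and \<sigma>: "(\<lambda>\<eta>. cmod (\<sigma> \<eta>)) summable_on ZZ J"
begin

lemma trunc_shift_V_factor:
  "trunc_shift (NN J) \<eta> o\<^sub>L trunc_shift (NN J) (- \<eta>)
   = trunc_shift (Cyl J j) (\<eta>(j := 0)) o\<^sub>L trunc_shift (Cyl J j) (- \<eta>(j := 0)) o\<^sub>L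
       amp j (hshift (\<eta> j) o\<^sub>L hshift (- \<eta> j))"
proof -
  have m: "(- \<eta>)(j := 0) = - \<eta>(j := 0)" by (auto simp: fun_eq_iff)
  have "amp j (hshift k) o\<^sub>L trunc_shift (Cyl J j) (- \<eta>(j := 0)) = trunc_shift (Cyl J j) (- \<eta>(j := 0)) o\<^sub>L amp j (hshift k)" for k
    by (rule amp_trunc_shift_commute[symmetric]) (auto simp: Cyl_update j complex_linear_trunc_shift)
  then show ?thesis
    unfolding trunc_shift_NN_factor[OF j, of \<eta>] trunc_shift_NN_factor[OF j, of "- \<eta>"] m
    by (simp add: amp_compose complex_linear_trunc_shift blinfun_compose_assoc')
       (simp add: blinfun_compose_assoc'[symmetric])
qed

lemma amp_Cyl_commute:
  "complex_linear a \<Longrightarrow> \<zeta> j = 0 \<Longrightarrow>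
    amp j a o\<^sub>L trunc_shift (Cyl J j) \<zeta> = trunc_shift (Cyl J j) \<zeta> o\<^sub>L amp j a"
  by (rule amp_trunc_shift_commute[symmetric]) (auto simp: Cyl_update j)

text \<open>
  The form in which the errors of the intertwining relations for \<open>T\<^sub>\<rho> + V\<^sub>\<sigma>\<close> appear: those of the shift by
  \<open>\<eta>\<close> depend on \<open>\<eta>\<^sub>j\<close> alone, up to a contraction.
\<close>

lemma symbol_error_tendsto_0:
  assumes lin: "\<And>k n. complex_linear (e k n)" "\<And>k n. complex_linear (f k n)"
    and bound: "\<And>k n. norm (e k n) \<le> K" "\<And>k n. norm (f k n) \<le> K"
    and lim: "\<And>k. (\<lambda>n. norm (e k n)) \<longlonglongrightarrow> 0" "\<And>k. (\<lambda>n. norm (f k n)) \<longlonglongrightarrow> 0"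
  shows "(\<lambda>n. norm
      ((\<Sum>\<^sub>\<infinity>\<eta>\<in>ZZ J. scalar (\<rho> \<eta>) o\<^sub>L (trunc_shift (Cyl J j) (\<eta>(j := 0)) o\<^sub>L amp j (e (\<eta> j) n))) +
       (\<Sum>\<^sub>\<infinity>\<eta>\<in>ZZ J. scalar (\<sigma> \<eta>) o\<^sub>L (trunc_shift (Cyl J j) (\<eta>(j := 0)) o\<^sub>L
          trunc_shift (Cyl J j) (- \<eta>(j := 0)) o\<^sub>L amp j (f (\<eta> j) n))))) \<longlonglongrightarrow> 0"
    (is "(\<lambda>n. norm ((\<Sum>\<^sub>\<infinity>\<eta>\<in>ZZ J. scalar (\<rho> \<eta>) o\<^sub>L ?A n \<eta>) + (\<Sum>\<^sub>\<infinity>\<eta>\<in>ZZ J. scalar (\<sigma> \<eta>) o\<^sub>L ?B n \<eta>))) \<longlonglongrightarrow> 0")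
proof (rule norm_tendsto_0_le[OF _ norm_triangle_ineq])
  let ?R = "\<lambda>A. \<Sum>\<^sub>\<infinity>\<eta>\<in>ZZ J. scalar (\<rho> \<eta>) o\<^sub>L A \<eta>"
  let ?S = "\<lambda>A. \<Sum>\<^sub>\<infinity>\<eta>\<in>ZZ J. scalar (\<sigma> \<eta>) o\<^sub>L A \<eta>"
  have A: "norm (?A n \<eta>) \<le> norm (e (\<eta> j) n)" for n \<eta>
    using norm_compose_le[OF norm_trunc_shift_le norm_amp[OF lin(1)]] by fastforce
  have B: "norm (?B n \<eta>) \<le> norm (f (\<eta> j) n)" for n \<eta>
    using norm_compose_le[OF norm_trunc_shift2_le norm_amp[OF lin(2)]] by fastforce
  have "(\<lambda>n. norm (?R (?A n))) \<longlonglongrightarrow> 0"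
    by (rule infsum_scalar_tendsto_0[OF \<rho> order_trans[OF A bound(1)] norm_tendsto_0_le[OF lim(1) A]])
  moreover have "(\<lambda>n. norm (?S (?B n))) \<longlonglongrightarrow> 0"
    by (rule infsum_scalar_tendsto_0[OF \<sigma> order_trans[OF B bound(2)] norm_tendsto_0_le[OF lim(2) B]])
  ultimately show "(\<lambda>n. norm (?R (?A n)) +
      norm (?S (?B n))) \<longlonglongrightarrow> 0"
    using tendsto_add by fastforce
qed

lemma symbol_right:
  "(\<lambda>n. norm ((TV J \<rho> \<sigma> o\<^sub>L amp j (s n)) - (amp j (s n) o\<^sub>L face_symbol J j (\<theta> n) \<rho> \<sigma>))) \<longlonglongrightarrow> 0"
proof -
  let ?w = "\<lambda>\<eta>. trunc_shift (Cyl J j) (\<eta>(j := 0))"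
  let ?ww = "\<lambda>\<eta>. ?w \<eta> o\<^sub>L trunc_shift (Cyl J j) (- \<eta>(j := 0))"
  let ?R = "\<lambda>A. \<Sum>\<^sub>\<infinity>\<eta>\<in>ZZ J. scalar (\<rho> \<eta>) o\<^sub>L A \<eta>"
  let ?S = "\<lambda>A. \<Sum>\<^sub>\<infinity>\<eta>\<in>ZZ J. scalar (\<sigma> \<eta>) o\<^sub>L A \<eta>"
  let ?d = "\<lambda>n \<eta>. amp j (freq (\<theta> n) (\<eta> j)) o\<^sub>L ?w \<eta>"
  let ?e = "\<lambda>k n. shift_defect k (s n) (\<theta> n)"
  let ?f = "\<lambda>k n. (hshift k o\<^sub>L hshift (- k) o\<^sub>L s n) - s n"
  note cl = complex_linear_compose complex_linear_trunc_shift lin complex_linear_freq complex_linear_diff complex_linear_amp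
  define A where "A n \<eta> = ?w \<eta> o\<^sub>L amp j (?e (\<eta> j) n)" for n \<eta>
  define B where "B n \<eta> = ?ww \<eta> o\<^sub>L amp j (?f (\<eta> j) n)" for n \<eta>
  have A: "(trunc_shift (NN J) \<eta> o\<^sub>L amp j (s n)) - (amp j (s n) o\<^sub>L (?d n \<eta>)) = A n \<eta>" for n \<eta>
  proof -
    have "amp j (s n) o\<^sub>L (?d n \<eta>) = amp j (s n o\<^sub>L freq (\<theta> n) (\<eta> j)) o\<^sub>L ?w \<eta>"
      by (simp add: amp_compose cl blinfun_compose_assoc')
    also have "\<dots> = ?w \<eta> o\<^sub>L amp j (s n o\<^sub>L freq (\<theta> n) (\<eta> j))"
      by (simp add: cl amp_Cyl_commute)
    finally have "amp j (s n) o\<^sub>L (?d n \<eta>) = \<dots>" .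
    then show ?thesis
      by (simp add: A_def amp_diff cl blinfun_diff_right trunc_shift_NN_factor[OF j, of \<eta>] amp_compose blinfun_compose_assoc')
  qed
  have B: "(trunc_shift (NN J) \<eta> o\<^sub>L trunc_shift (NN J) (- \<eta>) o\<^sub>L amp j (s n)) - (amp j (s n) o\<^sub>L ?ww \<eta>) = B n \<eta>" for n \<eta>
  proof -
    have "amp j (s n) o\<^sub>L ?ww \<eta> = ?ww \<eta> o\<^sub>L amp j (s n)"
      by (simp add: blinfun_compose_assoc'[symmetric] cl amp_Cyl_commute)
         (simp add: blinfun_compose_assoc' cl amp_Cyl_commute)
    then show ?thesis
      unfolding trunc_shift_V_factor
      by (simp add: B_def amp_diff cl blinfun_diff_right amp_compose blinfun_compose_assoc')
  qed
  have eq: "(TV J \<rho> \<sigma> o\<^sub>L amp j (s n)) - (amp j (s n) o\<^sub>L face_symbol J j (\<theta> n) \<rho> \<sigma>)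
      = ?R (A n) + ?S (B n)" for n
  proof -
    have bd: "norm (?d n \<eta>) \<le> 1 * 1" for \<eta>
      by (intro norm_compose_le norm_amp_freq norm_trunc_shift_le)
    have na: "norm (amp j (s n)) \<le> M" using norm_amp[OF lin(1)] bounded(1) by (rule order_trans)
    note b1 = norm_compose_le[OF norm_trunc_shift_le na] norm_compose_le[OF na bd]
    note b2 = norm_compose_le[OF norm_trunc_shift2_le na] norm_compose_le[OF na norm_trunc_shift2_le]
    have "(toeplitz_T J \<rho> o\<^sub>L amp j (s n)) -
        (amp j (s n) o\<^sub>L (?R (?d n)))
       = ?R (A n)"
      unfolding toeplitz_T_def infsum_scalar_compose_right[OF \<rho> norm_trunc_shift_le]
        infsum_scalar_compose_left[where A = "?d n", OF \<rho> bd complex_linear_amp[OF lin(1)]]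
      by (subst infsum_scalar_diff[where A = "\<lambda>\<eta>. trunc_shift (NN J) \<eta> o\<^sub>L amp j (s n)"
           and B = "\<lambda>\<eta>. amp j (s n) o\<^sub>L (?d n \<eta>)", OF \<rho> b1]) (simp only: A)
    moreover have "(toeplitz_V J \<sigma> o\<^sub>L amp j (s n)) -
        (amp j (s n) o\<^sub>L (?S ?ww))
       = ?S (B n)"
      unfolding toeplitz_V_alt infsum_scalar_compose_right[OF \<sigma> norm_trunc_shift2_le]
        infsum_scalar_compose_left[OF \<sigma> norm_trunc_shift2_le complex_linear_amp[OF lin(1)]]
      by (subst infsum_scalar_diff[OF \<sigma> b2]) (simp add: B)
    ultimately show ?thesis
      by (simp add: face_symbol_def blinfun_compose_bilinear algebra_simps)
  qed
  have "norm (?e k n) \<le> 1 * M + M * 1" "norm (?f k n) \<le> 1 * M + M" for k n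
    by (intro norm_diff_le norm_compose_le norm_trunc_shift_le norm_trunc_shift2_le norm_freq bounded)+
  then have bound: "norm (?e k n) \<le> 2 * M" "norm (?f k n) \<le> 2 * M" for k n by simp_all
  show ?thesis
    unfolding eq A_def B_def
    by (rule symbol_error_tendsto_0[OF _ _ bound shift_right V_right]) (intro cl)+
qed

lemma symbol_left:
  "(\<lambda>n. norm ((amp j (t n) o\<^sub>L TV J \<rho> \<sigma>) - (face_symbol J j (\<theta> n) \<rho> \<sigma> o\<^sub>L amp j (t n)))) \<longlonglongrightarrow> 0"
proof -
  let ?w = "\<lambda>\<eta>. trunc_shift (Cyl J j) (\<eta>(j := 0))"
  let ?ww = "\<lambda>\<eta>. ?w \<eta> o\<^sub>L trunc_shift (Cyl J j) (- \<eta>(j := 0))"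
  let ?R = "\<lambda>A. \<Sum>\<^sub>\<infinity>\<eta>\<in>ZZ J. scalar (\<rho> \<eta>) o\<^sub>L A \<eta>"
  let ?S = "\<lambda>A. \<Sum>\<^sub>\<infinity>\<eta>\<in>ZZ J. scalar (\<sigma> \<eta>) o\<^sub>L A \<eta>"
  let ?d = "\<lambda>n \<eta>. amp j (freq (\<theta> n) (\<eta> j)) o\<^sub>L ?w \<eta>"
  let ?e = "\<lambda>k n. (t n o\<^sub>L hshift k) - (freq (\<theta> n) k o\<^sub>L t n)"
  let ?f = "\<lambda>k n. (t n o\<^sub>L (hshift k o\<^sub>L hshift (- k))) - t n"
  note cl = complex_linear_compose complex_linear_trunc_shift lin complex_linear_freq complex_linear_diff complex_linear_amp
  define A where "A n \<eta> = ?w \<eta> o\<^sub>L amp j (?e (\<eta> j) n)" for n \<eta>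
  define B where "B n \<eta> = ?ww \<eta> o\<^sub>L amp j (?f (\<eta> j) n)" for n \<eta>
  have A: "(amp j (t n) o\<^sub>L trunc_shift (NN J) \<eta>) - ((?d n \<eta>) o\<^sub>L amp j (t n)) = A n \<eta>" for n \<eta>
  proof -
    have "(?d n \<eta>) o\<^sub>L amp j (t n) = ?w \<eta> o\<^sub>L amp j (freq (\<theta> n) (\<eta> j) o\<^sub>L t n)"
      by (simp add: amp_compose cl amp_Cyl_commute blinfun_compose_assoc')
    moreover have "amp j (t n) o\<^sub>L trunc_shift (NN J) \<eta> = ?w \<eta> o\<^sub>L amp j (t n o\<^sub>L hshift (\<eta> j))"
      unfolding trunc_shift_NN_factor[OF j, of \<eta>]
      by (simp add: blinfun_compose_assoc'[symmetric] cl amp_Cyl_commute)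
         (simp add: amp_compose cl blinfun_compose_assoc')
    ultimately show ?thesis
      by (simp add: A_def amp_diff cl blinfun_diff_right)
  qed
  have B: "(amp j (t n) o\<^sub>L (trunc_shift (NN J) \<eta> o\<^sub>L trunc_shift (NN J) (- \<eta>))) - (?ww \<eta> o\<^sub>L amp j (t n)) = B n \<eta>" for n \<eta>
  proof -
    have "amp j (t n) o\<^sub>L ?ww \<eta> = ?ww \<eta> o\<^sub>L amp j (t n)"
      by (simp add: blinfun_compose_assoc'[symmetric] cl amp_Cyl_commute)
         (simp add: blinfun_compose_assoc' cl amp_Cyl_commute)
    note ww = this
    have "amp j (t n) o\<^sub>L (trunc_shift (NN J) \<eta> o\<^sub>L trunc_shift (NN J) (- \<eta>))
        = (amp j (t n) o\<^sub>L ?ww \<eta>) o\<^sub>L amp j (hshift (\<eta> j) o\<^sub>L hshift (- \<eta> j))"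
      by (simp only: trunc_shift_V_factor blinfun_compose_assoc')
    also have "\<dots> = ?ww \<eta> o\<^sub>L (amp j (t n) o\<^sub>L amp j (hshift (\<eta> j) o\<^sub>L hshift (- \<eta> j)))"
      by (simp only: ww) (simp only: blinfun_compose_assoc')
    finally show ?thesis
      by (simp add: B_def amp_diff cl blinfun_diff_right amp_compose)
  qed
  have eq: "(amp j (t n) o\<^sub>L TV J \<rho> \<sigma>) - (face_symbol J j (\<theta> n) \<rho> \<sigma> o\<^sub>L amp j (t n))
      = ?R (A n) + ?S (B n)" for n
  proof -
    have bd: "norm (?d n \<eta>) \<le> 1 * 1" for \<eta>
      by (intro norm_compose_le norm_amp_freq norm_trunc_shift_le)
    have na: "norm (amp j (t n)) \<le> M" using norm_amp[OF lin(2)] bounded(2) by (rule order_trans)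
    note b1 = norm_compose_le[OF na norm_trunc_shift_le] norm_compose_le[OF bd na]
    note b2 = norm_compose_le[OF na norm_trunc_shift2_le] norm_compose_le[OF norm_trunc_shift2_le na]
    have "(amp j (t n) o\<^sub>L toeplitz_T J \<rho>) -
        ((?R (?d n)) o\<^sub>L amp j (t n))
       = ?R (A n)"
      unfolding toeplitz_T_def infsum_scalar_compose_right[where A = "?d n", OF \<rho> bd]
        infsum_scalar_compose_left[OF \<rho> norm_trunc_shift_le complex_linear_amp[OF lin(2)]]
      by (subst infsum_scalar_diff[where A = "\<lambda>\<eta>. amp j (t n) o\<^sub>L trunc_shift (NN J) \<eta>"
           and B = "\<lambda>\<eta>. (?d n \<eta>) o\<^sub>L amp j (t n)", OF \<rho> b1]) (simp only: A)
    moreover have "(amp j (t n) o\<^sub>L toeplitz_V J \<sigma>) -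
        ((?S ?ww) o\<^sub>L amp j (t n))
       = ?S (B n)"
      unfolding toeplitz_V_alt infsum_scalar_compose_right[OF \<sigma> norm_trunc_shift2_le]
        infsum_scalar_compose_left[OF \<sigma> norm_trunc_shift2_le complex_linear_amp[OF lin(2)]]
      by (subst infsum_scalar_diff[OF \<sigma> b2]) (simp add: B)
    ultimately show ?thesis
      by (simp add: face_symbol_def blinfun_compose_bilinear algebra_simps)
  qed
  have "norm (?e k n) \<le> M * 1 + 1 * M" "norm (?f k n) \<le> M * 1 + M" for k n
    by (intro norm_diff_le norm_compose_le norm_trunc_shift_le norm_trunc_shift2_le norm_freq bounded)+
  then have bound: "norm (?e k n) \<le> 2 * M" "norm (?f k n) \<le> 2 * M" for k n by simp_all
  show ?thesis
    unfolding eq A_def B_def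
    by (rule symbol_error_tendsto_0[OF _ _ bound shift_left V_left]) (intro cl)+
qed

end

end

section \<open>Discrete Fourier transform\<close>

lemma chi_eq_1_iff: "chi t = 1 \<longleftrightarrow> (\<exists>k::int. t = of_int k)"
proof
  assume "chi t = 1"
  then have "cos (2 * pi * t) = 1" by (simp add: chi_def complex_eq_iff)
  then obtain k :: int where "2 * pi * t = of_int k * 2 * pi" by (auto simp: cos_one_2pi_int)
  then show "\<exists>k::int. t = of_int k" by (intro exI[of _ k]) simp
next
  assume "\<exists>k::int. t = of_int k"
  then obtain k :: int where "t = of_int k" by blast
  then show "chi t = 1" using cis_multiple_2pi[of "of_int k"] by (simp add: chi_def)
qed

lemma chi_of_nat_mult: "chi (of_nat i * t) = chi t ^ i"
  by (simp add: chi_def Complex.DeMoivre algebra_simps)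

lemma sum_chi:
  fixes d :: int
  assumes "\<bar>d\<bar> < int n"
  shows "(\<Sum>i<n. chi (of_nat i * (of_int d / of_nat n))) = (if d = 0 then of_nat n else 0)"
proof (cases "d = 0")
  case False
  let ?w = "chi (of_int d / of_nat n)"
  have n: "0 < n" using assms by auto
  have "?w \<noteq> 1"
  proof
    assume "?w = 1"
    then obtain k :: int where "of_int d / of_nat n = (of_int k :: real)" unfolding chi_eq_1_iff by blast
    then have "of_int d = (of_int (k * int n) :: real)" using n by (simp add: field_simps)
    then have "d = k * int n" by (simp only: of_int_eq_iff)
    then show False using assms False n by (auto simp: abs_mult)
  qed
  moreover have "?w ^ n = 1"
    unfolding chi_of_nat_mult[symmetric] chi_eq_1_iff using n by (intro exI[of _ d]) simp
  ultimately have "(\<Sum>i<n. ?w ^ i) = 0" by (simp add: geometric_sum)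
  then show ?thesis using False by (simp only: chi_of_nat_mult if_False)
qed simp

lemma sum_int_interval:
  fixes F :: "int \<Rightarrow> 'b::comm_monoid_add"
  shows "(\<Sum>m\<in>{x..<x + int n}. F m) = (\<Sum>i<n. F (x + int i))"
proof (rule sum.reindex_bij_witness[of _ "\<lambda>i. x + int i" "\<lambda>m. nat (m - x)"])
qed auto

text \<open>
  The characters of order \<open>n\<close> are orthogonal on every interval of length \<open>n\<close>, so the position \<open>x\<close> of the
  interval does not affect the sum.
\<close>

lemma dft_parseval:
  "(\<Sum>m\<in>{x..<x + int n}. (cmod (\<Sum>l<n. chi (of_int m * (of_nat l / of_nat n)) * h l))\<^sup>2)
    = of_nat n * (\<Sum>l<n. (cmod (h l))\<^sup>2)"
proof (cases "n = 0")
  case False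
  let ?c = "\<lambda>m l. chi (of_int m * (of_nat l / of_nat n))"
  have orth: "(\<Sum>m\<in>{x..<x + int n}. ?c m l * cnj (?c m l')) = (if l = l' then of_nat n else 0)"
    if "l < n" "l' < n" for l l'
  proof -
    let ?d = "int l - int l'"
    have "?c (x + int i) l * cnj (?c (x + int i) l') =
        chi (of_int x * (of_int ?d / of_nat n)) * chi (of_nat i * (of_int ?d / of_nat n))" for i
      unfolding cnj_chi chi_add[symmetric]
      by (rule arg_cong[where f = chi]) (use False in \<open>simp add: field_simps\<close>)
    then have "(\<Sum>m\<in>{x..<x + int n}. ?c m l * cnj (?c m l')) =
        chi (of_int x * (of_int ?d / of_nat n)) * (\<Sum>i<n. chi (of_nat i * (of_int ?d / of_nat n)))"
      unfolding sum_int_interval sum_distrib_left by (intro sum.cong refl) blast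
    also have "(\<Sum>i<n. chi (of_nat i * (of_int ?d / of_nat n))) = (if ?d = 0 then of_nat n else 0)"
      by (rule sum_chi) (use that in auto)
    finally show ?thesis by simp
  qed
  have "of_real (\<Sum>m\<in>{x..<x + int n}. (cmod (\<Sum>l<n. ?c m l * h l))\<^sup>2)
     = (\<Sum>m\<in>{x..<x + int n}. (\<Sum>l<n. ?c m l * h l) * cnj (\<Sum>l<n. ?c m l * h l))"
    by (simp add: complex_norm_square del: of_real_power cnj_sum)
  also have "\<dots> = (\<Sum>m\<in>{x..<x + int n}. \<Sum>l<n. \<Sum>l'<n. (?c m l * cnj (?c m l')) * (h l * cnj (h l')))"
    by (simp add: sum_product mult_ac)
  also have "\<dots> = (\<Sum>l<n. \<Sum>l'<n. \<Sum>m\<in>{x..<x + int n}. (?c m l * cnj (?c m l')) * (h l * cnj (h l')))"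
    by (subst sum.swap, rule sum.cong[OF refl], rule sum.swap)
  also have "\<dots> = (\<Sum>l<n. \<Sum>l'<n. (if l = l' then of_nat n else 0) * (h l * cnj (h l')))"
    by (intro sum.cong refl, subst sum_distrib_right[symmetric], subst orth) auto
  also have "\<dots> = (\<Sum>l<n. of_nat n * (h l * cnj (h l)))"
    by (intro sum.cong refl) (simp add: if_distrib[of "\<lambda>z. z * _"] cong: if_cong)
  also have "\<dots> = of_real (of_nat n * (\<Sum>l<n. (cmod (h l))\<^sup>2))"
    by (simp add: complex_norm_square sum_distrib_left del: of_real_power)
  finally show ?thesis by (simp only: of_real_eq_iff)
qed simp

section \<open>Gabor packets\<close>

abbreviation window_sum :: "nat \<Rightarrow> int ell2 \<Rightarrow> int \<Rightarrow> int \<Rightarrow> complex"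
  where "window_sum n h a m \<equiv> \<Sum>l<n. chi (of_int m * (of_nat l / of_nat n)) * coord h (a * int n + int l)"

text \<open>
  The index \<open>a * n + l\<close> with \<open>l < n\<close> stands for the window \<open>a\<close> and the frequency \<open>l / n\<close>. The basis vector
  with this index is mapped to the plane wave of that frequency, multiplied with the profile \<open>c _ a\<close> and
  with \<open>1 / n\<close>. Coding the pair as an integer keeps all operators on the same space \<open>\<ell>\<^sup>2(\<int>)\<close>.
\<close>

definition packet_op :: "nat \<Rightarrow> (int \<Rightarrow> int \<Rightarrow> real) \<Rightarrow> int op"
  where "packet_op n c = ell2_op (\<lambda>h m. (\<Sum>a | c m a \<noteq> 0. of_real (c m a) *
      window_sum n h a m) / of_nat n)"

text \<open>
  If at most \<open>p\<close> profiles overlap at a point, the Cauchy-Schwarz inequality costs a factor \<open>p\<close>, and two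
  applications of \<open>dft_parseval\<close> to the support of a profile contribute \<open>2 n\<close>; with the normalisation
  \<open>1 / n\<^sup>2\<close> of the squared norm this gives \<open>2 p / n\<close>. It is bounded when \<open>p = n\<close> and tends to 0 when
  \<open>p\<close> stays fixed; the latter is the case for the difference of a window and its translate.
\<close>

lemma
  fixes n p :: nat
  assumes n: "1 \<le> n"
    and c: "\<And>m a. \<bar>c m a\<bar> \<le> 1"
    and col: "\<And>m. finite {a. c m a \<noteq> 0}" "\<And>m. card {a. c m a \<noteq> 0} \<le> p"
    and row: "\<And>a. \<exists>x. {m. c m a \<noteq> 0} \<subseteq> {x..<x + 2 * int n}"
  shows coord_packet_op: "finite A \<Longrightarrow> {a. c m a \<noteq> 0} \<subseteq> A \<Longrightarrow>
      coord (packet_op n c h) m = (\<Sum>a\<in>A. of_real (c m a) *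
        window_sum n h a m) / of_nat n"
    and norm_packet_op: "norm (packet_op n c) \<le> sqrt (2 * of_nat p / of_nat n)"
    and complex_linear_packet_op: "complex_linear (packet_op n c)"
proof -
  let ?g = "window_sum n"
  let ?S = "\<lambda>m. {a. c m a \<noteq> 0}"
  let ?F = "\<lambda>h m. (\<Sum>a\<in>?S m. of_real (c m a) * ?g h a m) / of_nat n"
  have props: "?F (f + g) m = ?F f m + ?F g m" "?F (scaleC z f) m = z * ?F f m" for f g m z
  proof -
    have "?g (f + g) a m = ?g f a m + ?g g a m" for a
      by (simp add: coord_simps distrib_left sum.distrib)
    then show "?F (f + g) m = ?F f m + ?F g m"
      by (simp add: distrib_left sum.distrib add_divide_distrib)
    have "?g (scaleC z f) a m = z * ?g f a m" for a
      by (simp add: coord_simps sum_distrib_left mult_ac)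
    then show "?F (scaleC z f) m = z * ?F f m"
      by (simp add: sum_distrib_left mult_ac)
  qed
  have bound: "(\<Sum>m\<in>X. (cmod (?F h m))\<^sup>2) \<le> (sqrt (2 * of_nat p / of_nat n) * norm h)\<^sup>2"
    if X: "finite X" for h X
  proof -
    let ?A = "\<Union>m\<in>X. ?S m"
    have A: "finite ?A" using X col by blast
    have "(\<Sum>m\<in>X. (cmod (?F h m))\<^sup>2) \<le> (\<Sum>m\<in>X. of_nat p / (of_nat n)\<^sup>2 * (\<Sum>a\<in>?S m. (cmod (?g h a m))\<^sup>2))"
    proof (rule sum_mono)
      fix m
      have "cmod (\<Sum>a\<in>?S m. of_real (c m a) * ?g h a m) \<le> (\<Sum>a\<in>?S m. cmod (?g h a m))"
        using c by (intro sum_norm_le) (auto simp: norm_mult intro!: mult_left_le_one_le)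
      then have "(cmod (\<Sum>a\<in>?S m. of_real (c m a) * ?g h a m))\<^sup>2 \<le> (\<Sum>a\<in>?S m. cmod (?g h a m))\<^sup>2"
        by (intro power_mono) auto
      also have "\<dots> \<le> (\<Sum>a\<in>?S m. (cmod (?g h a m))\<^sup>2) * of_nat (card (?S m))"
        by (rule sum_squared_le_sum_of_squares)
      also have "\<dots> \<le> (\<Sum>a\<in>?S m. (cmod (?g h a m))\<^sup>2) * of_nat p"
        using col(2) by (intro mult_left_mono sum_nonneg) auto
      finally show "(cmod (?F h m))\<^sup>2 \<le> of_nat p / (of_nat n)\<^sup>2 * (\<Sum>a\<in>?S m. (cmod (?g h a m))\<^sup>2)"
        using n by (simp add: norm_divide power_divide field_simps)
    qed
    also have "\<dots> = of_nat p / (of_nat n)\<^sup>2 * (\<Sum>m\<in>X. \<Sum>a\<in>?S m. (cmod (?g h a m))\<^sup>2)"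
      by (simp add: sum_distrib_left)
    finally have outer: "(\<Sum>m\<in>X. (cmod (?F h m))\<^sup>2)
      \<le> of_nat p / (of_nat n)\<^sup>2 * (\<Sum>m\<in>X. \<Sum>a\<in>?S m. (cmod (?g h a m))\<^sup>2)" .
    have "(\<Sum>m\<in>X. \<Sum>a\<in>?S m. (cmod (?g h a m))\<^sup>2) = (\<Sum>m\<in>X. \<Sum>a | a \<in> ?A \<and> c m a \<noteq> 0. (cmod (?g h a m))\<^sup>2)"
      by (intro sum.cong refl) auto
    also have "\<dots> = (\<Sum>a\<in>?A. \<Sum>m | m \<in> X \<and> c m a \<noteq> 0. (cmod (?g h a m))\<^sup>2)"
      by (rule sum.swap_restrict[OF X A])
    also have "\<dots> \<le> (\<Sum>a\<in>?A. 2 * of_nat n * (\<Sum>l<n. (cmod (coord h (a * int n + int l)))\<^sup>2))"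
    proof (rule sum_mono)
      fix a
      obtain x where x: "{m. c m a \<noteq> 0} \<subseteq> {x..<x + 2 * int n}" using row by blast
      have "(\<Sum>m | m \<in> X \<and> c m a \<noteq> 0. (cmod (?g h a m))\<^sup>2) \<le> (\<Sum>m\<in>{x..<x + 2 * int n}. (cmod (?g h a m))\<^sup>2)"
        using x by (intro sum_mono2) auto
      also have "{x..<x + 2 * int n} = {x..<x + int n} \<union> {x + int n..<(x + int n) + int n}" by auto
      also have "(\<Sum>m\<in>\<dots>. (cmod (?g h a m))\<^sup>2) = (\<Sum>m\<in>{x..<x + int n}. (cmod (?g h a m))\<^sup>2)
          + (\<Sum>m\<in>{x + int n..<(x + int n) + int n}. (cmod (?g h a m))\<^sup>2)"
        by (rule sum.union_disjoint) auto
      also have "\<dots> = 2 * of_nat n * (\<Sum>l<n. (cmod (coord h (a * int n + int l)))\<^sup>2)"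
        unfolding dft_parseval by simp
      finally show "(\<Sum>m | m \<in> X \<and> c m a \<noteq> 0. (cmod (?g h a m))\<^sup>2)
          \<le> 2 * of_nat n * (\<Sum>l<n. (cmod (coord h (a * int n + int l)))\<^sup>2)" .
    qed
    also have "\<dots> = 2 * of_nat n * (\<Sum>(a, l)\<in>?A \<times> {..<n}. (cmod (coord h (a * int n + int l)))\<^sup>2)"
      by (simp add: sum_distrib_left sum.cartesian_product case_prod_unfold)
    also have "(\<Sum>(a, l)\<in>?A \<times> {..<n}. (cmod (coord h (a * int n + int l)))\<^sup>2)
        = (\<Sum>b\<in>(\<lambda>(a, l). a * int n + int l) ` (?A \<times> {..<n}). (cmod (coord h b))\<^sup>2)"
    proof -
      have "inj_on (\<lambda>(a, l). a * int n + int l) (?A \<times> {..<n})"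
        by (rule inj_on_inverseI[where g = "\<lambda>b. (b div int n, nat (b mod int n))"]) (use n in auto)
      then show ?thesis by (simp add: sum.reindex case_prod_unfold)
    qed
    also have "2 * of_nat n * \<dots> \<le> 2 * of_nat n * (norm h)\<^sup>2"
      using A by (intro mult_left_mono sum_coord_le) auto
    finally have inner: "(\<Sum>m\<in>X. \<Sum>a\<in>?S m. (cmod (?g h a m))\<^sup>2) \<le> 2 * of_nat n * (norm h)\<^sup>2" .
    have "(\<Sum>m\<in>X. (cmod (?F h m))\<^sup>2) \<le> of_nat p / (of_nat n)\<^sup>2 * (2 * of_nat n * (norm h)\<^sup>2)"
      by (rule order_trans[OF outer mult_left_mono[OF inner]]) simp
    also have "\<dots> = (sqrt (2 * of_nat p / of_nat n) * norm h)\<^sup>2"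
      using n by (simp add: power_mult_distrib power2_eq_square field_simps)
    finally show ?thesis .
  qed
  note * = props bound
  show "coord (packet_op n c h) m = (\<Sum>a\<in>A. of_real (c m a) * ?g h a m) / of_nat n"
    if "finite A" "{a. c m a \<noteq> 0} \<subseteq> A"
  proof -
    have "coord (packet_op n c h) m = ?F h m"
      unfolding packet_op_def by (rule coord_ell2_op[OF *]) auto
    also have "(\<Sum>a\<in>?S m. of_real (c m a) * ?g h a m) = (\<Sum>a\<in>A. of_real (c m a) * ?g h a m)"
      using that by (intro sum.mono_neutral_left) auto
    finally show ?thesis .
  qed
  show "norm (packet_op n c) \<le> sqrt (2 * of_nat p / of_nat n)"
    unfolding packet_op_def by (rule norm_ell2_op[OF *]) auto
  show "complex_linear (packet_op n c)"
    unfolding packet_op_def complex_linear_def by (intro allI, rule scaleC_ell2_op[OF *]) auto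
qed

lemma hilbert_adjoint_freq: "hilbert_adjoint (freq \<theta> (- k)) = freq \<theta> k"
  unfolding freq_def by (subst hilbert_adjoint_mulop[where K = 1]) (auto simp: cnj_chi)

lemma wave_packets_adjoint:
  assumes lin: "\<And>n. complex_linear (s n)" and bd: "\<And>n. norm (s n) \<le> M"
    and lim: "\<And>k. (\<lambda>n. norm (shift_defect k (s n) (\<theta> n))) \<longlonglongrightarrow> 0"
  shows "wave_packets s (\<lambda>n. hilbert_adjoint (s n)) \<theta> M"
proof
  fix k
  show "(\<lambda>n. norm ((hilbert_adjoint (s n) o\<^sub>L hshift k) - (freq (\<theta> n) k o\<^sub>L hilbert_adjoint (s n)))) \<longlonglongrightarrow> 0"
  proof (rule norm_tendsto_0_le[OF lim[of "- k"]])
    note cl = complex_linear_compose complex_linear_trunc_shift complex_linear_freq lin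
    have "(hilbert_adjoint (s n) o\<^sub>L hshift k) - (freq (\<theta> n) k o\<^sub>L hilbert_adjoint (s n))
        = hilbert_adjoint (shift_defect (- k) (s n) (\<theta> n))" for n
      by (simp add: hilbert_adjoint_diff hilbert_adjoint_compose cl hilbert_adjoint_trunc_shift hilbert_adjoint_freq)
    then show "norm ((hilbert_adjoint (s n) o\<^sub>L hshift k) - (freq (\<theta> n) k o\<^sub>L hilbert_adjoint (s n)))
        \<le> norm (shift_defect (- k) (s n) (\<theta> n))" for n
      by (simp add: norm_hilbert_adjoint_le complex_linear_diff cl)
  qed
qed (use assms norm_hilbert_adjoint_le order_trans complex_linear_hilbert_adjoint in blast)+

definition window :: "nat \<Rightarrow> int \<Rightarrow> int \<Rightarrow> real"
  where "window n m a = (if int n \<le> a \<and> a \<le> m \<and> m < a + int n then 1 else 0)"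

text \<open>
  Windows start at \<open>a \<ge> n\<close>, so that they do not meet the end of the half-line even after a shift by less
  than \<open>n\<close>. The length of the windows is \<open>Suc n\<close> and hence never 0.
\<close>

definition gabor :: "nat \<Rightarrow> int op" where "gabor n = packet_op (Suc n) (window (Suc n))"

definition gabor_freq :: "nat \<Rightarrow> int \<Rightarrow> real"
  where "gabor_freq n b = of_int (b mod int (Suc n)) / of_nat (Suc n)"

lemma window_supp: "{a. window n m a \<noteq> 0} = {max (int n) (m - int n + 1)..m}"
  by (auto simp: window_def)

lemma card_window_supp: "card {a. window n m a \<noteq> 0} \<le> n"
  unfolding window_supp by simp

lemma window_row: "\<exists>x. {m. window n m a \<noteq> 0} \<subseteq> {x..<x + 2 * int n}"
  by (rule exI[of _ a]) (auto simp: window_def)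

lemma
  shows coord_gabor: "finite A \<Longrightarrow> {a. window (Suc n) m a \<noteq> 0} \<subseteq> A \<Longrightarrow>
      coord (gabor n h) m = (\<Sum>a\<in>A. of_real (window (Suc n) m a) *
        window_sum (Suc n) h a m) / of_nat (Suc n)"
    and norm_gabor: "norm (gabor n) \<le> sqrt 2"
    and complex_linear_gabor: "complex_linear (gabor n)"
proof -
  have c: "\<bar>window (Suc n) m a\<bar> \<le> 1" "finite {a. window (Suc n) m a \<noteq> 0}" for m a
    by (simp add: window_def) (simp add: window_supp)
  note * = _ c card_window_supp window_row
  show "finite A \<Longrightarrow> {a. window (Suc n) m a \<noteq> 0} \<subseteq> A \<Longrightarrow>
      coord (gabor n h) m = (\<Sum>a\<in>A. of_real (window (Suc n) m a) *
        window_sum (Suc n) h a m) / of_nat (Suc n)"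
    unfolding gabor_def by (rule coord_packet_op[OF *]) auto
  have "norm (gabor n) \<le> sqrt (2 * of_nat (Suc n) / of_nat (Suc n))"
    unfolding gabor_def by (rule norm_packet_op[OF *]) auto
  then show "norm (gabor n) \<le> sqrt 2" by (simp del: of_nat_Suc)
  show "complex_linear (gabor n)"
    unfolding gabor_def by (rule complex_linear_packet_op[OF *]) auto
qed

lemma card_near_le:
  fixes x y :: int
  assumes "A \<subseteq> {x - \<bar>k\<bar>..x + \<bar>k\<bar>} \<union> {y - \<bar>k\<bar>..y + \<bar>k\<bar>}"
  shows "card A \<le> nat (2 * (2 * \<bar>k\<bar> + 1))"
proof -
  have "card A \<le> card ({x - \<bar>k\<bar>..x + \<bar>k\<bar>} \<union> {y - \<bar>k\<bar>..y + \<bar>k\<bar>})"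
    by (rule card_mono[OF _ assms]) simp
  also have "\<dots> \<le> card {x - \<bar>k\<bar>..x + \<bar>k\<bar>} + card {y - \<bar>k\<bar>..y + \<bar>k\<bar>}" by (rule card_Un_le)
  also have "\<dots> = nat (2 * (2 * \<bar>k\<bar> + 1))" by simp
  finally show ?thesis .
qed

lemma sqrt_const_div_tendsto: "(\<lambda>n. sqrt (C / of_nat (Suc n))) \<longlonglongrightarrow> 0"
proof -
  have "(\<lambda>n. C / of_nat (Suc n)) \<longlonglongrightarrow> 0"
    using LIMSEQ_Suc[OF lim_const_over_n[of C]] by simp
  from tendsto_real_sqrt[OF this] show ?thesis by simp
qed

text \<open>
  Shifting a packet by \<open>k\<close> multiplies it with a character and translates its window by \<open>k\<close>. At each
  point the windows affected by the translation are those with an end at distance at most \<open>\<bar>k\<bar>\<close>, and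
  their number does not grow with \<open>n\<close>.
\<close>

lemma gabor_shift:
  "(\<lambda>n. norm (shift_defect k (gabor n) (gabor_freq n))) \<longlonglongrightarrow> 0"
proof (rule tendsto_norm_zero[OF Lim_null_comparison[OF eventually_sequentiallyI sqrt_const_div_tendsto]])
  let ?p = "nat (2 * (2 * \<bar>k\<bar> + 1))"
  show "norm (shift_defect k (gabor n) (gabor_freq n)) \<le> sqrt (2 * of_nat ?p / of_nat (Suc n))"
    if n: "nat \<bar>k\<bar> \<le> n" for n
  proof -
    define N where "N = Suc n"
    define c where "c m a = window N (m - k) a - window N m a" for m a
    have kN: "\<bar>k\<bar> < int N" using n by (simp add: N_def)
    have c1: "\<bar>c m a\<bar> \<le> 1" for m a by (simp add: c_def window_def)
    have c2: "{a. c m a \<noteq> 0} \<subseteq> {m - \<bar>k\<bar>..m + \<bar>k\<bar>} \<union> {(m - int N) - \<bar>k\<bar>..(m - int N) + \<bar>k\<bar>}" for m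
      by (auto simp: c_def window_def split: if_splits)
    have c3: "finite {a. c m a \<noteq> 0}" for m by (rule finite_subset[OF c2]) simp
    have c4: "card {a. c m a \<noteq> 0} \<le> ?p" for m by (rule card_near_le[OF c2])
    have c5: "\<exists>x. {m. c m a \<noteq> 0} \<subseteq> {x..<x + 2 * int N}" for a
      by (rule exI[of _ "min a (a + k)"]) (use kN in \<open>auto simp: c_def window_def split: if_splits\<close>)
    note * = _ c1 c3 c4 c5
    have "shift_defect k (gabor n) (gabor_freq n) = packet_op N c o\<^sub>L freq (gabor_freq n) k"
    proof (rule op_eqI)
      fix h m
      let ?A = "{a. window N (m - k) a \<noteq> 0} \<union> {a. window N m a \<noteq> 0} \<union> {a. c m a \<noteq> 0}"
      let ?h = "freq (gabor_freq n) k h"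
      have A: "finite ?A" using c3 by (simp add: window_supp)
      have "coord ((hshift k o\<^sub>L gabor n) h) m = coord (gabor n h) (m - k)"
      proof (cases "1 \<le> m \<and> 1 \<le> m - k")
        case False
        then have "{a. window N (m - k) a \<noteq> 0} = {}" using kN by (auto simp: window_def N_def)
        then show ?thesis using False coord_gabor[of "{}" n "m - k" h] by (auto simp: coord_trunc_shift N_def)
      qed (simp add: coord_trunc_shift)
      also have "\<dots> = (\<Sum>a\<in>?A. of_real (window N (m - k) a) *
          (\<Sum>l<N. chi (of_int (m - k) * (of_nat l / of_nat N)) * coord h (a * int N + int l))) / of_nat N"
        unfolding N_def by (rule coord_gabor) (use A in \<open>auto simp: N_def\<close>)
      also have "(\<lambda>a. (\<Sum>l<N. chi (of_int (m - k) * (of_nat l / of_nat N)) * coord h (a * int N + int l)))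
          = (\<lambda>a. window_sum N ?h a m)"
      proof (intro ext sum.cong refl)
        fix a :: int and l assume "l \<in> {..<N}"
        then have "gabor_freq n (a * int N + int l) = of_nat l / of_nat N"
          by (simp add: gabor_freq_def N_def[symmetric])
        moreover have "of_int (m - k) * (of_nat l / of_nat N) = of_int m * (of_nat l / of_nat N) + - (of_int k * (of_nat l / of_nat N) :: real)"
          by (simp add: left_diff_distrib diff_divide_distrib)
        ultimately show "chi (of_int (m - k) * (of_nat l / of_nat N)) * coord h (a * int N + int l)
            = chi (of_int m * (of_nat l / of_nat N)) * coord ?h (a * int N + int l)"
          by (simp only: coord_freq chi_add mult.assoc)
      qed
      finally have 1: "coord ((hshift k o\<^sub>L gabor n) h) m = (\<Sum>a\<in>?A. of_real (window N (m - k) a) *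
          window_sum N ?h a m) / of_nat N" .
      have 2: "coord (gabor n ?h) m = (\<Sum>a\<in>?A. of_real (window N m a) *
          window_sum N ?h a m) / of_nat N"
        unfolding N_def by (rule coord_gabor) (use A in \<open>auto simp: N_def\<close>)
      have 3: "coord (packet_op N c ?h) m = (\<Sum>a\<in>?A. of_real (c m a) *
          window_sum N ?h a m) / of_nat N"
        by (rule coord_packet_op[OF *]) (use A in \<open>auto simp: N_def\<close>)
      have "coord (shift_defect k (gabor n) (gabor_freq n) h) m =
         coord ((hshift k o\<^sub>L gabor n) h) m - coord (gabor n ?h) m"
        by (simp add: blinfun.diff_left coord_simps)
      also have "\<dots> = coord (packet_op N c ?h) m"
        unfolding 1 2 3
        by (simp add: c_def diff_divide_distrib[symmetric] sum_subtractf[symmetric] left_diff_distrib[symmetric])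
      finally show "coord (shift_defect k (gabor n) (gabor_freq n) h) m
          = coord ((packet_op N c o\<^sub>L freq (gabor_freq n) k) h) m" by simp
    qed
    moreover have "norm (packet_op N c o\<^sub>L freq (gabor_freq n) k) \<le> sqrt (2 * of_nat ?p / of_nat N) * 1"
      by (intro norm_compose_le norm_freq norm_packet_op[OF *]) (auto simp: N_def)
    ultimately show ?thesis by (simp add: N_def)
  qed
qed

lemma wave_packets_gabor: "wave_packets gabor (\<lambda>n. hilbert_adjoint (gabor n)) gabor_freq (sqrt 2)"
  by (rule wave_packets_adjoint) (rule complex_linear_gabor norm_gabor gabor_shift)+

text \<open>
  Of the \<open>Suc n\<close> intervals of length \<open>Suc n\<close> that contain \<open>m\<close>, the proportion that are windows.
\<close>

definition cutoff :: "nat \<Rightarrow> int \<Rightarrow> real"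
  where "cutoff n m = of_nat (card {a. window (Suc n) m a \<noteq> 0}) / of_nat (Suc n)"

lemma cutoff_bounds: "0 \<le> cutoff n m" "cutoff n m \<le> 1"
  using card_window_supp[of "Suc n" m] by (simp_all add: cutoff_def)

lemma cutoff_0: "m < int (Suc n) \<Longrightarrow> cutoff n m = 0"
  by (simp add: cutoff_def window_supp)

lemma cutoff_1: "2 * int (Suc n) \<le> m \<Longrightarrow> cutoff n m = 1"
proof -
  assume "2 * int (Suc n) \<le> m"
  then have "int (Suc n) \<le> m - int (Suc n) + 1" by simp
  then have "max (int (Suc n)) (m - int (Suc n) + 1) = m - int (Suc n) + 1" by (rule max_absorb2)
  then show ?thesis by (simp add: cutoff_def window_supp)
qed

text \<open>
  On each window the plane waves form an orthogonal basis, so the packets of one window add up to the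
  indicator function of the window.
\<close>

lemma gabor_frame: "gabor n o\<^sub>L hilbert_adjoint (gabor n) = mulop (\<lambda>m. of_real (cutoff n m))"
proof (rule op_eqI)
  fix f m
  define N where "N = Suc n"
  let ?W = "{a. window N m a \<noteq> 0}"
  let ?c = "\<lambda>m l. chi (of_int m * (of_nat l / of_nat N))"
  have adj: "coord (hilbert_adjoint (gabor n) f) (a * int N + int l)
      = (\<Sum>m'\<in>{a..<a + int N}. cnj (?c m' l) * coord f m') / of_nat N" if a: "a \<in> ?W" and l: "l < N" for a l
  proof -
    let ?b = "a * int N + int l"
    have k: "coord (gabor n (ket ?b)) m' = of_real (window N m' a) * ?c m' l / of_nat N" for m'
    proof -
      let ?A = "insert a {a. window N m' a \<noteq> 0}"
      have eq: "a' * int N + int l' = ?b \<longleftrightarrow> a' = a \<and> l' = l" if "l' < N" for a' l'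
      proof
        assume e: "a' * int N + int l' = ?b"
        have "a' = (a' * int N + int l') div int N" using that by simp
        also have "\<dots> = a" unfolding e using l by simp
        finally show "a' = a \<and> l' = l" using e by simp
      qed simp
      have "coord (gabor n (ket ?b)) m' =
         (\<Sum>a'\<in>?A. of_real (window N m' a') * (\<Sum>l'<N. ?c m' l' * coord (ket ?b) (a' * int N + int l'))) / of_nat N"
        unfolding N_def by (rule coord_gabor) (auto simp: window_supp)
      also have "(\<Sum>a'\<in>?A. of_real (window N m' a') * (\<Sum>l'<N. ?c m' l' * coord (ket ?b) (a' * int N + int l')))
          = (\<Sum>a'\<in>?A. if a' = a then of_real (window N m' a) * ?c m' l else 0)"
      proof (rule sum.cong[OF refl])
        fix a'
        have "(\<Sum>l'<N. ?c m' l' * coord (ket ?b) (a' * int N + int l')) = (\<Sum>l'<N. if l' = l then (if a' = a then ?c m' l else 0) else 0)"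
          by (intro sum.cong refl) (simp add: coord_ket eq)
        also have "\<dots> = (if a' = a then ?c m' l else 0)" using l by simp
        finally show "of_real (window N m' a') * (\<Sum>l'<N. ?c m' l' * coord (ket ?b) (a' * int N + int l'))
            = (if a' = a then of_real (window N m' a) * ?c m' l else 0)" by simp
      qed
      also have "\<dots> = of_real (window N m' a) * ?c m' l" by (simp add: window_supp)
      finally show ?thesis .
    qed
    have "coord (hilbert_adjoint (gabor n) f) ?b = cinner (gabor n (ket ?b)) f"
      by (rule coord_hilbert_adjoint[OF complex_linear_gabor])
    also have "\<dots> = (\<Sum>\<^sub>\<infinity>m'\<in>{a..<a + int N}. cnj (?c m' l) * coord f m' / of_nat N)"
      unfolding cinner_def by (rule infsum_cong_neutral) (use a in \<open>auto simp: k window_def\<close>)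
    finally show ?thesis by (simp add: sum_divide_distrib)
  qed
  have orth: "(\<Sum>l<N. ?c m l * (\<Sum>m'\<in>{a..<a + int N}. cnj (?c m' l) * coord f m')) = of_nat N * coord f m" if a: "a \<in> ?W" for a
  proof -
    have "(\<Sum>l<N. ?c m l * (\<Sum>m'\<in>{a..<a + int N}. cnj (?c m' l) * coord f m'))
        = (\<Sum>m'\<in>{a..<a + int N}. \<Sum>l<N. ?c m l * cnj (?c m' l) * coord f m')"
      unfolding sum_distrib_left by (subst sum.swap) (simp add: mult.assoc)
    also have "\<dots> = (\<Sum>m'\<in>{a..<a + int N}. if m' = m then of_nat N * coord f m else 0)"
    proof (rule sum.cong[OF refl])
      fix m' assume m': "m' \<in> {a..<a + int N}"
      have "?c m l * cnj (?c m' l) = chi (of_nat l * (of_int (m - m') / of_nat N))" for l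
        unfolding cnj_chi chi_add[symmetric] by (rule arg_cong[where f = chi]) (simp add: diff_divide_distrib algebra_simps)
      then have "(\<Sum>l<N. ?c m l * cnj (?c m' l) * coord f m') = (\<Sum>l<N. chi (of_nat l * (of_int (m - m') / of_nat N))) * coord f m'"
        by (simp add: sum_distrib_right)
      also have "(\<Sum>l<N. chi (of_nat l * (of_int (m - m') / of_nat N))) = (if m - m' = 0 then of_nat N else 0)"
        by (rule sum_chi) (use a m' in \<open>auto simp: window_def split: if_splits\<close>)
      finally show "(\<Sum>l<N. ?c m l * cnj (?c m' l) * coord f m') = (if m' = m then of_nat N * coord f m else 0)"
        by auto
    qed
    also have "\<dots> = of_nat N * coord f m" using a by (simp add: window_def split: if_splits)
    finally show ?thesis .
  qed
  have "coord ((gabor n o\<^sub>L hilbert_adjoint (gabor n)) f) m = (\<Sum>a\<in>?W. of_real (window N m a) *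
      (\<Sum>l<N. ?c m l * coord (hilbert_adjoint (gabor n) f) (a * int N + int l))) / of_nat N"
    unfolding N_def blinfun_apply_blinfun_compose by (rule coord_gabor) (auto simp: window_supp)
  also have "(\<Sum>a\<in>?W. of_real (window N m a) *
      (\<Sum>l<N. ?c m l * coord (hilbert_adjoint (gabor n) f) (a * int N + int l))) = (\<Sum>a\<in>?W. coord f m)"
  proof (rule sum.cong[OF refl])
    fix a assume a: "a \<in> ?W"
    have "(\<Sum>l<N. ?c m l * coord (hilbert_adjoint (gabor n) f) (a * int N + int l))
      = (\<Sum>l<N. ?c m l * (\<Sum>m'\<in>{a..<a + int N}. cnj (?c m' l) * coord f m')) / of_nat N"
      unfolding sum_divide_distrib by (intro sum.cong refl) (simp add: adj[OF a])
    also have "\<dots> = coord f m" unfolding orth[OF a] by (simp add: N_def del: of_nat_Suc)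
    finally show "of_real (window N m a) * (\<Sum>l<N. ?c m l * coord (hilbert_adjoint (gabor n) f) (a * int N + int l)) = coord f m"
      using a by (simp add: window_def split: if_splits)
  qed
  also have "\<dots> / of_nat N = of_real (cutoff n m) * coord f m"
    by (simp add: cutoff_def N_def)
  also have "\<dots> = coord (mulop (\<lambda>m. of_real (cutoff n m)) f) m"
    by (rule coord_mulop[where K = 1, symmetric]) (use cutoff_bounds in simp)
  finally show "coord ((gabor n o\<^sub>L hilbert_adjoint (gabor n)) f) m
      = coord (mulop (\<lambda>m. of_real (cutoff n m)) f) m" .
qed

section \<open>Plane waves\<close>

text \<open>The rank one operator \<open>|x\<rangle>\<langle>ket 0|\<close>.\<close>

definition column_op :: "(int \<Rightarrow> complex) \<Rightarrow> int op"
  where "column_op x = ell2_op (\<lambda>f m. x m * coord f 0)"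

lemma
  assumes B: "finite B" "card B \<le> p" and x: "\<And>m. cmod (x m) \<le> r" "\<And>m. m \<notin> B \<Longrightarrow> x m = 0"
  shows coord_column_op: "coord (column_op x f) m = x m * coord f 0"
    and norm_column_op: "norm (column_op x) \<le> sqrt (of_nat p * r\<^sup>2)"
    and complex_linear_column_op: "complex_linear (column_op x)"
proof -
  have bound: "(\<Sum>m\<in>X. (cmod (x m * coord f 0))\<^sup>2) \<le> (sqrt (of_nat p * r\<^sup>2) * norm f)\<^sup>2" if "finite X" for f X
  proof -
    have "(\<Sum>m\<in>X. (cmod (x m))\<^sup>2) = (\<Sum>m\<in>X \<inter> B. (cmod (x m))\<^sup>2)"
      using that x(2) by (intro sum.mono_neutral_right) auto
    also have "\<dots> \<le> (\<Sum>m\<in>B. (cmod (x m))\<^sup>2)"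
      using B by (intro sum_mono2) auto
    also have "\<dots> \<le> (\<Sum>m\<in>B. r\<^sup>2)"
      using x(1) by (intro sum_mono power_mono) auto
    also have "\<dots> \<le> of_nat p * r\<^sup>2"
      using B by (simp add: mult_right_mono)
    finally have "(\<Sum>m\<in>X. (cmod (x m))\<^sup>2) * (cmod (coord f 0))\<^sup>2 \<le> (of_nat p * r\<^sup>2) * (norm f)\<^sup>2"
      by (intro mult_mono power_mono cmod_coord_le) auto
    then show ?thesis by (simp add: norm_mult power_mult_distrib sum_distrib_right)
  qed
  have props: "x m * coord (f + g) 0 = x m * coord f 0 + x m * coord g 0"
    "x m * coord (scaleC c f) 0 = c * (x m * coord f 0)" for f g c m
    by (simp_all add: coord_simps algebra_simps)
  note * = props bound
  show "coord (column_op x f) m = x m * coord f 0"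
    unfolding column_op_def by (rule coord_ell2_op[where F = "\<lambda>f m. x m * coord f 0", OF *]) auto
  show "norm (column_op x) \<le> sqrt (of_nat p * r\<^sup>2)"
    unfolding column_op_def by (rule norm_ell2_op[where F = "\<lambda>f m. x m * coord f 0", OF *]) auto
  show "complex_linear (column_op x)"
    unfolding column_op_def complex_linear_def by (intro allI, rule scaleC_ell2_op[where F = "\<lambda>f m. x m * coord f 0", OF *]) auto
qed

definition plane_wave :: "real \<Rightarrow> nat \<Rightarrow> int \<Rightarrow> complex"
  where "plane_wave \<tau> n m = (if int (Suc n) \<le> m \<and> m < 2 * int (Suc n) then chi (of_int m * \<tau>) / of_real (sqrt (of_nat (Suc n))) else 0)"

definition wave :: "real \<Rightarrow> nat \<Rightarrow> int op" where "wave \<tau> n = column_op (plane_wave \<tau> n)"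

lemma
  shows coord_wave: "coord (wave \<tau> n f) m = plane_wave \<tau> n m * coord f 0"
    and norm_wave: "norm (wave \<tau> n) \<le> 1"
    and complex_linear_wave: "complex_linear (wave \<tau> n)"
proof -
  let ?B = "{int (Suc n)..<2 * int (Suc n)}"
  have B: "finite ?B" "card ?B \<le> Suc n" by simp_all
  have x: "cmod (plane_wave \<tau> n m) \<le> 1 / sqrt (of_nat (Suc n))" "m \<notin> ?B \<Longrightarrow> plane_wave \<tau> n m = 0" for m
    by (auto simp: plane_wave_def norm_divide)
  note * = B x
  show "coord (wave \<tau> n f) m = plane_wave \<tau> n m * coord f 0"
    unfolding wave_def by (rule coord_column_op[OF *])
  have "norm (wave \<tau> n) \<le> sqrt (of_nat (Suc n) * (1 / sqrt (of_nat (Suc n)))\<^sup>2)"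
    unfolding wave_def by (rule norm_column_op[OF *])
  then show "norm (wave \<tau> n) \<le> 1" by (simp add: power_divide)
  show "complex_linear (wave \<tau> n)"
    unfolding wave_def by (rule complex_linear_column_op[OF *])
qed

text \<open>
  Up to a character, a shift by \<open>k\<close> changes the wave only near the two ends of its support, where there
  is a bounded number of entries of size \<open>1 / sqrt (Suc n)\<close>.
\<close>

lemma wave_shift:
  "(\<lambda>n. norm (shift_defect k (wave \<tau> n) (\<lambda>_. \<tau>))) \<longlonglongrightarrow> 0"
proof (rule tendsto_norm_zero[OF Lim_null_comparison[OF eventually_sequentiallyI sqrt_const_div_tendsto]])
  let ?p = "nat (2 * (2 * \<bar>k\<bar> + 1))"
  show "norm (shift_defect k (wave \<tau> n) (\<lambda>_. \<tau>)) \<le> sqrt (of_nat ?p / of_nat (Suc n))"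
    if n: "nat \<bar>k\<bar> \<le> n" for n
  proof -
    define N where "N = int (Suc n)"
    define x where "x m = plane_wave \<tau> n (m - k) - chi (- (of_int k * \<tau>)) * plane_wave \<tau> n m" for m
    let ?B = "{N - \<bar>k\<bar>..N + \<bar>k\<bar>} \<union> {2 * N - \<bar>k\<bar>..2 * N + \<bar>k\<bar>}"
    have kN: "\<bar>k\<bar> < N" using n by (simp add: N_def)
    have e: "chi (of_int (m - k) * \<tau>) = chi (- (of_int k * \<tau>)) * chi (of_int m * \<tau>)" for m
      unfolding chi_add[symmetric] by (rule arg_cong[where f = chi]) (simp add: algebra_simps)
    have B: "finite ?B" "card ?B \<le> ?p" using card_near_le[of ?B] by auto
    have x: "cmod (x m) \<le> 1 / sqrt (of_nat (Suc n))" "m \<notin> ?B \<Longrightarrow> x m = 0" for m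
      using kN by (auto simp: x_def plane_wave_def e[simplified] norm_divide norm_mult N_def)
    note * = B x
    have "shift_defect k (wave \<tau> n) (\<lambda>_. \<tau>) = column_op x"
    proof (rule op_eqI)
      fix f m
      have "coord (hshift k (wave \<tau> n f)) m = plane_wave \<tau> n (m - k) * coord f 0"
        using kN by (auto simp: coord_trunc_shift coord_wave plane_wave_def N_def)
      then show "coord (shift_defect k (wave \<tau> n) (\<lambda>_. \<tau>) f) m
          = coord (column_op x f) m"
        using coord_column_op[where x = x and f = f and m = m, OF *]
        by (simp add: blinfun.diff_left coord_simps coord_wave coord_freq x_def algebra_simps)
    qed
    moreover have "norm (column_op x) \<le> sqrt (of_nat ?p * (1 / sqrt (of_nat (Suc n)))\<^sup>2)"
      by (rule norm_column_op[OF *])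
    ultimately show ?thesis by (simp add: power_divide)
  qed
qed

lemma wave_packets_wave: "wave_packets (wave \<tau>) (\<lambda>n. hilbert_adjoint (wave \<tau> n)) (\<lambda>_ _. \<tau>) 1"
  by (rule wave_packets_adjoint) (rule complex_linear_wave norm_wave wave_shift)+

lemma wave_isometry: "hilbert_adjoint (wave \<tau> n) o\<^sub>L wave \<tau> n = proj {0}"
proof (rule op_eqI)
  fix f b
  have "cnj (plane_wave \<tau> n m) * plane_wave \<tau> n m = 1 / of_nat (Suc n)" if "m \<in> {int (Suc n)..<2 * int (Suc n)}" for m
    using that by (simp add: plane_wave_def cnj_chi chi_add[symmetric] mult.commute[of "chi (- _)"] of_real_mult[symmetric] real_sqrt_mult_self del: of_real_mult of_nat_Suc)
  then have *: "(\<Sum>m\<in>{int (Suc n)..<2 * int (Suc n)}. cnj (plane_wave \<tau> n m) * plane_wave \<tau> n m) = 1"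
    by (simp del: of_nat_Suc)
  have "coord ((hilbert_adjoint (wave \<tau> n) o\<^sub>L wave \<tau> n) f) b
      = cinner (wave \<tau> n (ket b)) (wave \<tau> n f)"
    by (simp add: coord_hilbert_adjoint complex_linear_wave)
  also have "\<dots> = (\<Sum>\<^sub>\<infinity>m\<in>{int (Suc n)..<2 * int (Suc n)}.
      (cnj (plane_wave \<tau> n m) * plane_wave \<tau> n m) * (if b = 0 then coord f 0 else 0))"
    unfolding cinner_def
    by (rule infsum_cong_neutral) (auto simp: coord_wave coord_ket plane_wave_def)
  also have "\<dots> = (if b = 0 then coord f 0 else 0)"
    by (simp only: infsum_finite finite_atLeastLessThan_int sum_distrib_right[symmetric] *) simp
  finally show "coord ((hilbert_adjoint (wave \<tau> n) o\<^sub>L wave \<tau> n) f) b = coord (proj {0} f) b"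
    by (simp add: coord_simps)
qed

lemma wave_proj_0: "wave \<tau> n o\<^sub>L proj {0} = wave \<tau> n"
  by (rule op_eqI) (simp add: coord_wave coord_simps)

lemma proj_wave: "proj {int (Suc n)..} o\<^sub>L wave \<tau> n = wave \<tau> n"
  by (rule op_eqI) (auto simp: coord_wave coord_simps plane_wave_def)

lemma hilbert_adjoint_proj: "hilbert_adjoint (proj E) = proj E"
  by (rule hilbert_adjointI) (auto simp: cinner_def coord_simps intro!: infsum_cong)

lemma adjoint_wave_proj: "hilbert_adjoint (wave \<tau> n) o\<^sub>L proj {int (Suc n)..} = hilbert_adjoint (wave \<tau> n)"
  by (rule hilbert_adjoint_compose[OF complex_linear_proj complex_linear_wave, of "{int (Suc n)..}" \<tau> n,
        unfolded proj_wave hilbert_adjoint_proj, symmetric])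

lemma proj_0_adjoint_wave: "proj {0} o\<^sub>L hilbert_adjoint (wave \<tau> n) = hilbert_adjoint (wave \<tau> n)"
  by (rule hilbert_adjoint_compose[OF complex_linear_wave complex_linear_proj, of \<tau> n "{0}",
        unfolded wave_proj_0 hilbert_adjoint_proj, symmetric])

section \<open>Invertibility in corners and modulo compact operators\<close>

lemma carrier_compose:
  "A \<in> carrier (bop_alg E) \<Longrightarrow> B \<in> carrier (bop_alg E) \<Longrightarrow> A o\<^sub>L B \<in> carrier (bop_alg E)"
  using monoid.m_closed[OF ring.is_monoid[OF ring_bop_alg]] by (metis bop_alg_simps(2))

lemma carrier_plus:
  "A \<in> carrier (bop_alg E) \<Longrightarrow> B \<in> carrier (bop_alg E) \<Longrightarrow> A + B \<in> carrier (bop_alg E)"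
  by (simp add: bop_alg_simps blinfun_compose_bilinear complex_linear_plus)

lemma carrier_uminus: "A \<in> carrier (bop_alg E) \<Longrightarrow> - A \<in> carrier (bop_alg E)"
  by (simp add: bop_alg_simps blinfun_compose_bilinear complex_linear_uminus)

lemma carrier_diff:
  "A \<in> carrier (bop_alg E) \<Longrightarrow> B \<in> carrier (bop_alg E) \<Longrightarrow> A - B \<in> carrier (bop_alg E)"
  using carrier_plus[OF _ carrier_uminus, of A E B] by simp

lemma carrier_proj: "proj E \<in> carrier (bop_alg E)"
  by (simp add: bop_alg_simps complex_linear_proj proj_proj)

lemma carrier_corner: "complex_linear A \<Longrightarrow> proj E o\<^sub>L A o\<^sub>L proj E \<in> carrier (bop_alg E)"
  by (simp add: bop_alg_simps complex_linear_compose complex_linear_proj blinfun_compose_assoc' proj_proj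
      blinfun_compose_assoc'[symmetric, of "proj E" "proj E"])

lemma carrier_linear: "A \<in> carrier (bop_alg E) \<Longrightarrow> complex_linear A"
  by (simp add: bop_alg_simps)

lemma bop_alg_minus:
  assumes "A \<in> carrier (bop_alg E)" "B \<in> carrier (bop_alg E)"
  shows "A \<ominus>\<^bsub>bop_alg E\<^esub> B = A - B"
proof -
  interpret ring "bop_alg E" by (rule ring_bop_alg)
  have "\<ominus>\<^bsub>bop_alg E\<^esub> B = - B"
    using assms(2) complex_linear_uminus[of B]
    by (intro minus_equality) (auto simp: bop_alg_simps blinfun_compose_bilinear)
  then show ?thesis by (simp add: a_minus_def bop_alg_simps(4))
qed

lemma norm_proj_le: "norm (proj E) \<le> 1"
proof (rule norm_blinfun_bound)
  show "norm (proj E f) \<le> 1 * norm f" for f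
    unfolding mult_1 by (rule norm_ell2_mono) (simp add: coord_simps)
qed simp

lemma Units_bop_alg:
  "A \<in> Units (bop_alg E) \<longleftrightarrow> A \<in> carrier (bop_alg E) \<and>
    (\<exists>X\<in>carrier (bop_alg E). X o\<^sub>L A = proj E \<and> A o\<^sub>L X = proj E)"
  by (auto simp: Units_def bop_alg_simps(2,3))

lemma neumann_corner:
  assumes e: "e \<in> carrier (bop_alg E)" "norm e < 1"
  shows "\<exists>X\<in>carrier (bop_alg E). (proj E - e) o\<^sub>L X = proj E \<and> X o\<^sub>L (proj E - e) = proj E"
proof -
  \<comment> \<open>the powers of \<open>e\<close> in the corner, whose unit is \<open>proj E\<close>\<close>
  define pw where "pw k = rec_nat (proj E) (\<lambda>_ A. e o\<^sub>L A) k" for k :: nat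
  have pw: "pw 0 = proj E" "pw (Suc k) = e o\<^sub>L pw k" for k by (simp_all add: pw_def)
  have car: "pw k \<in> carrier (bop_alg E)" for k
    by (induction k) (auto simp: pw carrier_proj carrier_compose e(1))
  have pw': "pw k o\<^sub>L e = pw (Suc k)" for k
  proof (induction k)
    case 0 then show ?case using e(1) by (simp add: pw bop_alg_simps)
  next
    case (Suc k) then show ?case by (simp add: pw blinfun_compose_assoc')
  qed
  have nrm: "norm (pw k) \<le> norm e ^ k" for k
  proof (induction k)
    case (Suc k)
    then show ?case using norm_compose_le[OF order_refl Suc, of e] by (simp add: pw)
  qed (simp add: pw norm_proj_le)
  have "summable (\<lambda>k. norm (pw k))"
    by (rule summable_comparison_test'[OF summable_geometric[of "norm e"]]) (use e nrm in auto)
  then have "pw summable_on UNIV" by (rule norm_summable_imp_summable_on)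
  note s = has_sum_infsum[OF this]
  define X where "X = infsum pw UNIV"
  have split: "X = proj E + infsum pw (range Suc)"
  proof -
    have "infsum pw (insert 0 (range Suc)) = pw 0 + infsum pw (range Suc)"
      by (rule infsum_insert) (use s summable_on_subset_banach has_sum_imp_summable in blast)+
    moreover have "insert 0 (range Suc) = (UNIV :: nat set)" by (rule UNIV_nat_eq[symmetric])
    ultimately show ?thesis by (simp add: X_def pw)
  qed
  have reindex: "infsum pw (range Suc) = (\<Sum>\<^sub>\<infinity>k. pw (Suc k))"
    by (simp add: infsum_reindex o_def)
  have "((\<lambda>k. e o\<^sub>L pw k) has_sum (e o\<^sub>L X)) UNIV"
    unfolding X_def by (rule has_sum_bounded_linear[OF
      bounded_bilinear.bounded_linear_right[OF bounded_bilinear_blinfun_compose] s])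
  then have 1: "e o\<^sub>L X = infsum pw (range Suc)"
    unfolding reindex by (simp add: pw infsumI)
  have "((\<lambda>k. pw k o\<^sub>L e) has_sum (X o\<^sub>L e)) UNIV"
    unfolding X_def by (rule has_sum_bounded_linear[OF
      bounded_bilinear.bounded_linear_left[OF bounded_bilinear_blinfun_compose] s])
  then have 2: "X o\<^sub>L e = infsum pw (range Suc)"
    unfolding reindex by (simp add: pw' infsumI)
  have X: "X \<in> carrier (bop_alg E)"
    unfolding X_def by (rule infsum_bop_alg[OF car has_sum_imp_summable[OF s]])
  then have "proj E o\<^sub>L X = X" "X o\<^sub>L proj E = X" by (simp_all add: bop_alg_simps)
  then have "(proj E - e) o\<^sub>L X = proj E" "X o\<^sub>L (proj E - e) = proj E"
    unfolding blinfun_diff_left blinfun_diff_right 1 2 using split by simp_all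
  then show ?thesis using X by blast
qed

text \<open>
  Neumann series turn \<open>C\<close> into a left and into a right inverse of \<open>A\<close>, and these coincide.
\<close>

lemma Units_if_approx_inverse:
  assumes A: "A \<in> carrier (bop_alg E)" and C: "C \<in> carrier (bop_alg E)"
    and l: "norm ((C o\<^sub>L A) - proj E) < 1" and r: "norm ((A o\<^sub>L C) - proj E) < 1"
  shows "A \<in> Units (bop_alg E)"
proof -
  have "proj E - (C o\<^sub>L A) \<in> carrier (bop_alg E)" "norm (proj E - (C o\<^sub>L A)) < 1"
    using l by (auto intro: carrier_diff carrier_proj carrier_compose A C simp: norm_minus_commute)
  from neumann_corner[OF this] obtain X where X: "X \<in> carrier (bop_alg E)" "X o\<^sub>L (C o\<^sub>L A) = proj E" by auto
  have "proj E - (A o\<^sub>L C) \<in> carrier (bop_alg E)" "norm (proj E - (A o\<^sub>L C)) < 1"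
    using r by (auto intro: carrier_diff carrier_proj carrier_compose A C simp: norm_minus_commute)
  from neumann_corner[OF this] obtain Y where Y: "Y \<in> carrier (bop_alg E)" "(A o\<^sub>L C) o\<^sub>L Y = proj E" by auto
  have L: "(X o\<^sub>L C) o\<^sub>L A = proj E" using X(2) by (simp add: blinfun_compose_assoc')
  have R: "A o\<^sub>L (C o\<^sub>L Y) = proj E" using Y(2) by (simp add: blinfun_compose_assoc')
  have XC: "X o\<^sub>L C \<in> carrier (bop_alg E)" and CY: "C o\<^sub>L Y \<in> carrier (bop_alg E)"
    by (intro carrier_compose X Y C)+
  have "X o\<^sub>L C = (X o\<^sub>L C) o\<^sub>L (A o\<^sub>L (C o\<^sub>L Y))"
    using XC unfolding R by (simp add: bop_alg_simps)
  also have "\<dots> = ((X o\<^sub>L C) o\<^sub>L A) o\<^sub>L (C o\<^sub>L Y)" by (simp only: blinfun_compose_assoc')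
  also have "\<dots> = C o\<^sub>L Y"
    using CY unfolding L by (simp add: bop_alg_simps)
  finally show ?thesis
    unfolding Units_bop_alg using A L R CY by metis
qed

lemma
  assumes "K \<in> compact_ops E"
  shows compact_ops_carrier: "K \<in> carrier (bop_alg E)"
    and compact_ops_plus: "L \<in> compact_ops E \<Longrightarrow> K + L \<in> compact_ops E"
    and compact_ops_uminus: "- K \<in> compact_ops E"
    and compact_ops_left: "A \<in> carrier (bop_alg E) \<Longrightarrow> A o\<^sub>L K \<in> compact_ops E"
    and compact_ops_right: "A \<in> carrier (bop_alg E) \<Longrightarrow> K o\<^sub>L A \<in> compact_ops E"
  using assms
  by (auto simp: compact_ops_def carrier_plus carrier_uminus carrier_compose
      simp del: blinfun_apply_blinfun_compose
      intro: compact_plus compact_uminus compact_comp_left compact_comp_right)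

lemma calkin_map_Units_iff:
  assumes H: "H \<in> carrier (bop_alg E)"
  shows "calkin_map E H \<in> Units (calkin E) \<longleftrightarrow>
    (\<exists>B\<in>carrier (bop_alg E). (B o\<^sub>L H) - proj E \<in> compact_ops E \<and> (H o\<^sub>L B) - proj E \<in> compact_ops E)"
proof -
  interpret ideal "compact_ops E" "bop_alg E" by (rule ideal_compact_ops)
  have hom: "calkin_map E \<in> ring_hom (bop_alg E) (calkin E)"
    using rcos_ring_hom by (simp add: calkin_def calkin_map_def[abs_def])
  have eq: "calkin_map E A = calkin_map E B \<longleftrightarrow> A - B \<in> compact_ops E"
    if "A \<in> carrier (bop_alg E)" "B \<in> carrier (bop_alg E)" for A B
    using quotient_eq_iff_same_a_r_cos[OF ideal_axioms that] that by (simp add: calkin_map_def bop_alg_minus)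
  have car: "carrier (calkin E) = calkin_map E ` carrier (bop_alg E)"
    by (auto simp: calkin_def FactRing_def A_RCOSETS_def' calkin_map_def)
  have one: "\<one>\<^bsub>calkin E\<^esub> = calkin_map E (proj E)"
    using ring_hom_one[OF hom] by (simp add: bop_alg_simps(3))
  have mult: "calkin_map E A \<otimes>\<^bsub>calkin E\<^esub> calkin_map E B = calkin_map E (A o\<^sub>L B)"
    if "A \<in> carrier (bop_alg E)" "B \<in> carrier (bop_alg E)" for A B
    using ring_hom_mult[OF hom that] by (simp add: bop_alg_simps(2))
  have "calkin_map E H \<in> Units (calkin E) \<longleftrightarrow>
     (\<exists>B\<in>carrier (bop_alg E). calkin_map E (B o\<^sub>L H) = calkin_map E (proj E) \<and> calkin_map E (H o\<^sub>L B) = calkin_map E (proj E))"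
    using H by (auto simp: Units_def car one mult)
  then show ?thesis by (auto simp: eq carrier_compose carrier_proj H)
qed

text \<open>A left and a right parametrix differ by a compact operator, so each of them is two-sided.\<close>

lemma parametrix_left_right:
  assumes H: "H \<in> carrier (bop_alg E)" and B: "B \<in> carrier (bop_alg E)" "B' \<in> carrier (bop_alg E)"
    and r: "(H o\<^sub>L B) - proj E \<in> compact_ops E" and l: "(B' o\<^sub>L H) - proj E \<in> compact_ops E"
  shows "(H o\<^sub>L B') - proj E \<in> compact_ops E"
proof -
  let ?K = "(H o\<^sub>L B) - proj E" and ?L = "(B' o\<^sub>L H) - proj E"
  have "B' o\<^sub>L ?K = (B' o\<^sub>L H o\<^sub>L B) - B'" "?L o\<^sub>L B = (B' o\<^sub>L H o\<^sub>L B) - B"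
    using B by (simp_all add: blinfun_diff_left blinfun_diff_right bop_alg_simps blinfun_compose_assoc')
  then have "B' = B + ((?L o\<^sub>L B) + - (B' o\<^sub>L ?K))" by simp
  then have "(H o\<^sub>L B') - proj E = ?K + (H o\<^sub>L ((?L o\<^sub>L B) + - (B' o\<^sub>L ?K)))"
    by (metis (no_types, lifting) add.commute add_diff_eq blinfun_compose_bilinear(2))
  also have "\<dots> \<in> compact_ops E"
    by (intro compact_ops_plus compact_ops_left compact_ops_right compact_ops_uminus r l H B)
  finally show ?thesis .
qed

lemma finite_support_compact:
  assumes "finite X" "X \<subseteq> E" "\<And>x. x \<notin> X \<Longrightarrow> u x = 0" "\<And>x. cmod (u x) \<le> K"
  shows "mulop u \<in> compact_ops E"
proof -
  note c = coord_mulop[where K = K, OF assms(4)]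
  have "u x = 0" if "x \<notin> E" for x using assms(2,3) that by blast
  then have car: "mulop u \<in> carrier (bop_alg E)"
    by (auto simp: bop_alg_simps complex_linear_mulop[where K = K, OF assms(4)] c coord_simps intro!: op_eqI)
  define T where "T Y = {\<Sum>x\<in>Y. scaleC (v x) (ket x) | v. \<forall>x. cmod (v x) \<le> K}" for Y :: "'a set"
  have "compact (T X)"
    using assms(1)
  proof (induction X rule: finite_induct)
    case empty
    have "0 \<le> K" using assms(4) norm_ge_zero order_trans by blast
    then have "T {} = {0}" by (auto simp: T_def intro!: exI[of _ "\<lambda>_. 0"])
    then show ?case by simp
  next
    case (insert y Y)
    have cont: "compact ((\<lambda>c. scaleC c (ket y)) ` cball 0 K)"
    proof (rule compact_continuous_image)
      have "bounded_linear (\<lambda>c. scaleC c (ket y :: 'a ell2))"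
        by (rule bounded_linear_intro[where K = "norm (ket y :: 'a ell2)"])
           (auto intro!: coord_inject_ext simp: coord_simps algebra_simps norm_scaleC scaleR_conv_of_real)
      then show "continuous_on (cball 0 K) (\<lambda>c. scaleC c (ket y :: 'a ell2))"
        by (rule linear_continuous_on)
    qed simp
    have "T (insert y Y) \<subseteq> {a + b | a b. a \<in> (\<lambda>c. scaleC c (ket y)) ` cball 0 K \<and> b \<in> T Y}"
      using insert(1,2) by (fastforce simp: T_def)
    moreover have "{a + b | a b. a \<in> (\<lambda>c. scaleC c (ket y)) ` cball 0 K \<and> b \<in> T Y} \<subseteq> T (insert y Y)"
    proof clarsimp
      fix c b assume c: "cmod c \<le> K" and "b \<in> T Y"
      then obtain v where v: "b = (\<Sum>x\<in>Y. scaleC (v x) (ket x))" "\<forall>x. cmod (v x) \<le> K" by (auto simp: T_def)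
      have "(\<Sum>x\<in>Y. scaleC (v x) (ket x)) = (\<Sum>x\<in>Y. scaleC ((v(y := c)) x) (ket x))"
        using insert(2) by (intro sum.cong) auto
      then show "scaleC c (ket y) + b \<in> T (insert y Y)"
        using insert(1,2) c v unfolding T_def by (intro CollectI exI[of _ "v(y := c)"]) auto
    qed
    ultimately have "T (insert y Y) = {a + b | a b. a \<in> (\<lambda>c. scaleC c (ket y)) ` cball 0 K \<and> b \<in> T Y}" by blast
    then show ?case using compact_sums[OF cont insert(3)] by simp
  qed
  moreover have "blinfun_apply (mulop u) ` cball 0 1 \<subseteq> T X"
  proof clarsimp
    fix f :: "'a ell2" assume f: "norm f \<le> 1"
    have "mulop u f = restr X (mulop u f)"
      using assms(3) by (intro coord_inject_ext) (auto simp: c coord_simps)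
    also have "\<dots> = (\<Sum>x\<in>X. scaleC (coord (mulop u f) x) (ket x))"
      by (rule restr_finite[OF assms(1)])
    finally show "mulop u f \<in> T X"
    proof (unfold T_def, intro CollectI exI conjI allI)
      fix x
      have "cmod (coord (mulop u f) x) \<le> norm (mulop u f)" by (rule cmod_coord_le)
      also have "\<dots> \<le> K * 1"
        by (rule order_trans[OF norm_blinfun mult_mono[OF norm_mulop[OF assms(4)] f]])
           (use assms(4) norm_ge_zero order_trans in \<open>blast, simp\<close>)
      finally show "cmod (coord (mulop u f) x) \<le> K" by simp
    qed
  qed
  ultimately show ?thesis
    using car compact_closure_mono by (auto simp: compact_ops_def)
qed

text \<open>Strong convergence to 0 of contractions is uniform on compact sets.\<close>

lemma compact_strong_tendsto_0:
  fixes A :: "nat \<Rightarrow> 'a op"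
  assumes K: "compact (closure (blinfun_apply K ` cball 0 1))"
    and A: "\<And>n. norm (A n) \<le> 1" "\<And>g. (\<lambda>n. norm (blinfun_apply (A n) g)) \<longlonglongrightarrow> 0"
  shows "(\<lambda>n. norm (A n o\<^sub>L K)) \<longlonglongrightarrow> 0"
proof (rule tendstoI)
  fix e :: real assume e: "0 < e"
  let ?S = "closure (blinfun_apply K ` cball 0 1)"
  have cover: "?S \<subseteq> (\<Union>y\<in>?S. ball y (e / 4))" using e by auto
  obtain Y where Y: "finite Y" "?S \<subseteq> (\<Union>y\<in>Y. ball y (e / 4))"
    by (rule compactE_image[OF K _ cover]) auto
  have "eventually (\<lambda>n. \<forall>y\<in>Y. norm (A n y) < e / 4) sequentially"
    using Y(1) e tendstoD[OF A(2), of "e / 4"] by (intro eventually_ball_finite) auto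
  then show "eventually (\<lambda>n. dist (norm (A n o\<^sub>L K)) 0 < e) sequentially"
  proof eventually_elim
    case (elim n)
    have "norm (A n o\<^sub>L K) \<le> e / 2"
    proof (rule norm_blinfun_bound)
      have unit: "norm (blinfun_apply (A n o\<^sub>L K) g) \<le> e / 2" if "norm g \<le> 1" for g
      proof -
        have "K g \<in> ?S" using that by (intro subsetD[OF closure_subset]) auto
        then obtain y where y: "y \<in> Y" "norm (K g - y) < e / 4"
          using Y(2) by (auto simp: dist_norm norm_minus_commute)
        have "blinfun_apply (A n o\<^sub>L K) g = A n (K g - y) + A n y"
          by (simp add: blinfun.diff_right)
        also have "norm \<dots> \<le> 1 * norm (K g - y) + norm (A n y)"
          by (rule order_trans[OF norm_triangle_ineq add_right_mono[OF order_trans[OF norm_blinfun mult_right_mono[OF A(1)]]]]) simp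
        finally show ?thesis using y elim by fastforce
      qed
      fix f
      show "norm (blinfun_apply (A n o\<^sub>L K) f) \<le> e / 2 * norm f"
      proof (cases "f = 0")
        case False
        have "f = norm f *\<^sub>R ((1 / norm f) *\<^sub>R f)" using False by simp
        then have "norm (blinfun_apply (A n o\<^sub>L K) f) = norm f * norm (blinfun_apply (A n o\<^sub>L K) ((1 / norm f) *\<^sub>R f))"
          by (metis abs_norm_cancel blinfun.scaleR_right norm_scaleR)
        also have "\<dots> \<le> norm f * (e / 2)"
          using False by (intro mult_left_mono unit) auto
        finally show ?thesis by (simp add: mult.commute)
      qed (simp add: blinfun.zero_right)
    qed (use e in simp)
    then show ?case using e by simp
  qed
qed

lemma proj_strong_tendsto_0:
  assumes "\<And>x. eventually (\<lambda>n. x \<notin> S n) sequentially"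
  shows "(\<lambda>n. norm (proj (S n) g)) \<longlonglongrightarrow> 0"
proof (rule tendstoI)
  fix e :: real assume e: "0 < e"
  obtain F where F: "finite F" "dist (restr F g) g < e"
    using tendstoD[OF restr_tendsto[of g] e] unfolding eventually_finite_subsets_at_top by blast
  have "eventually (\<lambda>n. \<forall>x\<in>F. x \<notin> S n) sequentially"
    using F(1) assms by (intro eventually_ball_finite) auto
  then show "eventually (\<lambda>n. dist (norm (proj (S n) g)) 0 < e) sequentially"
  proof eventually_elim
    case (elim n)
    have "norm (proj (S n) g) \<le> norm (restr F g - g)"
      using elim by (intro norm_ell2_mono) (auto simp: coord_simps)
    then show ?case using F(2) by (simp add: dist_norm)
  qed
qed

section \<open>Fredholm Toeplitz operators\<close>

lemma amp_proj: "amp j (proj S) = proj {\<xi>. \<xi> j \<in> S}"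
  by (rule op_eqI) (simp add: coord_amp[OF complex_linear_proj] coord_simps coord_line)

lemma proj_NN_factor: "j \<in> J \<Longrightarrow> proj (NN J) = proj (Cyl J j) o\<^sub>L amp j (proj {1..})"
  by (rule op_eqI) (auto simp: amp_proj coord_simps NN_eq_Cyl)

lemma proj_Cyl_amp: "j \<in> J \<Longrightarrow> complex_linear a \<Longrightarrow> proj (Cyl J j) o\<^sub>L amp j a = amp j a o\<^sub>L proj (Cyl J j)"
  by (rule amp_proj_commute) (auto simp: Cyl_update)

lemma proj_Cyl_slice: "j \<in> J \<Longrightarrow> proj (Cyl J j) o\<^sub>L proj {\<xi>. \<xi> j = 0} = proj (NN (J - {j}))"
  unfolding Cyl_slice[symmetric] by (rule op_eqI) (auto simp: coord_simps)

context
  fixes J :: "nat set" and \<rho> \<sigma> :: "(nat \<Rightarrow> int) \<Rightarrow> complex"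
  assumes \<rho>: "(\<lambda>\<eta>. cmod (\<rho> \<eta>)) summable_on ZZ J"
    and \<sigma>: "(\<lambda>\<eta>. cmod (\<sigma> \<eta>)) summable_on ZZ J"
begin

abbreviation face :: "nat \<Rightarrow> real \<Rightarrow> (nat \<Rightarrow> int) op"
  where "face j \<tau> \<equiv> TV (J - {j}) (nu j \<tau> \<rho>) (nu j 0 \<sigma>)"

lemma TV_carrier: "TV J \<rho> \<sigma> \<in> carrier (bop_alg (NN J))"
  by (intro carrier_plus toeplitz_carrier \<rho> \<sigma>)

lemma face_carrier: "j \<in> J \<Longrightarrow> face j \<tau> \<in> carrier (bop_alg (NN (J - {j})))"
  by (intro carrier_plus toeplitz_carrier abs_summable_nu \<rho> \<sigma>)

text \<open>
  With \<open>s\<close> and \<open>t\<close> built from plane waves of frequency \<open>\<tau>\<close>, \<open>C = t B s\<close> inverts the face \<open>F\<close>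
  asymptotically: \<open>C F = t B s F\<close> is close to \<open>t B H s = t (1 + K) s\<close>, here \<open>t s = 1\<close>, and \<open>t K\<close> tends to 0
  in norm. The same argument applies to \<open>F C\<close>. An operator that is close to the unit is invertible.
\<close>

lemma face_Units_if_parametrix:
  assumes j: "j \<in> J" and B: "B \<in> carrier (bop_alg (NN J))"
    and l: "(B o\<^sub>L TV J \<rho> \<sigma>) - proj (NN J) \<in> compact_ops (NN J)"
    and r: "(TV J \<rho> \<sigma> o\<^sub>L B) - proj (NN J) \<in> compact_ops (NN J)"
  shows "face j \<tau> \<in> Units (bop_alg (NN (J - {j})))"
proof -
  interpret wave_packets "wave \<tau>" "\<lambda>n. hilbert_adjoint (wave \<tau> n)" "\<lambda>_ _. \<tau>" 1
    by (rule wave_packets_wave)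
  define s where "s n = amp j (wave \<tau> n)" for n
  define t where "t n = amp j (hilbert_adjoint (wave \<tau> n))" for n
  define H where "H = TV J \<rho> \<sigma>"
  define L where "L = face_symbol J j (\<lambda>_. \<tau>) \<rho> \<sigma>"
  define F where "F = face j \<tau>"
  let ?E = "NN J" and ?E' = "NN (J - {j})" and ?Q = "proj {\<xi> :: nat \<Rightarrow> int. \<xi> j = 0}"
  note cl = complex_linear_wave complex_linear_hilbert_adjoint complex_linear_proj complex_linear_compose
  have F: "F \<in> carrier (bop_alg ?E')" unfolding F_def by (rule face_carrier[OF j])
  have Q: "amp j (proj {0}) = ?Q" unfolding amp_proj by simp
  have QL: "?Q o\<^sub>L L = F o\<^sub>L ?Q"
    unfolding L_def F_def by (rule slice_face_symbol[OF j \<rho> \<sigma>, of 0 "\<lambda>_. \<tau>", unfolded slice_0])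
  have sQ: "s n o\<^sub>L ?Q = s n" for n
    unfolding s_def Q[symmetric] by (simp add: amp_compose[symmetric] cl wave_proj_0)
  have Qt: "?Q o\<^sub>L t n = t n" for n
    unfolding t_def Q[symmetric] by (simp add: amp_compose[symmetric] cl proj_0_adjoint_wave)
  have PQ: "proj ?E' o\<^sub>L ?Q = proj ?E'" "?Q o\<^sub>L proj ?E' = proj ?E'"
    unfolding Cyl_slice[OF j, symmetric] by (auto intro!: op_eqI simp: coord_simps)
  have FP: "F o\<^sub>L proj ?E' = F" "proj ?E' o\<^sub>L F = F" using F by (simp_all add: bop_alg_simps)
  have FQ: "F o\<^sub>L ?Q = F" using FP(1) PQ(1) by (metis blinfun_compose_assoc')
  have ns: "norm (s n) \<le> 1" for n
    unfolding s_def by (rule order_trans[OF norm_amp[OF lin(1)] bounded(1)])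
  have nt: "norm (t n) \<le> 1" for n
    unfolding t_def by (rule order_trans[OF norm_amp[OF lin(2)] bounded(2)])
  have Ps: "proj ?E o\<^sub>L s n = proj (Cyl J j) o\<^sub>L s n" for n
  proof -
    have "proj {1..} o\<^sub>L wave \<tau> n = wave \<tau> n"
      by (rule op_eqI) (auto simp: coord_wave coord_simps plane_wave_def)
    then show ?thesis
      unfolding proj_NN_factor[OF j] s_def blinfun_compose_assoc'
      by (simp add: amp_compose[symmetric] cl)
  qed
  have tPs: "t n o\<^sub>L (proj ?E o\<^sub>L s n) = proj ?E'" for n
  proof -
    have "t n o\<^sub>L (proj ?E o\<^sub>L s n) = (t n o\<^sub>L proj (Cyl J j)) o\<^sub>L s n"
      by (simp only: Ps blinfun_compose_assoc')
    also have "t n o\<^sub>L proj (Cyl J j) = proj (Cyl J j) o\<^sub>L t n"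
      unfolding t_def by (simp add: proj_Cyl_amp j cl)
    also have "(proj (Cyl J j) o\<^sub>L t n) o\<^sub>L s n = proj (Cyl J j) o\<^sub>L amp j (proj {0})"
      unfolding t_def s_def blinfun_compose_assoc' by (simp add: amp_compose[symmetric] cl wave_isometry)
    also have "\<dots> = proj ?E'" unfolding Q by (rule proj_Cyl_slice[OF j])
    finally show ?thesis .
  qed
  define K1 where "K1 = (B o\<^sub>L H) - proj ?E"
  define K2 where "K2 = (H o\<^sub>L B) - proj ?E"
  have decay: "(\<lambda>n. norm (t n o\<^sub>L K)) \<longlonglongrightarrow> 0" if "K \<in> compact_ops ?E" for K
  proof (rule compact_strong_tendsto_0)
    fix g
    let ?far = "\<lambda>n. proj {\<xi>. \<xi> j \<in> {int (Suc n)..}}"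
    have proj_t: "t n = t n o\<^sub>L ?far n" for n
      unfolding t_def amp_proj[symmetric]
      by (subst amp_compose[symmetric]) (simp_all only: cl adjoint_wave_proj)
    have "eventually (\<lambda>n. \<xi> \<notin> {\<xi> :: nat \<Rightarrow> int. \<xi> j \<in> {int (Suc n)..}}) sequentially" for \<xi>
      by (rule eventually_sequentiallyI[of "nat (\<xi> j)"]) auto
    from proj_strong_tendsto_0[OF this, of g]
    have lim: "(\<lambda>n. norm (?far n g)) \<longlonglongrightarrow> 0" .
    have le: "norm (blinfun_apply (t n) g) \<le> norm (?far n g)" for n
    proof -
      have "norm (blinfun_apply (t n) g) = norm (blinfun_apply (t n) (?far n g))"
        by (subst proj_t) simp
      also have "\<dots> \<le> 1 * norm (?far n g)"
        by (rule order_trans[OF norm_blinfun mult_right_mono[OF nt]]) simp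
      finally show ?thesis by simp
    qed
    show "(\<lambda>n. norm (blinfun_apply (t n) g)) \<longlonglongrightarrow> 0"
      by (rule norm_tendsto_0_le[OF lim le])
  qed (use that nt in \<open>auto simp: compact_ops_def\<close>)
  define e1 where "e1 n = (H o\<^sub>L s n) - (s n o\<^sub>L L)" for n
  define e2 where "e2 n = (t n o\<^sub>L H) - (L o\<^sub>L t n)" for n
  have e1: "(\<lambda>n. norm (e1 n)) \<longlonglongrightarrow> 0"
    unfolding e1_def H_def L_def s_def by (rule symbol_right[OF j \<rho> \<sigma>])
  have e2: "(\<lambda>n. norm (e2 n)) \<longlonglongrightarrow> 0"
    unfolding e2_def H_def L_def t_def by (rule symbol_left[OF j \<rho> \<sigma>])
  define C where "C n = t n o\<^sub>L (B o\<^sub>L s n)" for n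
  have sL: "s n o\<^sub>L L = s n o\<^sub>L F" for n
  proof -
    have "s n o\<^sub>L L = (s n o\<^sub>L ?Q) o\<^sub>L L" by (simp only: sQ)
    also have "\<dots> = s n o\<^sub>L F" by (simp only: blinfun_compose_assoc' QL FQ)
    finally show ?thesis .
  qed
  have QLt: "?Q o\<^sub>L e2 n = (t n o\<^sub>L H) - (F o\<^sub>L t n)" for n
  proof -
    have 1: "?Q o\<^sub>L (t n o\<^sub>L H) = t n o\<^sub>L H" by (rule comp_absorb_left[OF Qt])
    have "?Q o\<^sub>L (L o\<^sub>L t n) = (?Q o\<^sub>L L) o\<^sub>L t n" by (simp only: blinfun_compose_assoc')
    also have "\<dots> = F o\<^sub>L t n" by (simp only: QL blinfun_compose_assoc' Qt)
    finally show ?thesis by (simp add: e2_def blinfun_diff_right 1)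
  qed
  have left: "(C n o\<^sub>L F) - proj ?E' = ((t n o\<^sub>L K1) o\<^sub>L s n) - ((t n o\<^sub>L B) o\<^sub>L e1 n)" for n
  proof -
    have "(t n o\<^sub>L K1) o\<^sub>L s n = ((t n o\<^sub>L B) o\<^sub>L (H o\<^sub>L s n)) - (t n o\<^sub>L (proj ?E o\<^sub>L s n))"
      by (simp add: K1_def blinfun_diff_left blinfun_diff_right blinfun_compose_assoc')
    moreover have "(t n o\<^sub>L B) o\<^sub>L e1 n = ((t n o\<^sub>L B) o\<^sub>L (H o\<^sub>L s n)) - (C n o\<^sub>L F)"
      by (simp add: e1_def sL C_def blinfun_diff_right blinfun_compose_assoc')
    ultimately show ?thesis by (simp add: tPs)
  qed
  have right: "(F o\<^sub>L C n) - proj ?E' = ((t n o\<^sub>L K2) o\<^sub>L s n) - ((?Q o\<^sub>L e2 n) o\<^sub>L (B o\<^sub>L s n))" for n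
  proof -
    have "(t n o\<^sub>L K2) o\<^sub>L s n = ((t n o\<^sub>L H) o\<^sub>L (B o\<^sub>L s n)) - (t n o\<^sub>L (proj ?E o\<^sub>L s n))"
      by (simp add: K2_def blinfun_diff_left blinfun_diff_right blinfun_compose_assoc')
    moreover have "(?Q o\<^sub>L e2 n) o\<^sub>L (B o\<^sub>L s n) = ((t n o\<^sub>L H) o\<^sub>L (B o\<^sub>L s n)) - (F o\<^sub>L C n)"
      unfolding QLt by (simp add: C_def blinfun_diff_left blinfun_compose_assoc')
    ultimately show ?thesis by (simp add: tPs)
  qed
  have leftlim: "(\<lambda>n. norm ((C n o\<^sub>L F) - proj ?E')) \<longlonglongrightarrow> 0"
  proof (rule norm_tendsto_0_le)
    show "(\<lambda>n. norm (t n o\<^sub>L K1) * 1 + (1 * norm B) * norm (e1 n)) \<longlonglongrightarrow> 0"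
      using tendsto_add[OF decay[OF l[folded H_def K1_def]] tendsto_mult_left[OF e1, of "norm B"]] by simp
    show "norm ((C n o\<^sub>L F) - proj ?E') \<le> norm (t n o\<^sub>L K1) * 1 + (1 * norm B) * norm (e1 n)" for n
      unfolding left by (intro norm_diff_le norm_compose_le nt ns order_refl)
  qed
  have rightlim: "(\<lambda>n. norm ((F o\<^sub>L C n) - proj ?E')) \<longlonglongrightarrow> 0"
  proof (rule norm_tendsto_0_le)
    show "(\<lambda>n. norm (t n o\<^sub>L K2) * 1 + (1 * norm (e2 n)) * (norm B * 1)) \<longlonglongrightarrow> 0"
      using tendsto_add[OF decay[OF r[folded H_def K2_def]] tendsto_mult_right[OF e2, of "norm B"]] by simp
    show "norm ((F o\<^sub>L C n) - proj ?E') \<le> norm (t n o\<^sub>L K2) * 1 + (1 * norm (e2 n)) * (norm B * 1)" for n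
      unfolding right by (intro norm_diff_le norm_compose_le nt ns norm_proj_le order_refl)
  qed
  have "eventually (\<lambda>n. norm ((C n o\<^sub>L F) - proj ?E') < 1 \<and> norm ((F o\<^sub>L C n) - proj ?E') < 1) sequentially"
    by (intro eventually_conj order_tendstoD(2)[OF leftlim] order_tendstoD(2)[OF rightlim]) auto
  then obtain n where n: "norm ((C n o\<^sub>L F) - proj ?E') < 1" "norm ((F o\<^sub>L C n) - proj ?E') < 1"
    unfolding eventually_sequentially by blast
  define C' where "C' = proj ?E' o\<^sub>L C n o\<^sub>L proj ?E'"
  have C': "C' \<in> carrier (bop_alg ?E')"
    unfolding C'_def C_def s_def t_def
    by (intro carrier_corner complex_linear_compose complex_linear_amp cl carrier_linear[OF B])
  have "(C' o\<^sub>L F) - proj ?E' = proj ?E' o\<^sub>L ((C n o\<^sub>L F) - proj ?E')"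
    by (simp add: C'_def blinfun_diff_right blinfun_compose_assoc' FP proj_proj)
  then have 1: "norm ((C' o\<^sub>L F) - proj ?E') < 1"
    using n(1) norm_compose_le[OF norm_proj_le order_refl, of ?E' "(C n o\<^sub>L F) - proj ?E'"] by simp
  have "F o\<^sub>L C' = (F o\<^sub>L proj ?E') o\<^sub>L (C n o\<^sub>L proj ?E')"
    by (simp only: C'_def blinfun_compose_assoc')
  then have "(F o\<^sub>L C') - proj ?E' = ((F o\<^sub>L C n) - proj ?E') o\<^sub>L proj ?E'"
    unfolding FP by (simp add: blinfun_diff_left blinfun_compose_assoc' proj_proj)
  then have 2: "norm ((F o\<^sub>L C') - proj ?E') < 1"
    using n(2) norm_compose_le[OF order_refl norm_proj_le, of "(F o\<^sub>L C n) - proj ?E'" ?E'] by simp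
  show ?thesis
    using Units_if_approx_inverse[OF F C' 1 2] by (simp add: F_def)
qed

lemma face_continuous:
  assumes j: "j \<in> J" and lim: "u \<longlonglongrightarrow> \<tau>"
  shows "(\<lambda>n. norm (face j (u n) - face j \<tau>)) \<longlonglongrightarrow> 0"
proof -
  let ?v = "\<lambda>\<eta>. trunc_shift (NN (J - {j})) (\<eta>(j := 0))"
  let ?c = "\<lambda>\<eta> \<tau>. chi (- (of_int (\<eta> j) * \<tau>))"
  define A where "A n \<eta> = (scalar (?c \<eta> (u n)) o\<^sub>L ?v \<eta>) - (scalar (?c \<eta> \<tau>) o\<^sub>L ?v \<eta>)" for n and \<eta> :: "nat \<Rightarrow> int"
  have cv: "norm (scalar (?c \<eta> \<tau>) o\<^sub>L ?v \<eta>) \<le> 1" for \<eta> \<tau>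
    using norm_scalar_comp_le[of "?c \<eta> \<tau>" "?v \<eta>"] norm_trunc_shift_le[of "NN (J - {j})" "\<eta>(j := 0)"] by simp
  have T: "toeplitz_T (J - {j}) (nu j \<tau> \<rho>) = (\<Sum>\<^sub>\<infinity>\<eta>\<in>ZZ J. scalar (\<rho> \<eta>) o\<^sub>L (scalar (?c \<eta> \<tau>) o\<^sub>L ?v \<eta>))" for \<tau>
    unfolding toeplitz_T_def scalar_scalar
    by (rule infsum_scalar_regroup[OF j \<rho> norm_trunc_shift_le, symmetric])
  have "face j (u n) - face j \<tau> = (\<Sum>\<^sub>\<infinity>\<eta>\<in>ZZ J. scalar (\<rho> \<eta>) o\<^sub>L A n \<eta>)" for n
    unfolding A_def infsum_scalar_diff[where A = "\<lambda>\<eta>. scalar (?c \<eta> (u n)) o\<^sub>L ?v \<eta>"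
        and B = "\<lambda>\<eta>. scalar (?c \<eta> \<tau>) o\<^sub>L ?v \<eta>", OF \<rho> cv cv, symmetric]
    by (simp add: T)
  moreover have "(\<lambda>n. norm (\<Sum>\<^sub>\<infinity>\<eta>\<in>ZZ J. scalar (\<rho> \<eta>) o\<^sub>L A n \<eta>)) \<longlonglongrightarrow> 0"
  proof (rule infsum_scalar_tendsto_0[OF \<rho>])
    show "norm (A n \<eta>) \<le> 1 + 1" for n \<eta>
      unfolding A_def by (intro norm_diff_le cv)
    show "(\<lambda>n. norm (A n \<eta>)) \<longlonglongrightarrow> 0" for \<eta>
    proof (rule norm_tendsto_0_le)
      have "(\<lambda>n. cmod (?c \<eta> (u n) - ?c \<eta> \<tau>)) \<longlonglongrightarrow> cmod (?c \<eta> \<tau> - ?c \<eta> \<tau>)"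
        unfolding chi_def by (intro tendsto_intros lim)
      then show "(\<lambda>n. cmod (?c \<eta> (u n) - ?c \<eta> \<tau>)) \<longlonglongrightarrow> 0" by simp
      show "norm (A n \<eta>) \<le> cmod (?c \<eta> (u n) - ?c \<eta> \<tau>)" for n
      proof -
        have "A n \<eta> = scalar (?c \<eta> (u n) - ?c \<eta> \<tau>) o\<^sub>L ?v \<eta>"
          unfolding A_def by (rule op_eqI) (simp add: blinfun.diff_left coord_simps algebra_simps)
        also have "norm \<dots> \<le> cmod (?c \<eta> (u n) - ?c \<eta> \<tau>) * 1"
          by (rule order_trans[OF norm_scalar_comp_le mult_left_mono[OF norm_trunc_shift_le]]) simp
        finally show ?thesis by simp
      qed
    qed
  qed
  ultimately show ?thesis by simp
qed

text \<open>
  If the inverses were unbounded along a sequence converging to \<open>\<tau>\<close>, the resolvent identity for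
  \<open>X \<tau>\<close> and continuity would bound them by \<open>2 * norm (X \<tau>)\<close> eventually.
\<close>

lemma face_inverse_bounded:
  assumes j: "j \<in> J" and inv: "\<And>\<tau>. \<tau> \<in> {0..1} \<Longrightarrow> X \<tau> \<in> carrier (bop_alg (NN (J - {j}))) \<and>
      X \<tau> o\<^sub>L face j \<tau> = proj (NN (J - {j})) \<and> face j \<tau> o\<^sub>L X \<tau> = proj (NN (J - {j}))"
  shows "\<exists>C. \<forall>\<tau>\<in>{0..1}. norm (X \<tau>) \<le> C"
proof (rule ccontr)
  assume "\<not> (\<exists>C. \<forall>\<tau>\<in>{0..1}. norm (X \<tau>) \<le> C)"
  then have "\<forall>n. \<exists>\<tau>\<in>{0..1}. of_nat n < norm (X \<tau>)" by (meson not_le)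
  then obtain u where u: "\<And>n. u n \<in> {0..1}" "\<And>n. of_nat n < norm (X (u n))" by metis
  obtain \<tau> r where \<tau>: "\<tau> \<in> {0..1::real}" "strict_mono r" "(u \<circ> r) \<longlonglongrightarrow> \<tau>"
    using compact_imp_seq_compact[OF compact_Icc] u(1) unfolding seq_compact_def by metis
  let ?d = "\<lambda>k. norm (face j ((u \<circ> r) k) - face j \<tau>)"
  have d: "?d \<longlonglongrightarrow> 0" by (rule face_continuous[OF j \<tau>(3)])
  have bd: "norm (X (u (r k))) \<le> norm (X \<tau>) + norm (X \<tau>) * (?d k * norm (X (u (r k))))" for k
  proof -
    let ?Y = "X (u (r k))"
    note iY = inv[OF u(1), of "r k"] and iX = inv[OF \<tau>(1)]
    have "X \<tau> o\<^sub>L ((face j ((u \<circ> r) k) - face j \<tau>) o\<^sub>L ?Y) =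
        (X \<tau> o\<^sub>L (face j (u (r k)) o\<^sub>L ?Y)) - ((X \<tau> o\<^sub>L face j \<tau>) o\<^sub>L ?Y)"
      by (simp only: o_apply blinfun_diff_left blinfun_diff_right blinfun_compose_assoc')
    also have "\<dots> = X \<tau> - ?Y"
      using iX iY by (simp add: bop_alg_simps)
    finally have eq: "?Y = X \<tau> - (X \<tau> o\<^sub>L ((face j ((u \<circ> r) k) - face j \<tau>) o\<^sub>L ?Y))" by simp
    have "norm (X \<tau> - (X \<tau> o\<^sub>L ((face j ((u \<circ> r) k) - face j \<tau>) o\<^sub>L ?Y))) \<le> norm (X \<tau>) + norm (X \<tau>) * (?d k * norm ?Y)"
      by (intro norm_diff_le norm_compose_le order_refl)
    then show ?thesis by (subst eq)
  qed
  have "(\<lambda>k. norm (X \<tau>) * ?d k) \<longlonglongrightarrow> 0" using tendsto_mult_left[OF d, of "norm (X \<tau>)"] by simp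
  then have "eventually (\<lambda>k. norm (X \<tau>) * ?d k < 1 / 2) sequentially"
    by (rule order_tendstoD) simp
  then obtain k0 where k0: "\<And>k. k \<ge> k0 \<Longrightarrow> norm (X \<tau>) * ?d k < 1 / 2"
    unfolding eventually_sequentially by blast
  define k where "k = max k0 (nat \<lceil>2 * norm (X \<tau>)\<rceil>)"
  have "norm (X \<tau>) * ?d k * norm (X (u (r k))) \<le> 1 / 2 * norm (X (u (r k)))"
    using k0[of k] by (intro mult_right_mono) (auto simp: k_def)
  then have "norm (X (u (r k))) \<le> 2 * norm (X \<tau>)" using bd[of k] by (simp add: mult.assoc)
  moreover have "2 * norm (X \<tau>) \<le> of_nat k" unfolding k_def by linarith
  moreover have "of_nat k \<le> (of_nat (r k) :: real)" using \<tau>(2) by (simp add: seq_suble)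
  ultimately show False using u(2)[of "r k"] by linarith
qed

abbreviation cutoff_op :: "nat \<Rightarrow> nat \<Rightarrow> (nat \<Rightarrow> int) op"
  where "cutoff_op n j \<equiv> mulop (\<lambda>\<xi>. of_real (cutoff n (\<xi> j)))"

lemma mulop_cutoff: "cutoff_op n j = amp j (mulop (\<lambda>m. of_real (cutoff n m)))"
  by (rule amp_mulop[where K = 1, symmetric]) (use cutoff_bounds in simp)

lemma coord_mulop_cutoff:
  "coord (cutoff_op n j f) \<xi> = of_real (cutoff n (\<xi> j)) * coord f \<xi>"
  by (rule coord_mulop[where K = 1]) (use cutoff_bounds in simp)

text \<open>
  The operator \<open>G = s D t\<close>, where \<open>s\<close>, \<open>t\<close> are built from Gabor packets and \<open>D\<close> is the direct sum of the
  inverses of the faces at the frequencies of the packets: \<open>H s D t\<close> is close to \<open>s L D t = s t\<close>, where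
  \<open>L\<close> is the direct sum of the faces, and \<open>s t\<close> is the cutoff function.
\<close>

lemma face_parametrix:
  assumes j: "j \<in> J" and u: "\<And>\<tau>. \<tau> \<in> {0..1} \<Longrightarrow> face j \<tau> \<in> Units (bop_alg (NN (J - {j})))"
    and \<epsilon>: "0 < \<epsilon>"
  obtains G n where "G \<in> carrier (bop_alg (NN J))"
    "norm ((TV J \<rho> \<sigma> o\<^sub>L G) - (proj (NN J) o\<^sub>L cutoff_op n j)) \<le> \<epsilon>"
    "norm ((G o\<^sub>L TV J \<rho> \<sigma>) - (proj (NN J) o\<^sub>L cutoff_op n j)) \<le> \<epsilon>"
proof -
  interpret wave_packets gabor "\<lambda>n. hilbert_adjoint (gabor n)" gabor_freq "sqrt 2"
    by (rule wave_packets_gabor)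
  let ?E = "NN J" and ?E' = "NN (J - {j})" and ?P = "proj (Cyl J j)"
  have "\<forall>\<tau>\<in>{0..1}. \<exists>X. X \<in> carrier (bop_alg ?E') \<and> X o\<^sub>L face j \<tau> = proj ?E' \<and> face j \<tau> o\<^sub>L X = proj ?E'"
    using u unfolding Units_bop_alg by blast
  then obtain X where X: "\<And>\<tau>. \<tau> \<in> {0..1} \<Longrightarrow> X \<tau> \<in> carrier (bop_alg ?E') \<and>
      X \<tau> o\<^sub>L face j \<tau> = proj ?E' \<and> face j \<tau> o\<^sub>L X \<tau> = proj ?E'"
    by metis
  obtain C where C: "\<And>\<tau>. \<tau> \<in> {0..1} \<Longrightarrow> norm (X \<tau>) \<le> C"
    using face_inverse_bounded[OF j X] by blast
  have C0: "0 \<le> C" using order_trans[OF norm_ge_zero C[of 0]] by simp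
  have freq01: "gabor_freq n b \<in> {0..1}" for n b
  proof -
    have "of_int (b mod int (Suc n)) \<le> (of_int (int (Suc n)) :: real)"
      unfolding of_int_le_iff by (rule less_imp_le[OF pos_mod_bound]) simp
    then show ?thesis by (auto simp: gabor_freq_def field_simps)
  qed
  define s where "s n = amp j (gabor n)" for n
  define t where "t n = amp j (hilbert_adjoint (gabor n))" for n
  define H where "H = TV J \<rho> \<sigma>"
  define L where "L n = face_symbol J j (gabor_freq n) \<rho> \<sigma>" for n
  define D where "D n = direct_sum j (\<lambda>b. X (gabor_freq n b))" for n
  define \<Phi> where "\<Phi> n = cutoff_op n j" for n
  note cl = complex_linear_gabor complex_linear_hilbert_adjoint complex_linear_proj complex_linear_compose
  have Xlin: "complex_linear (X (gabor_freq n b))" and XC: "norm (X (gabor_freq n b)) \<le> C" for n b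
    using X[OF freq01] C[OF freq01] carrier_linear by blast+
  have nD: "norm (D n) \<le> C" and clD: "complex_linear (D n)" for n
    unfolding D_def by (rule norm_direct_sum[OF XC Xlin] complex_linear_direct_sum[OF XC Xlin])+
  have PE': "proj {\<xi>. \<xi> j = 0} o\<^sub>L proj ?E' = proj ?E'"
    unfolding Cyl_slice[OF j, symmetric] by (auto intro!: op_eqI simp: coord_simps)
  have sD: "slice j b o\<^sub>L D n = X (gabor_freq n b) o\<^sub>L slice j b" for b n
  proof -
    let ?X = "X (gabor_freq n b)"
    have "proj ?E' o\<^sub>L ?X = ?X" using X[OF freq01] by (simp add: bop_alg_simps)
    then have "proj {\<xi>. \<xi> j = 0} o\<^sub>L ?X = ?X" using comp_absorb_left[OF PE', of ?X] by simp
    then show ?thesis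
      unfolding D_def slice_direct_sum[where X = "\<lambda>b. X (gabor_freq n b)", OF XC Xlin] by simp
  qed
  have sL: "slice j b o\<^sub>L L n = face j (gabor_freq n b) o\<^sub>L slice j b" for b n
    unfolding L_def by (rule slice_face_symbol[OF j \<rho> \<sigma>])
  have sP: "slice j b o\<^sub>L ?P = proj ?E' o\<^sub>L slice j b" for b
    by (simp add: slice_proj Cyl_update j Cyl_slice)
  have LD: "L n o\<^sub>L D n = ?P" for n
  proof (rule slice_ext)
    fix b
    have "slice j b o\<^sub>L (L n o\<^sub>L D n) = (slice j b o\<^sub>L L n) o\<^sub>L D n" by (simp only: blinfun_compose_assoc')
    also have "\<dots> = face j (gabor_freq n b) o\<^sub>L (slice j b o\<^sub>L D n)" by (simp only: sL blinfun_compose_assoc')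
    also have "\<dots> = (face j (gabor_freq n b) o\<^sub>L X (gabor_freq n b)) o\<^sub>L slice j b" by (simp only: sD blinfun_compose_assoc')
    also have "\<dots> = slice j b o\<^sub>L ?P" using X[OF freq01] by (simp add: sP)
    finally show "slice j b o\<^sub>L (L n o\<^sub>L D n) = slice j b o\<^sub>L ?P" .
  qed
  have DL: "D n o\<^sub>L L n = ?P" for n
  proof (rule slice_ext)
    fix b
    have "slice j b o\<^sub>L (D n o\<^sub>L L n) = (slice j b o\<^sub>L D n) o\<^sub>L L n" by (simp only: blinfun_compose_assoc')
    also have "\<dots> = X (gabor_freq n b) o\<^sub>L (slice j b o\<^sub>L L n)" by (simp only: sD blinfun_compose_assoc')
    also have "\<dots> = (X (gabor_freq n b) o\<^sub>L face j (gabor_freq n b)) o\<^sub>L slice j b" by (simp only: sL blinfun_compose_assoc')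
    also have "\<dots> = slice j b o\<^sub>L ?P" using X[OF freq01] by (simp add: sP)
    finally show "slice j b o\<^sub>L (D n o\<^sub>L L n) = slice j b o\<^sub>L ?P" .
  qed
  have ns: "norm (s n) \<le> sqrt 2" for n
    unfolding s_def by (rule order_trans[OF norm_amp[OF lin(1)] bounded(1)])
  have nt: "norm (t n) \<le> sqrt 2" for n
    unfolding t_def by (rule order_trans[OF norm_amp[OF lin(2)] bounded(2)])
  have frame: "s n o\<^sub>L (?P o\<^sub>L t n) = proj ?E o\<^sub>L \<Phi> n" for n
  proof -
    have "?P o\<^sub>L t n = t n o\<^sub>L ?P" unfolding t_def by (simp add: proj_Cyl_amp j cl)
    then have "s n o\<^sub>L (?P o\<^sub>L t n) = amp j (gabor n o\<^sub>L hilbert_adjoint (gabor n)) o\<^sub>L ?P"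
      by (simp add: s_def t_def amp_compose cl blinfun_compose_assoc')
    also have "\<dots> = \<Phi> n o\<^sub>L ?P" unfolding gabor_frame \<Phi>_def mulop_cutoff ..
    also have "\<dots> = proj ?E o\<^sub>L \<Phi> n"
      by (rule op_eqI) (auto simp: \<Phi>_def coord_mulop_cutoff coord_simps NN_eq_Cyl[OF j] cutoff_0)
    finally show ?thesis .
  qed
  have \<Phi>P: "\<Phi> n o\<^sub>L proj ?E = proj ?E o\<^sub>L \<Phi> n" for n
    by (rule op_eqI) (auto simp: \<Phi>_def coord_mulop_cutoff coord_simps)
  define G0 where "G0 n = s n o\<^sub>L (D n o\<^sub>L t n)" for n
  define e1 where "e1 n = (H o\<^sub>L s n) - (s n o\<^sub>L L n)" for n
  define e2 where "e2 n = (t n o\<^sub>L H) - (L n o\<^sub>L t n)" for n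
  have e1: "(\<lambda>n. norm (e1 n)) \<longlonglongrightarrow> 0"
    unfolding e1_def H_def L_def s_def by (rule symbol_right[OF j \<rho> \<sigma>])
  have e2: "(\<lambda>n. norm (e2 n)) \<longlonglongrightarrow> 0"
    unfolding e2_def H_def L_def t_def by (rule symbol_left[OF j \<rho> \<sigma>])
  have HG: "(H o\<^sub>L G0 n) - (proj ?E o\<^sub>L \<Phi> n) = e1 n o\<^sub>L (D n o\<^sub>L t n)" for n
  proof -
    have "e1 n o\<^sub>L (D n o\<^sub>L t n) = (H o\<^sub>L G0 n) - (s n o\<^sub>L ((L n o\<^sub>L D n) o\<^sub>L t n))"
      by (simp only: e1_def G0_def blinfun_diff_left blinfun_compose_assoc')
    then show ?thesis by (simp add: LD frame)
  qed
  have GH: "(G0 n o\<^sub>L H) - (proj ?E o\<^sub>L \<Phi> n) = (s n o\<^sub>L D n) o\<^sub>L e2 n" for n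
  proof -
    have "(s n o\<^sub>L D n) o\<^sub>L e2 n = (G0 n o\<^sub>L H) - (s n o\<^sub>L ((D n o\<^sub>L L n) o\<^sub>L t n))"
      by (simp only: e2_def G0_def blinfun_diff_right blinfun_compose_assoc')
    then show ?thesis by (simp add: DL frame)
  qed
  have lim: "(\<lambda>n. norm (e1 n) * (C * sqrt 2)) \<longlonglongrightarrow> 0" "(\<lambda>n. (sqrt 2 * C) * norm (e2 n)) \<longlonglongrightarrow> 0"
    using tendsto_mult_right[OF e1, of "C * sqrt 2"] tendsto_mult_left[OF e2, of "sqrt 2 * C"] by simp_all
  have "eventually (\<lambda>n. norm (e1 n) * (C * sqrt 2) < \<epsilon> \<and> (sqrt 2 * C) * norm (e2 n) < \<epsilon>) sequentially"
    by (intro eventually_conj order_tendstoD(2)[OF lim(1) \<epsilon>] order_tendstoD(2)[OF lim(2) \<epsilon>])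
  then obtain n where n: "norm (e1 n) * (C * sqrt 2) < \<epsilon>" "(sqrt 2 * C) * norm (e2 n) < \<epsilon>"
    unfolding eventually_sequentially by blast
  define G where "G = proj ?E o\<^sub>L G0 n o\<^sub>L proj ?E"
  have HP: "H o\<^sub>L proj ?E = H" "proj ?E o\<^sub>L H = H"
    using TV_carrier by (simp_all add: bop_alg_simps H_def)
  show ?thesis
  proof
    show "G \<in> carrier (bop_alg ?E)"
      unfolding G_def G0_def s_def t_def
      by (intro carrier_corner complex_linear_compose complex_linear_amp clD cl)
    have "H o\<^sub>L G = (H o\<^sub>L proj ?E) o\<^sub>L (G0 n o\<^sub>L proj ?E)" by (simp only: G_def blinfun_compose_assoc')
    then have "(H o\<^sub>L G) - (proj ?E o\<^sub>L \<Phi> n) = ((H o\<^sub>L G0 n) - (proj ?E o\<^sub>L \<Phi> n)) o\<^sub>L proj ?E"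
      unfolding HP blinfun_diff_left
      by (simp add: blinfun_compose_assoc' \<Phi>P) (simp add: blinfun_compose_assoc'[symmetric] proj_proj)
    also have "norm \<dots> \<le> (norm (e1 n) * (C * sqrt 2)) * 1"
      unfolding HG by (intro norm_compose_le norm_proj_le order_refl nD nt)
    finally show "norm ((TV J \<rho> \<sigma> o\<^sub>L G) - (proj ?E o\<^sub>L cutoff_op n j)) \<le> \<epsilon>"
      using n(1) by (simp add: H_def \<Phi>_def)
    have "G o\<^sub>L H = proj ?E o\<^sub>L (G0 n o\<^sub>L (proj ?E o\<^sub>L H))" by (simp only: G_def blinfun_compose_assoc')
    then have "(G o\<^sub>L H) - (proj ?E o\<^sub>L \<Phi> n) = proj ?E o\<^sub>L ((G0 n o\<^sub>L H) - (proj ?E o\<^sub>L \<Phi> n))"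
      unfolding HP blinfun_diff_right by (simp add: blinfun_compose_assoc'[symmetric] proj_proj)
    also have "norm \<dots> \<le> 1 * ((sqrt 2 * C) * norm (e2 n))"
      unfolding GH by (intro norm_compose_le norm_proj_le order_refl nD ns)
    finally show "norm ((G o\<^sub>L TV J \<rho> \<sigma>) - (proj ?E o\<^sub>L cutoff_op n j)) \<le> \<epsilon>"
      using n(2) by (simp add: H_def \<Phi>_def)
  qed
qed

text \<open>
  If \<open>B\<close> inverts \<open>H\<close> away from the support of \<open>\<psi>\<close>, and \<open>G\<close> inverts \<open>H\<close> where the cutoff \<open>\<phi>\<close> in direction \<open>j\<close>
  equals 1, then \<open>B + G \<psi>\<close> inverts \<open>H\<close> away from the support of \<open>(1 - \<phi>) \<psi>\<close>, because
  \<open>(1 - \<psi>) + \<phi> \<psi> = 1 - (1 - \<phi>) \<psi>\<close>. One direction after the other, the part of the octant that is not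
  under control becomes bounded. The induction starts with \<open>B = 0\<close> and \<open>\<psi> = 1\<close> on the octant.
\<close>

lemma partial_parametrix:
  assumes I: "finite I" "I \<subseteq> J" and \<epsilon>: "0 < \<epsilon>"
    and u: "\<And>j \<tau>. j \<in> J \<Longrightarrow> \<tau> \<in> {0..1} \<Longrightarrow> face j \<tau> \<in> Units (bop_alg (NN (J - {j})))"
  shows "\<exists>B\<in>carrier (bop_alg (NN J)). \<exists>B'\<in>carrier (bop_alg (NN J)). \<exists>\<psi> :: (nat \<Rightarrow> int) \<Rightarrow> real. \<exists>M.
     (\<forall>\<xi>. 0 \<le> \<psi> \<xi> \<and> \<psi> \<xi> \<le> 1) \<and> (\<forall>\<xi>. \<psi> \<xi> \<noteq> 0 \<longrightarrow> \<xi> \<in> NN J \<and> (\<forall>i\<in>I. \<xi> i \<le> M)) \<and>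
     norm ((TV J \<rho> \<sigma> o\<^sub>L B) - (proj (NN J) - mulop (\<lambda>\<xi>. of_real (\<psi> \<xi>)))) \<le> \<epsilon> \<and>
     norm ((B' o\<^sub>L TV J \<rho> \<sigma>) - (proj (NN J) - mulop (\<lambda>\<xi>. of_real (\<psi> \<xi>)))) \<le> \<epsilon>"
  using I \<epsilon>
proof (induction I arbitrary: \<epsilon> rule: finite_induct)
  case empty
  have "mulop (\<lambda>\<xi>. of_real (if \<xi> \<in> NN J then 1 else 0)) = proj (NN J)"
    by (rule op_eqI) (simp add: coord_mulop[where K = 1] coord_simps)
  then show ?case
    using empty carrier_diff[OF TV_carrier TV_carrier]
    by (intro bexI[of _ 0] exI[of _ "\<lambda>\<xi>. if \<xi> \<in> NN J then 1 else 0"]) auto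
next
  case (insert j I)
  let ?E = "NN J" and ?H = "TV J \<rho> \<sigma>"
  have "0 < \<epsilon> / 2" "I \<subseteq> J" using insert by auto
  from insert.IH[OF this(2,1)] obtain B B' \<psi> M where
    B: "B \<in> carrier (bop_alg ?E)" "B' \<in> carrier (bop_alg ?E)"
    and \<psi>: "\<And>\<xi>. 0 \<le> \<psi> \<xi>" "\<And>\<xi>. \<psi> \<xi> \<le> 1"
    and supp: "\<And>\<xi>. \<psi> \<xi> \<noteq> 0 \<Longrightarrow> \<xi> \<in> ?E \<and> (\<forall>i\<in>I. \<xi> i \<le> M)"
    and r: "norm ((?H o\<^sub>L B) - (proj ?E - mulop (\<lambda>\<xi>. of_real (\<psi> \<xi>)))) \<le> \<epsilon> / 2"
    and l: "norm ((B' o\<^sub>L ?H) - (proj ?E - mulop (\<lambda>\<xi>. of_real (\<psi> \<xi>)))) \<le> \<epsilon> / 2"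
    by blast
  have j: "j \<in> J" using insert.prems by blast
  obtain G n where G: "G \<in> carrier (bop_alg ?E)"
    "norm ((?H o\<^sub>L G) - (proj ?E o\<^sub>L cutoff_op n j)) \<le> \<epsilon> / 2"
    "norm ((G o\<^sub>L ?H) - (proj ?E o\<^sub>L cutoff_op n j)) \<le> \<epsilon> / 2"
    using face_parametrix[OF j u[OF j] \<open>0 < \<epsilon> / 2\<close>] by blast
  define \<Psi> where "\<Psi> = mulop (\<lambda>\<xi>. of_real (\<psi> \<xi>))"
  define \<Phi> where "\<Phi> = cutoff_op n j"
  define \<psi>' where "\<psi>' \<xi> = (1 - cutoff n (\<xi> j)) * \<psi> \<xi>" for \<xi>
  define \<Psi>' where "\<Psi>' = mulop (\<lambda>\<xi>. of_real (\<psi>' \<xi>))"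
  have \<psi>': "0 \<le> \<psi>' \<xi>" "\<psi>' \<xi> \<le> 1" for \<xi>
    using \<psi>[of \<xi>] cutoff_bounds[of n "\<xi> j"] by (auto simp: \<psi>'_def intro: mult_le_one)
  have bd: "cmod (of_real (\<psi> \<xi>)) \<le> 1" "cmod (of_real (\<psi>' \<xi>)) \<le> 1" for \<xi> using \<psi>[of \<xi>] \<psi>'[of \<xi>] by auto
  note c = coord_mulop[where K = 1 and u = "\<lambda>\<xi>. of_real (\<psi> \<xi>)", OF bd(1), folded \<Psi>_def]
    coord_mulop[where K = 1 and u = "\<lambda>\<xi>. of_real (\<psi>' \<xi>)", OF bd(2), folded \<Psi>'_def]
    coord_mulop_cutoff[of n j, folded \<Phi>_def]
  have n\<Psi>: "norm \<Psi> \<le> 1" unfolding \<Psi>_def by (rule norm_mulop[OF bd(1)])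
  have out: "\<psi> \<xi> = 0" if "\<xi> \<notin> ?E" for \<xi> using supp that by blast
  have \<Psi>: "\<Psi> \<in> carrier (bop_alg ?E)"
    using out complex_linear_mulop[where K = 1 and u = "\<lambda>\<xi>. of_real (\<psi> \<xi>)", OF bd(1), folded \<Psi>_def]
    by (auto simp: bop_alg_simps c coord_simps intro!: op_eqI)
  have eq: "proj ?E o\<^sub>L \<Phi> o\<^sub>L \<Psi> = \<Psi> - \<Psi>'" "\<Psi> o\<^sub>L (proj ?E o\<^sub>L \<Phi>) = \<Psi> - \<Psi>'"
    using out by (auto intro!: op_eqI simp: c coord_simps blinfun.diff_left blinfun.add_left \<psi>'_def algebra_simps)
  define B2 where "B2 = B + (G o\<^sub>L \<Psi>)"
  define B2' where "B2' = B' + (\<Psi> o\<^sub>L G)"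
  have "(?H o\<^sub>L B2) - (proj ?E - \<Psi>') = ((?H o\<^sub>L B) - (proj ?E - \<Psi>)) - - (((?H o\<^sub>L G) - (proj ?E o\<^sub>L \<Phi>)) o\<^sub>L \<Psi>)"
    unfolding B2_def blinfun_diff_left eq by (simp only: blinfun_compose_bilinear blinfun_compose_assoc') simp
  also have "norm \<dots> \<le> \<epsilon> / 2 + (\<epsilon> / 2) * 1"
    using norm_compose_le[OF G(2) n\<Psi>] by (intro norm_diff_le r[folded \<Psi>_def]) (simp add: \<Phi>_def)
  finally have R: "norm ((?H o\<^sub>L B2) - (proj ?E - \<Psi>')) \<le> \<epsilon>" by simp
  have "(B2' o\<^sub>L ?H) - (proj ?E - \<Psi>') = ((B' o\<^sub>L ?H) - (proj ?E - \<Psi>)) - - (\<Psi> o\<^sub>L ((G o\<^sub>L ?H) - (proj ?E o\<^sub>L \<Phi>)))"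
    unfolding B2'_def blinfun_diff_right eq by (simp only: blinfun_compose_bilinear blinfun_compose_assoc') simp
  also have "norm \<dots> \<le> \<epsilon> / 2 + 1 * (\<epsilon> / 2)"
    using norm_compose_le[OF n\<Psi> G(3)] by (intro norm_diff_le l[folded \<Psi>_def]) (simp add: \<Phi>_def)
  finally have L: "norm ((B2' o\<^sub>L ?H) - (proj ?E - \<Psi>')) \<le> \<epsilon>" by simp
  have supp': "\<xi> \<in> ?E \<and> (\<forall>i\<in>insert j I. \<xi> i \<le> max M (2 * int (Suc n)))" if nz: "\<psi>' \<xi> \<noteq> 0" for \<xi>
  proof -
    have "cutoff n (\<xi> j) \<noteq> 1" "\<psi> \<xi> \<noteq> 0" using nz by (auto simp: \<psi>'_def)
    then have "\<xi> j \<le> 2 * int (Suc n)" using cutoff_1[of n "\<xi> j"] by linarith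
    then show ?thesis using supp[OF \<open>\<psi> \<xi> \<noteq> 0\<close>] by (auto simp: le_max_iff_disj)
  qed
  have B2: "B2 \<in> carrier (bop_alg ?E)" "B2' \<in> carrier (bop_alg ?E)"
    unfolding B2_def B2'_def by (intro carrier_plus carrier_compose B G \<Psi>)+
  show ?case
    by (rule bexI[OF _ B2(1)], rule bexI[OF _ B2(2)], rule exI[of _ \<psi>'], rule exI[of _ "max M (2 * int (Suc n))"])
       (use \<psi>' supp' R L in \<open>auto simp: \<Psi>'_def\<close>)
qed

lemma finite_box: "finite J \<Longrightarrow> finite {\<xi> \<in> NN J. \<forall>i\<in>J. \<xi> i \<le> M}"
proof (rule finite_subset[OF _ finite_set_of_finite_funs[of J "{1..M}" 0]])
  show "{\<xi> \<in> NN J. \<forall>i\<in>J. \<xi> i \<le> M} \<subseteq> {f. \<forall>x. (x \<in> J \<longrightarrow> f x \<in> {1..M}) \<and> (x \<notin> J \<longrightarrow> f x = 0)}"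
    by (auto simp: NN_def ZZ_def)
qed auto

text \<open>
  Once all directions are used, \<open>\<psi>\<close> has finite support and is compact, and the error of norm less than 1
  is removed by a Neumann series.
\<close>

lemma calkin_Units_if_faces:
  assumes J: "finite J"
    and u: "\<And>j \<tau>. j \<in> J \<Longrightarrow> \<tau> \<in> {0..1} \<Longrightarrow> face j \<tau> \<in> Units (bop_alg (NN (J - {j})))"
  shows "calkin_map (NN J) (TV J \<rho> \<sigma>) \<in> Units (calkin (NN J))"
proof -
  let ?E = "NN J" and ?H = "TV J \<rho> \<sigma>"
  have half: "(0 :: real) < 1 / 2" by simp
  obtain B B' \<psi> M where
    B: "B \<in> carrier (bop_alg ?E)" "B' \<in> carrier (bop_alg ?E)"
    and \<psi>: "\<And>\<xi>. 0 \<le> \<psi> \<xi>" "\<And>\<xi>. \<psi> \<xi> \<le> 1"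
    and supp: "\<And>\<xi>. \<psi> \<xi> \<noteq> 0 \<Longrightarrow> \<xi> \<in> ?E \<and> (\<forall>i\<in>J. \<xi> i \<le> M)"
    and r: "norm ((?H o\<^sub>L B) - (proj ?E - mulop (\<lambda>\<xi>. of_real (\<psi> \<xi>)))) \<le> 1 / 2"
    and l: "norm ((B' o\<^sub>L ?H) - (proj ?E - mulop (\<lambda>\<xi>. of_real (\<psi> \<xi>)))) \<le> 1 / 2"
    using partial_parametrix[OF J order_refl half u] by blast
  define \<Psi> where "\<Psi> = mulop (\<lambda>\<xi>. of_real (\<psi> \<xi>))"
  have K: "\<Psi> \<in> compact_ops ?E"
    unfolding \<Psi>_def
    by (rule finite_support_compact[OF finite_box[OF J, of M], where K = 1]) (use supp \<psi> in auto)
  note H = TV_carrier and \<Psi> = compact_ops_carrier[OF K]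
  have HB: "?H o\<^sub>L B \<in> carrier (bop_alg ?E)" "B' o\<^sub>L ?H \<in> carrier (bop_alg ?E)"
    by (intro carrier_compose H B)+
  define e where "e = (proj ?E - \<Psi>) - (?H o\<^sub>L B)"
  define e' where "e' = (proj ?E - \<Psi>) - (B' o\<^sub>L ?H)"
  have e: "e \<in> carrier (bop_alg ?E)" "norm e < 1" "e' \<in> carrier (bop_alg ?E)" "norm e' < 1"
    using r l by (auto simp: e_def e'_def norm_minus_commute \<Psi>_def[symmetric] intro: carrier_diff carrier_proj \<Psi> HB)
  obtain Y where Y: "Y \<in> carrier (bop_alg ?E)" "(proj ?E - e) o\<^sub>L Y = proj ?E"
    using neumann_corner[OF e(1,2)] by blast
  obtain Y' where Y': "Y' \<in> carrier (bop_alg ?E)" "Y' o\<^sub>L (proj ?E - e') = proj ?E"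
    using neumann_corner[OF e(3,4)] by blast
  have "?H o\<^sub>L B = (proj ?E - e) - \<Psi>" "B' o\<^sub>L ?H = (proj ?E - e') - \<Psi>" by (simp_all add: e_def e'_def)
  note split = this
  have "?H o\<^sub>L (B o\<^sub>L Y) = (?H o\<^sub>L B) o\<^sub>L Y" by (simp only: blinfun_compose_assoc')
  then have 1: "(?H o\<^sub>L (B o\<^sub>L Y)) - proj ?E = - (\<Psi> o\<^sub>L Y)"
    unfolding split(1) blinfun_diff_left[of "proj ?E - e"] Y(2) by simp
  have "(Y' o\<^sub>L B') o\<^sub>L ?H = Y' o\<^sub>L (B' o\<^sub>L ?H)" by (simp only: blinfun_compose_assoc')
  then have 2: "((Y' o\<^sub>L B') o\<^sub>L ?H) - proj ?E = - (Y' o\<^sub>L \<Psi>)"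
    unfolding split(2) blinfun_diff_right[of _ "proj ?E - e'"] Y'(2) by simp
  have par: "(?H o\<^sub>L (B o\<^sub>L Y)) - proj ?E \<in> compact_ops ?E" "((Y' o\<^sub>L B') o\<^sub>L ?H) - proj ?E \<in> compact_ops ?E"
    unfolding 1 2 using K Y(1) Y'(1) by (auto intro: compact_ops_uminus compact_ops_left compact_ops_right)
  have car: "B o\<^sub>L Y \<in> carrier (bop_alg ?E)" "Y' o\<^sub>L B' \<in> carrier (bop_alg ?E)"
    by (intro carrier_compose B Y Y')+
  show ?thesis
    unfolding calkin_map_Units_iff[OF H]
    using parametrix_left_right[OF H car par] par(2) car(2) by blast
qed

theorem calkin_Units_iff_faces:
  assumes "finite J"
  shows "calkin_map (NN J) (TV J \<rho> \<sigma>) \<in> Units (calkin (NN J)) \<longleftrightarrow>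
    (\<forall>j\<in>J. \<forall>\<tau>\<in>{0..1}. face j \<tau> \<in> Units (bop_alg (NN (J - {j}))))"
  using calkin_Units_if_faces[OF assms] face_Units_if_parametrix
  unfolding calkin_map_Units_iff[OF TV_carrier] by blast

end

section \<open>The essential spectrum\<close>

definition minus_delta :: "((nat \<Rightarrow> int) \<Rightarrow> complex) \<Rightarrow> complex \<Rightarrow> (nat \<Rightarrow> int) \<Rightarrow> complex"
  where "minus_delta \<rho> z \<eta> = \<rho> \<eta> - (if \<eta> = 0 then z else 0)"

lemma zero_ZZ: "0 \<in> ZZ J"
  by (simp add: ZZ_def)

lemma delta_summable: "(\<lambda>\<eta>. cmod (if \<eta> = 0 then z else 0)) summable_on A"
proof -
  have "(\<lambda>\<eta>. cmod (if \<eta> = 0 then z else 0)) summable_on (A \<inter> {0})"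
    by (rule summable_on_finite) simp
  then show ?thesis by (rule summable_on_cong_neutral[THEN iffD1, rotated -1]) auto
qed

lemma abs_summable_minus_delta:
  assumes "(\<lambda>\<eta>. cmod (\<rho> \<eta>)) summable_on ZZ J"
  shows "(\<lambda>\<eta>. cmod (minus_delta \<rho> z \<eta>)) summable_on ZZ J"
  by (rule summable_on_comparison_test[OF summable_on_add[OF assms delta_summable[of z]]])
     (auto simp: minus_delta_def norm_triangle_ineq4)

lemma toeplitz_T_minus_delta:
  assumes "(\<lambda>\<eta>. cmod (\<rho> \<eta>)) summable_on ZZ J"
  shows "toeplitz_T J (minus_delta \<rho> z) = toeplitz_T J \<rho> - (scalar z o\<^sub>L proj (NN J))"
proof -
  let ?v = "trunc_shift (NN J)"
  have v0: "?v 0 = proj (NN J)"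
    by (rule op_eqI) (simp add: coord_trunc_shift coord_simps)
  have "(\<Sum>\<^sub>\<infinity>\<eta>\<in>ZZ J. scalar (if \<eta> = 0 then z else 0) o\<^sub>L ?v \<eta>) = (\<Sum>\<^sub>\<infinity>\<eta>\<in>{0}. scalar z o\<^sub>L ?v \<eta>)"
    using zero_ZZ by (intro infsum_cong_neutral) (auto intro!: op_eqI simp: coord_simps)
  then have d: "(\<Sum>\<^sub>\<infinity>\<eta>\<in>ZZ J. scalar (if \<eta> = 0 then z else 0) o\<^sub>L ?v \<eta>) = scalar z o\<^sub>L proj (NN J)"
    by (simp add: v0)
  have "scalar (\<rho> \<eta>) o\<^sub>L ?v \<eta> = (scalar (minus_delta \<rho> z \<eta>) o\<^sub>L ?v \<eta>) + (scalar (if \<eta> = 0 then z else 0) o\<^sub>L ?v \<eta>)" for \<eta>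
    by (rule op_eqI) (simp add: minus_delta_def coord_simps blinfun.add_left algebra_simps)
  then have "toeplitz_T J \<rho> = toeplitz_T J (minus_delta \<rho> z) + (\<Sum>\<^sub>\<infinity>\<eta>\<in>ZZ J. scalar (if \<eta> = 0 then z else 0) o\<^sub>L ?v \<eta>)"
    unfolding toeplitz_T_def
    by (simp add: infsum_add abs_summable_scalar(2)[OF abs_summable_minus_delta[OF assms] norm_trunc_shift_le]
        abs_summable_scalar(2)[OF delta_summable norm_trunc_shift_le])
  then show ?thesis by (simp add: d)
qed

lemma nu_minus_delta:
  assumes j: "j \<in> J" and \<rho>: "(\<lambda>\<eta>. cmod (\<rho> \<eta>)) summable_on ZZ J" and x: "x \<in> ZZ (J - {j})"
  shows "nu j \<tau> (minus_delta \<rho> z) x = minus_delta (nu j \<tau> \<rho>) z x"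
proof -
  have x0: "x(j := m) = 0 \<longleftrightarrow> x = 0 \<and> m = 0" for m
    using x by (auto simp: ZZ_def fun_eq_iff)
  have s: "(\<lambda>m. chi (- (of_int m * \<tau>)) * \<rho>' (x(j := m))) summable_on UNIV"
    if \<rho>': "(\<lambda>\<eta>. cmod (\<rho>' \<eta>)) summable_on ZZ J" for \<rho>'
  proof -
    have "(\<lambda>(z, m). cmod (\<rho>' (z(j := m)))) summable_on ZZ (J - {j}) \<times> UNIV"
      by (rule summable_ZZ_split[OF j \<rho>'])
    from summable_on_SigmaD1[OF this x]
    have "(\<lambda>m. cmod (chi (- (of_int m * \<tau>)) * \<rho>' (x(j := m)))) summable_on UNIV"
      by (simp add: norm_mult)
    then show ?thesis by (rule abs_summable_summable)
  qed
  have "(\<Sum>\<^sub>\<infinity>m. chi (- (of_int m * \<tau>)) * (if x(j := m) = 0 then z else 0)) = (\<Sum>\<^sub>\<infinity>m\<in>{0 :: int}. if x = 0 then z else 0)"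
    by (rule infsum_cong_neutral) (auto simp: x0)
  moreover have "chi (- (of_int m * \<tau>)) * \<rho> (x(j := m)) = chi (- (of_int m * \<tau>)) * minus_delta \<rho> z (x(j := m))
      + chi (- (of_int m * \<tau>)) * (if x(j := m) = 0 then z else 0)" for m
    by (simp add: minus_delta_def algebra_simps)
  ultimately have "nu j \<tau> \<rho> x = nu j \<tau> (minus_delta \<rho> z) x + (if x = 0 then z else 0)"
    unfolding nu_chi using s[OF abs_summable_minus_delta[OF \<rho>]] s[OF delta_summable] by (simp add: infsum_add)
  then show ?thesis by (simp add: minus_delta_def)
qed

lemma toeplitz_T_cong: "(\<And>\<eta>. \<eta> \<in> ZZ J \<Longrightarrow> \<rho> \<eta> = \<rho>' \<eta>) \<Longrightarrow> toeplitz_T J \<rho> = toeplitz_T J \<rho>'"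
  unfolding toeplitz_T_def by (rule infsum_cong) simp

lemma ess_spectrum_iff:
  assumes A: "A \<in> carrier (bop_alg E)"
  shows "z \<in> ess_spectrum E A \<longleftrightarrow> calkin_map E (A - (scalar z o\<^sub>L proj E)) \<notin> Units (calkin E)"
proof -
  interpret ideal "compact_ops E" "bop_alg E" by (rule ideal_compact_ops)
  have hom: "calkin_map E \<in> ring_hom (bop_alg E) (calkin E)"
    using rcos_ring_hom by (simp add: calkin_def calkin_map_def[abs_def])
  interpret h: ring_hom_ring "bop_alg E" "calkin E" "calkin_map E"
    by (intro ring_hom_ringI2 ring_bop_alg hom) (simp add: calkin_def quotient_is_ring)
  have S: "scalar z o\<^sub>L proj E \<in> carrier (bop_alg E)" by (rule scalar_proj_carrier)
  have "calkin_map E A \<ominus>\<^bsub>calkin E\<^esub> calkin_map E (scalar z o\<^sub>L proj E) = calkin_map E (A \<ominus>\<^bsub>bop_alg E\<^esub> (scalar z o\<^sub>L proj E))"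
    using A S by (simp add: a_minus_def)
  then show ?thesis
    by (simp add: ess_spectrum_def alg_spectrum_def bop_alg_minus[OF A S])
qed

theorem ess_spectrum_toeplitz:
  assumes J: "finite J"
    and \<rho>: "(\<lambda>\<eta>. cmod (\<rho> \<eta>)) summable_on ZZ J" and \<sigma>: "(\<lambda>\<eta>. cmod (\<sigma> \<eta>)) summable_on ZZ J"
  shows "ess_spectrum (NN J) (TV J \<rho> \<sigma>) =
    (\<Union>j\<in>J. \<Union>\<tau>\<in>{0..1}. spectrum (NN (J - {j})) (TV (J - {j}) (nu j \<tau> \<rho>) (nu j 0 \<sigma>)))"
proof (rule Set.set_eqI)
  fix z
  have \<rho>z: "(\<lambda>\<eta>. cmod (minus_delta \<rho> z \<eta>)) summable_on ZZ J" by (rule abs_summable_minus_delta[OF \<rho>])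
  have eq: "TV J \<rho> \<sigma> - (scalar z o\<^sub>L proj (NN J)) = TV J (minus_delta \<rho> z) \<sigma>"
    by (simp add: toeplitz_T_minus_delta[OF \<rho>])
  have "z \<in> ess_spectrum (NN J) (TV J \<rho> \<sigma>) \<longleftrightarrow>
      (\<exists>j\<in>J. \<exists>\<tau>\<in>{0..1}. TV (J - {j}) (nu j \<tau> (minus_delta \<rho> z)) (nu j 0 \<sigma>) \<notin> Units (bop_alg (NN (J - {j}))))"
    unfolding ess_spectrum_iff[OF TV_carrier[OF \<rho> \<sigma>]] eq calkin_Units_iff_faces[OF \<rho>z \<sigma> J] by blast
  also have "\<dots> \<longleftrightarrow> (\<exists>j\<in>J. \<exists>\<tau>\<in>{0..1}. z \<in> spectrum (NN (J - {j})) (TV (J - {j}) (nu j \<tau> \<rho>) (nu j 0 \<sigma>)))"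
  proof (intro bex_cong refl)
    fix j \<tau> assume j: "j \<in> J"
    have "toeplitz_T (J - {j}) (nu j \<tau> (minus_delta \<rho> z)) = toeplitz_T (J - {j}) (nu j \<tau> \<rho>) - (scalar z o\<^sub>L proj (NN (J - {j})))"
      unfolding toeplitz_T_minus_delta[OF abs_summable_nu[OF j \<rho>], symmetric]
      by (rule toeplitz_T_cong) (rule nu_minus_delta[OF j \<rho>])
    then have eq2: "TV (J - {j}) (nu j \<tau> (minus_delta \<rho> z)) (nu j 0 \<sigma>) =
        TV (J - {j}) (nu j \<tau> \<rho>) (nu j 0 \<sigma>) - (scalar z o\<^sub>L proj (NN (J - {j})))" by simp
    show "TV (J - {j}) (nu j \<tau> (minus_delta \<rho> z)) (nu j 0 \<sigma>) \<notin> Units (bop_alg (NN (J - {j}))) \<longleftrightarrow>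
        z \<in> spectrum (NN (J - {j})) (TV (J - {j}) (nu j \<tau> \<rho>) (nu j 0 \<sigma>))"
      by (simp only: spectrum_def alg_spectrum_def mem_Collect_eq eq2
          bop_alg_minus[OF face_carrier[OF \<rho> \<sigma> j] scalar_proj_carrier])
  qed
  finally show "z \<in> ess_spectrum (NN J) (TV J \<rho> \<sigma>) \<longleftrightarrow>
    z \<in> (\<Union>j\<in>J. \<Union>\<tau>\<in>{0..1}. spectrum (NN (J - {j})) (TV (J - {j}) (nu j \<tau> \<rho>) (nu j 0 \<sigma>)))"
    by blast
qed

lemma inj_on_theta_inv: "inj_on (theta_inv N) (ZZ {1..N})"
proof (rule inj_onI, rule ext)
  fix z z' i
  assume z: "z \<in> ZZ {1..N}" "z' \<in> ZZ {1..N}" and eq: "theta_inv N z = theta_inv N z'"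
  have sums: "(\<Sum>l=1..i. z l) = (\<Sum>l=1..i. z' l)" if "i \<le> N" for i
  proof (cases "i = 0")
    case False then show ?thesis using fun_cong[OF eq, of i] that by (simp add: theta_inv_def)
  qed simp
  show "z i = z' i"
  proof (cases "i \<in> {1..N}")
    case True
    then obtain k where k: "i = Suc k" by (cases i) auto
    show ?thesis using sums[of i] sums[of k] True by (simp add: k)
  next
    case False then show ?thesis using z by (simp add: ZZ_def)
  qed
qed

text \<open>
  The transform \<open>mu\<close> is \<open>nu 1\<close> after the change of variables \<^const>\<open>theta_inv\<close>.
\<close>

lemma abs_summable_mu:
  assumes N: "1 \<le> N" and \<rho>: "(\<lambda>z. cmod (\<rho> z)) summable_on ZZ {1..N}"
  shows "(\<lambda>z. cmod (mu N \<tau> \<rho> z)) summable_on ZZ {2..N}"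
proof -
  have "theta_inv N ` ZZ {1..N} \<subseteq> ZZ {1..N}" by (auto simp: theta_inv_def ZZ_def)
  then have "(\<lambda>z. cmod (\<rho> z)) summable_on theta_inv N ` ZZ {1..N}"
    by (rule summable_on_subset_banach[OF \<rho>])
  then have "(\<lambda>z. cmod ((\<rho> \<circ> theta_inv N) z)) summable_on ZZ {1..N}"
    using summable_on_reindex[OF inj_on_theta_inv, of "\<lambda>z. cmod (\<rho> z)" N] by (simp add: o_def)
  moreover have "mu N \<tau> \<rho> = nu 1 \<tau> (\<rho> \<circ> theta_inv N)" by (simp add: mu_def nu_def)
  moreover have "{1..N} - {1} = {2..N}" by auto
  moreover have "1 \<in> {1..N}" using N by simp
  ultimately show ?thesis using abs_summable_nu[of 1 "{1..N}" "\<rho> \<circ> theta_inv N" \<tau>] by metis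
qed

theorem theorem4p2:
  fixes N :: nat and \<phi> \<psi> :: "(nat \<Rightarrow> int) \<Rightarrow> real" and \<tau> :: real
  assumes "1 \<le> N"
    and "(\<lambda>z. \<bar>\<phi> z\<bar>) summable_on ZZ {1..N}"
    and "(\<lambda>z. \<bar>\<psi> z\<bar>) summable_on ZZ {1..N}"
    and "\<tau> \<in> {0..1}"
  shows "ess_spectrum (NN {2..N})
           (toeplitz_T {2..N} (mu N \<tau> (\<lambda>z. complex_of_real (\<phi> z))) +
            toeplitz_V {2..N} (mu N 0 (\<lambda>z. complex_of_real (\<psi> z)))) =
         (\<Union>j\<in>{2..N}. \<Union>\<tau>'\<in>{0..1}.
            spectrum (NN ({2..N} - {j}))
              (toeplitz_T ({2..N} - {j}) (nu j \<tau>' (mu N \<tau> (\<lambda>z. complex_of_real (\<phi> z)))) +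
               toeplitz_V ({2..N} - {j}) (nu j 0 (mu N 0 (\<lambda>z. complex_of_real (\<psi> z))))))"
  using assms by (intro ess_spectrum_toeplitz abs_summable_mu) simp_all

end
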